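(* Every semisimple real Lie group of even dimension admits a left invariant complex structure. Every semisimple real Lie group of odd dimension admits a left invariant $CR$ structure of hypersurface type.
   Context: A $CR$ structure on a smooth real manifold $M$ is a smooth complex subbundle $T^{0,1}M$ of $T^{\mathbb{C}}M$ with $T^{0,1}M\cap\overline{T^{0,1}M}=0$ that is closed under brackets of sections. If $n$ is the rank of $T^{0,1}M$, the $CR$ codimension is $\dim_{\mathbb{R}}M-2n$; it is of hypersurface type if the $CR$ codimension is $1$, and it is a complex structure if the $CR$ codimension is $0$. A $CR$ structure on a Lie group $\mathbf{G}_0$ is left invariant if left translations are $CR$ maps; such structures correspond to complex Lie subalgebras $\mathfrak{q}$ of the complexification $\mathfrak{g}$ of $\mathfrak{g}_0=\mathrm{Lie}(\mathbf{G}_0)$ with $\mathfrak{q}\cap\bar{\mathfrak{q}}=0$, where $\mathfrak q=T^{0,1}_e\mathbf G_0$. No right invariance is required. *)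

theory Defs
  imports "HOL-Analysis.Analysis" "HOL-Library.Function_Algebras"
begin

section \<open>Smooth manifolds\<close>

primrec C_k_on :: "nat \<Rightarrow> 'a::real_normed_vector set \<Rightarrow> ('a \<Rightarrow> 'b::real_normed_vector) \<Rightarrow> bool" where
  "C_k_on 0 S f \<longleftrightarrow> continuous_on S f"
| "C_k_on (Suc k) S f \<longleftrightarrow>
     (\<forall>x\<in>S. f differentiable (at x)) \<and> (\<forall>v. C_k_on k S (\<lambda>x. frechet_derivative f (at x) v))"

text \<open>Used only for open \<open>S\<close> and finite-dimensional domains, where \<open>C_k_on k S f\<close> is the usual
  \<open>C\<^sup>k\<close> condition.\<close>

definition smooth_on :: "'a::real_normed_vector set \<Rightarrow> ('a \<Rightarrow> 'b::real_normed_vector) \<Rightarrow> bool" where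
  "smooth_on S f \<longleftrightarrow> (\<forall>k. C_k_on k S f)"

text \<open>A chart is a pair of a domain and a coordinate map; the coordinate map matters only on the
  domain.  The whole type \<open>'m\<close> is the manifold.  The model space \<open>'e\<close> is a finite-dimensional real
  inner product space; in contrast to \<open>euclidean_space\<close> this includes dimension \<open>0\<close>.  Charts take
  values in one fixed \<open>'e\<close>, so manifolds have constant dimension.\<close>

type_synonym ('m, 'e) atlas = "('m set \<times> ('m \<Rightarrow> 'e)) set"

definition smooth_manifold ::
    "('m::{t2_space,second_countable_topology}, 'e::real_inner) atlas \<Rightarrow> bool" where
  "smooth_manifold A \<longleftrightarrow>
     (\<exists>B::'e set. finite B \<and> span B = UNIV) \<and>
     (\<Union>(U, \<phi>)\<in>A. U) = UNIV \<and>
     (\<forall>(U, \<phi>)\<in>A. open U \<and> open (\<phi> ` U) \<and> homeomorphism U (\<phi> ` U) \<phi> (inv_into U \<phi>)) \<and>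
     (\<forall>(U, \<phi>)\<in>A. \<forall>(V, \<psi>)\<in>A. smooth_on (\<phi> ` (U \<inter> V)) (\<psi> \<circ> inv_into U \<phi>))"

definition manifold_dim :: "('m, 'e::real_inner) atlas \<Rightarrow> nat" where
  "manifold_dim A = dim (UNIV :: 'e set)"

definition smooth_map ::
    "('m::topological_space, 'e::real_inner) atlas \<Rightarrow> ('n::topological_space, 'f::real_inner) atlas
      \<Rightarrow> ('m \<Rightarrow> 'n) \<Rightarrow> bool" where
  "smooth_map A B F \<longleftrightarrow> continuous_on UNIV F \<and>
     (\<forall>(U, \<phi>)\<in>A. \<forall>(V, \<psi>)\<in>B. smooth_on (\<phi> ` (U \<inter> F -` V)) (\<psi> \<circ> F \<circ> inv_into U \<phi>))"

definition prod_atlas :: "('m, 'e) atlas \<Rightarrow> ('n, 'f) atlas \<Rightarrow> ('m \<times> 'n, 'e \<times> 'f) atlas" where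
  "prod_atlas A B = {(U \<times> V, map_prod \<phi> \<psi>) |U \<phi> V \<psi>. (U, \<phi>) \<in> A \<and> (V, \<psi>) \<in> B}"

definition smooth_fun :: "('m, 'e::real_inner) atlas \<Rightarrow> ('m \<Rightarrow> 'k::real_normed_vector) set" where
  "smooth_fun A = {f. \<forall>(U, \<phi>)\<in>A. smooth_on (\<phi> ` U) (f \<circ> inv_into U \<phi>)}"


section \<open>Tangent vectors and vector fields\<close>

text \<open>Scalars \<open>'k\<close> are \<open>real\<close> or \<open>complex\<close>.  Tangent vectors at \<open>p\<close> are the \<open>'k\<close>-linear derivations
  at \<open>p\<close> of the algebra of smooth \<open>'k\<close>-valued functions: for \<open>'k = real\<close> they form the tangent space
  \<open>T\<^sub>pM\<close>, and for \<open>'k = complex\<close> its complexification.  They are set to \<open>0\<close> on non-smooth functions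
  so that a tangent vector is determined by its values on smooth ones.  Addition and
  multiplication of functions are pointwise.\<close>

type_synonym ('m, 'k) tvec = "('m \<Rightarrow> 'k) \<Rightarrow> 'k"
type_synonym ('m, 'k) vfield = "'m \<Rightarrow> ('m, 'k) tvec"

definition fscale :: "'k::field \<Rightarrow> ('b \<Rightarrow> 'k) \<Rightarrow> 'b \<Rightarrow> 'k" where
  "fscale a v = (\<lambda>x. a * v x)"

interpretation tvec: vector_space fscale
  by unfold_locales (auto simp: fscale_def fun_eq_iff algebra_simps)

definition vfscale :: "'k::field \<Rightarrow> ('m, 'k) vfield \<Rightarrow> ('m, 'k) vfield" where
  "vfscale a X = (\<lambda>p. fscale a (X p))"

interpretation vfield: vector_space vfscale
  by unfold_locales (auto simp: vfscale_def fscale_def fun_eq_iff algebra_simps)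

definition tangent_space ::
    "('m, 'e::real_inner) atlas \<Rightarrow> 'm \<Rightarrow> ('m, 'k::real_normed_field) tvec set" where
  "tangent_space A p = {v.
     (\<forall>f\<in>smooth_fun A. \<forall>g\<in>smooth_fun A. v (f + g) = v f + v g) \<and>
     (\<forall>a. \<forall>f\<in>smooth_fun A. v (fscale a f) = a * v f) \<and>
     (\<forall>f\<in>smooth_fun A. \<forall>g\<in>smooth_fun A. v (f * g) = v f * g p + f p * v g) \<and>
     (\<forall>f. f \<notin> smooth_fun A \<longrightarrow> v f = 0)}"

definition differential ::
    "('n, 'f::real_inner) atlas \<Rightarrow> ('m \<Rightarrow> 'n) \<Rightarrow> ('m, 'k::real_normed_field) tvec \<Rightarrow> ('n, 'k) tvec" where
  "differential B F v = (\<lambda>f. if f \<in> smooth_fun B then v (f \<circ> F) else 0)"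

definition smooth_vector_field ::
    "('m, 'e::real_inner) atlas \<Rightarrow> ('m, 'k::real_normed_field) vfield \<Rightarrow> bool" where
  "smooth_vector_field A X \<longleftrightarrow>
     (\<forall>p. X p \<in> tangent_space A p) \<and> (\<forall>f\<in>smooth_fun A. (\<lambda>p. X p f) \<in> smooth_fun A)"

definition bracket ::
    "('m, 'k::real_normed_field) vfield \<Rightarrow> ('m, 'k) vfield \<Rightarrow> ('m, 'k) vfield" where
  "bracket X Y = (\<lambda>p f. X p (\<lambda>q. Y q f) - Y p (\<lambda>q. X q f))"


section \<open>CR structures\<close>

definition conj_tvec :: "('m, complex) tvec \<Rightarrow> ('m, complex) tvec" where
  "conj_tvec v = (\<lambda>f. cnj (v (cnj \<circ> f)))"

text \<open>By means of cut-off functions, every local smooth frame is, near a given point, the restriction of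
  global smooth vector fields, and closure under brackets can be tested on global sections.\<close>

definition smooth_complex_subbundle ::
    "('m::topological_space, 'e::real_inner) atlas \<Rightarrow> nat \<Rightarrow> ('m \<Rightarrow> ('m, complex) tvec set) \<Rightarrow> bool"
  where
  "smooth_complex_subbundle A n H \<longleftrightarrow>
     (\<forall>p. H p \<subseteq> tangent_space A p \<and> tvec.subspace (H p) \<and> tvec.dim (H p) = n) \<and>
     (\<forall>p. \<exists>U X. open U \<and> p \<in> U \<and> (\<forall>i<n. smooth_vector_field A (X i)) \<and>
        (\<forall>q\<in>U. H q = tvec.span ((\<lambda>i. X i q) ` {..<n})))"

definition smooth_section ::
    "('m, 'e::real_inner) atlas \<Rightarrow> ('m \<Rightarrow> ('m, complex) tvec set) \<Rightarrow> ('m, complex) vfield \<Rightarrow> bool"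
  where
  "smooth_section A H X \<longleftrightarrow> smooth_vector_field A X \<and> (\<forall>p. X p \<in> H p)"

text \<open>\<open>H p\<close> is the fibre of \<open>T\<^sup>0\<^sup>,\<^sup>1M\<close> at \<open>p\<close>, and \<open>n\<close> is its rank.\<close>

definition CR_structure ::
    "('m::topological_space, 'e::real_inner) atlas \<Rightarrow> nat \<Rightarrow> ('m \<Rightarrow> ('m, complex) tvec set) \<Rightarrow> bool"
  where
  "CR_structure A n H \<longleftrightarrow>
     smooth_complex_subbundle A n H \<and>
     (\<forall>p. H p \<inter> conj_tvec ` H p = {0}) \<and>
     (\<forall>X Y. smooth_section A H X \<and> smooth_section A H Y \<longrightarrow> smooth_section A H (bracket X Y))"

definition CR_codim :: "('m, 'e::real_inner) atlas \<Rightarrow> nat \<Rightarrow> int" where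
  "CR_codim A n = int (manifold_dim A) - 2 * int n"

definition complex_structure ::
    "('m::topological_space, 'e::real_inner) atlas \<Rightarrow> ('m \<Rightarrow> ('m, complex) tvec set) \<Rightarrow> bool" where
  "complex_structure A H \<longleftrightarrow> (\<exists>n. CR_structure A n H \<and> CR_codim A n = 0)"

definition hypersurface_CR_structure ::
    "('m::topological_space, 'e::real_inner) atlas \<Rightarrow> ('m \<Rightarrow> ('m, complex) tvec set) \<Rightarrow> bool" where
  "hypersurface_CR_structure A H \<longleftrightarrow> (\<exists>n. CR_structure A n H \<and> CR_codim A n = 1)"

definition CR_map ::
    "('m::topological_space, 'e::real_inner) atlas \<Rightarrow> ('m \<Rightarrow> ('m, complex) tvec set)
      \<Rightarrow> ('n::topological_space, 'f::real_inner) atlas \<Rightarrow> ('n \<Rightarrow> ('n, complex) tvec set)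
      \<Rightarrow> ('m \<Rightarrow> 'n) \<Rightarrow> bool" where
  "CR_map A H B K F \<longleftrightarrow> smooth_map A B F \<and> (\<forall>p. differential B F ` H p \<subseteq> K (F p))"


section \<open>Semisimple Lie groups\<close>

text \<open>The Lie algebra predicates are relative to a scalar multiplication \<open>s\<close> and a bracket \<open>br\<close>.\<close>

definition lie_ideal ::
    "(real \<Rightarrow> 'a::ab_group_add \<Rightarrow> 'a) \<Rightarrow> ('a \<Rightarrow> 'a \<Rightarrow> 'a) \<Rightarrow> 'a set \<Rightarrow> 'a set \<Rightarrow> bool" where
  "lie_ideal s br L I \<longleftrightarrow> I \<subseteq> L \<and> module.subspace s I \<and> (\<forall>x\<in>L. \<forall>y\<in>I. br x y \<in> I)"

primrec derived_series ::
    "(real \<Rightarrow> 'a::ab_group_add \<Rightarrow> 'a) \<Rightarrow> ('a \<Rightarrow> 'a \<Rightarrow> 'a) \<Rightarrow> 'a set \<Rightarrow> nat \<Rightarrow> 'a set" where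
  "derived_series s br I 0 = I"
| "derived_series s br I (Suc k) =
     module.span s {br x y |x y. x \<in> derived_series s br I k \<and> y \<in> derived_series s br I k}"

definition lie_solvable ::
    "(real \<Rightarrow> 'a::ab_group_add \<Rightarrow> 'a) \<Rightarrow> ('a \<Rightarrow> 'a \<Rightarrow> 'a) \<Rightarrow> 'a set \<Rightarrow> bool" where
  "lie_solvable s br I \<longleftrightarrow> (\<exists>k. derived_series s br I k = {0})"

definition lie_semisimple ::
    "(real \<Rightarrow> 'a::ab_group_add \<Rightarrow> 'a) \<Rightarrow> ('a \<Rightarrow> 'a \<Rightarrow> 'a) \<Rightarrow> 'a set \<Rightarrow> bool" where
  "lie_semisimple s br L \<longleftrightarrow> (\<forall>I. lie_ideal s br L I \<and> lie_solvable s br I \<longrightarrow> I = {0})"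

definition lie_group ::
    "('g::{t2_space,second_countable_topology}, 'e::real_inner) atlas
      \<Rightarrow> ('g \<Rightarrow> 'g \<Rightarrow> 'g) \<Rightarrow> 'g \<Rightarrow> ('g \<Rightarrow> 'g) \<Rightarrow> bool" where
  "lie_group A mul e iv \<longleftrightarrow>
     smooth_manifold A \<and> group mul e iv \<and>
     smooth_map (prod_atlas A A) A (\<lambda>(x, y). mul x y) \<and> smooth_map A A iv"

text \<open>The Lie algebra is the space of left invariant real vector fields.\<close>

definition lie_algebra_of ::
    "('g, 'e::real_inner) atlas \<Rightarrow> ('g \<Rightarrow> 'g \<Rightarrow> 'g) \<Rightarrow> ('g, real) vfield set" where
  "lie_algebra_of A mul =
     {X. smooth_vector_field A X \<and> (\<forall>g p. differential A (mul g) (X p) = X (mul g p))}"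

definition semisimple_lie_group ::
    "('g::{t2_space,second_countable_topology}, 'e::real_inner) atlas
      \<Rightarrow> ('g \<Rightarrow> 'g \<Rightarrow> 'g) \<Rightarrow> 'g \<Rightarrow> ('g \<Rightarrow> 'g) \<Rightarrow> bool" where
  "semisimple_lie_group A mul e iv \<longleftrightarrow>
     lie_group A mul e iv \<and> lie_semisimple vfscale bracket (lie_algebra_of A mul)"

definition left_invariant ::
    "('g::topological_space, 'e::real_inner) atlas \<Rightarrow> ('g \<Rightarrow> 'g \<Rightarrow> 'g)
      \<Rightarrow> ('g \<Rightarrow> ('g, complex) tvec set) \<Rightarrow> bool" where
  "left_invariant A mul H \<longleftrightarrow> (\<forall>g. CR_map A H A H (mul g))"

end

theory Submission
  imports Defs "HOL-Computational_Algebra.Fundamental_Theorem_Algebra"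
begin

text \<open>Let \<open>G\<close> be the complexified Lie algebra with conjugation \<open>\<sigma>\<close>.  Call \<open>c\<close> in the real form
  compact if \<open>ad c\<close> is diagonalizable with imaginary eigenvalues.  For a compact \<open>t\<close> whose
  centralizer \<open>Z\<close> has minimal dimension, \<open>Z\<close> is abelian: every derivation is inner, so each \<open>x\<close> in
  the real form of \<open>Z\<close> has an elliptic part, which by minimality is central in \<open>Z\<close>; on the
  orthogonal complement of these compact elements the Killing form is positive definite and
  \<open>ad x\<close> is skew with real eigenvalues, hence zero.  With \<open>N\<close> the sum of the eigenspaces of
  \<open>ad t\<close> for \<open>i r\<close>, \<open>r > 0\<close>, we have \<open>G = \<sigma> N + Z + N\<close> and \<open>[N + Z, N + Z] \<subseteq> N\<close>.  So any subspace \<open>q\<close>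
  with \<open>N \<subseteq> q \<subseteq> N + Z\<close> is a subalgebra, and a maximal one with \<open>q \<inter> \<sigma> q = 0\<close> has dimension
  \<open>\<lfloor>dim G / 2\<rfloor>\<close>.  Translating \<open>q\<close> over the group gives the CR structure.\<close>

section \<open>Linear algebra\<close>

text \<open>Derivations are inner because the Killing form is nondegenerate, and that is obtained
  from the absence of solvable ideals: brackets of the real form with the radical of the Killing
  form span an ideal of ad-nilpotent elements, by a trace computation with conjugated eigenvalues,
  and Engel's theorem makes it solvable. Elliptic parts arise from the same source: an operator
  acting on each generalized eigenspace of \<open>ad x\<close> by an additive function of the
  eigenvalue is a derivation, hence some \<open>ad c\<close>; the function \<open>i Im\<close> gives
  the elliptic part. The obstacle is that a Cartan subalgebra of compact elements may not exist, as
  for sl(3,R). So \<open>Z\<close> keeps a noncompact part, and the share of \<open>q\<close> in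
  \<open>Z\<close> comes from maximality: two elements of the real form of \<open>Z\<close>
  independent modulo \<open>q + \<sigma> q\<close> would allow \<open>z1 + i z2\<close> to be added.
  On the group, closure under brackets concerns every smooth section, whose coefficients in the left
  invariant frame are chosen pointwise. Their continuity is proved, and it suffices because the
  bracket is tested on a function whose derivatives along the frame vanish at the point.\<close>

locale lin_alg = vector_space scale for scale :: "'f::field \<Rightarrow> 'v::ab_group_add \<Rightarrow> 'v"
begin

text \<open>The ambient space will be that of all complex vector fields, in general
  infinite-dimensional, so facts on dimensions are stated relative to a finite set \<open>B\<close>
  whose span contains everything in sight.\<close>

lemma fin_independent_card_le_dim:
  assumes "finite B" "W \<subseteq> span B" "C \<subseteq> W" "independent C"
  shows "finite C" "card C \<le> dim W"
proof -
  obtain S where S: "S \<subseteq> W" "independent S" "W \<subseteq> span S" "card S = dim W"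
    using basis_exists by blast
  have "finite S" using independent_span_bound[OF assms(1) S(2)] S(1) assms(2) by auto
  have "C \<subseteq> span S" using assms(3) S(3) by blast
  then show "finite C" "card C \<le> dim W"
    using independent_span_bound[OF \<open>finite S\<close> assms(4)] S(4) by auto
qed

text \<open>This turns extremal choices of a dimension (maximal subalgebras, minimal centralizers,
  maximal \<open>q\<close>) into statements on inclusions.\<close>

lemma fin_dim_psubset:
  assumes "finite B" "W \<subseteq> span B" "subspace U" "U \<subset> W"
  shows "dim U < dim W"
proof -
  obtain S where S: "S \<subseteq> U" "independent S" "U \<subseteq> span S" "card S = dim U"
    using basis_exists by blast
  have eq: "span S = U" using S assms(3) by (simp add: span_subspace)
  obtain w where w: "w \<in> W" "w \<notin> U" using assms(4) by blast
  have i: "independent (insert w S)" using independent_insertI S(2) w eq by blast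
  have sub: "insert w S \<subseteq> W" using S(1) w assms(4) by blast
  have "finite (insert w S)" "card (insert w S) \<le> dim W"
    using fin_independent_card_le_dim[OF assms(1,2) sub i] .
  moreover have "w \<notin> S" using S(1) w by blast
  ultimately show ?thesis using S(4) by simp
qed

lemma fin_basis:
  assumes "finite B" "subspace W" "W \<subseteq> span B"
  obtains S where "finite S" "independent S" "span S = W" "card S = dim W"
proof -
  obtain S where S: "S \<subseteq> W" "independent S" "W \<subseteq> span S" "card S = dim W"
    using basis_exists by blast
  have "finite S" using independent_span_bound[OF assms(1) S(2)] S(1) assms(3) by auto
  then show ?thesis using that S assms(2) by (simp add: span_subspace)
qed

lemma independent_card_imp_span:
  assumes "finite B" "independent C" "C \<subseteq> span B" "card C = card B"
  shows "span C = span B"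
proof (rule ccontr)
  assume ne: "span C \<noteq> span B"
  have "span C \<subseteq> span B" using assms(3) by (simp add: span_minimal)
  then obtain v where v: "v \<in> span B" "v \<notin> span C" using ne by blast
  have "independent (insert v C)" using independent_insertI v assms(2) by blast
  then have "finite (insert v C)" "card (insert v C) \<le> card B"
    using independent_span_bound[OF assms(1), of "insert v C"] v assms(3) by auto
  moreover have "v \<notin> C" using v span_base by blast
  ultimately show False using assms(4) by simp
qed

text \<open>The trace of \<open>T\<close> on \<open>span B\<close> as the sum of its diagonal matrix
  entries. It is meaningful if \<open>T\<close> maps \<open>B\<close> into \<open>span B\<close>:
  off the span \<open>representation\<close> returns 0.\<close>

definition tr :: "'v set \<Rightarrow> ('v \<Rightarrow> 'v) \<Rightarrow> 'f" where
  "tr B T = (\<Sum>b\<in>B. representation B (T b) b)"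

lemma sum_representation:
  assumes "independent B" "finite B" "v \<in> span B"
  shows "(\<Sum>b\<in>B. scale (representation B v b) b) = v"
  using sum_representation_eq[OF assms(1,3,2)] by simp

lemma representation_linear:
  assumes B: "independent B" and C: "independent C" "finite C"
    and S: "Vector_Spaces.linear scale scale S" and y: "y \<in> span C" and SC: "\<And>c. c \<in> C \<Longrightarrow> S c \<in> span B"
  shows "representation B (S y) b = (\<Sum>c\<in>C. representation C y c * representation B (S c) b)"
proof -
  interpret S: Vector_Spaces.linear scale scale S by fact
  have "S y = S (\<Sum>c\<in>C. scale (representation C y c) c)"
    using sum_representation[OF C y] by simp
  also have "\<dots> = (\<Sum>c\<in>C. scale (representation C y c) (S c))"
    by (simp add: S.sum S.scale)
  finally have "S y = (\<Sum>c\<in>C. scale (representation C y c) (S c))" .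
  moreover have "representation B (\<Sum>c\<in>C. scale (representation C y c) (S c))
      = (\<lambda>b. \<Sum>c\<in>C. representation B (scale (representation C y c) (S c)) b)"
    by (rule representation_sum[OF B]) (simp add: SC span_scale)
  ultimately show ?thesis using B SC by (simp add: representation_scale)
qed

lemma linear_ident: "Vector_Spaces.linear scale scale (\<lambda>x. x)"
  using module_hom_ident module_hom_iff_linear by blast

text \<open>Allowing two bases of the same space makes one double sum serve twice:
  \<open>B = C\<close> is the cyclicity of the trace, and an identity factor gives its independence
  of the basis.\<close>

lemma tr_swap:
  assumes B: "independent B" "finite B" and C: "independent C" "finite C" and BC: "span B = span C"
    and S: "Vector_Spaces.linear scale scale S" and T: "Vector_Spaces.linear scale scale T"
    and SB: "S ` span B \<subseteq> span B" and TB: "T ` span B \<subseteq> span B"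
  shows "tr B (\<lambda>x. S (T x)) = tr C (\<lambda>x. T (S x))"
proof -
  have BC': "x \<in> span C" if "x \<in> B \<or> x \<in> C" for x using BC that span_base by blast
  have SB': "S x \<in> span B" if "x \<in> span B" for x using SB that by blast
  have TB': "T x \<in> span B" if "x \<in> span B" for x using TB that by blast
  have "tr B (\<lambda>x. S (T x)) = (\<Sum>b\<in>B. \<Sum>c\<in>C. representation C (T b) c * representation B (S c) b)"
    unfolding tr_def
    by (intro sum.cong refl representation_linear) (use B C S T BC SB' TB' BC' in auto)
  also have "\<dots> = (\<Sum>c\<in>C. \<Sum>b\<in>B. representation B (S c) b * representation C (T b) c)"
    by (subst sum.swap) (simp add: mult.commute)
  also have "\<dots> = tr C (\<lambda>x. T (S x))"
    unfolding tr_def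
    by (intro sum.cong refl representation_linear[symmetric]) (use B C S T BC SB' TB' BC' in auto)
  finally show ?thesis .
qed

lemma tr_basis_independent:
  assumes "independent B" "finite B" "independent C" "finite C" "span B = span C"
    and "Vector_Spaces.linear scale scale T" "T ` span B \<subseteq> span B"
  shows "tr B T = tr C T"
  using tr_swap[OF assms(1-5) assms(6) linear_ident assms(7)] by simp

lemma tr_add:
  assumes "independent B" "\<And>b. b \<in> B \<Longrightarrow> S b \<in> span B" "\<And>b. b \<in> B \<Longrightarrow> T b \<in> span B"
  shows "tr B (\<lambda>x. S x + T x) = tr B S + tr B T"
  unfolding tr_def by (simp add: assms representation_add sum.distrib)

lemma tr_diff:
  assumes "independent B" "\<And>b. b \<in> B \<Longrightarrow> S b \<in> span B" "\<And>b. b \<in> B \<Longrightarrow> T b \<in> span B"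
  shows "tr B (\<lambda>x. S x - T x) = tr B S - tr B T"
  unfolding tr_def by (simp add: assms representation_diff sum_subtractf)

lemma tr_scale:
  assumes "independent B" "\<And>b. b \<in> B \<Longrightarrow> S b \<in> span B"
  shows "tr B (\<lambda>x. scale c (S x)) = c * tr B S"
  unfolding tr_def by (simp add: assms representation_scale sum_distrib_left)

lemma tr_cong: "(\<And>b. b \<in> B \<Longrightarrow> S b = T b) \<Longrightarrow> tr B S = tr B T"
  unfolding tr_def by simp

lemma linear_eq_on_span':
  assumes "Vector_Spaces.linear scale scale S" "Vector_Spaces.linear scale scale T"
    "\<And>x. x \<in> X \<Longrightarrow> S x = T x" "v \<in> span X"
  shows "S v = T v"
proof -
  interpret S: Vector_Spaces.linear scale scale S by fact
  interpret T: Vector_Spaces.linear scale scale T by fact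
  show ?thesis using assms(4)
    by (induction rule: span_induct_alt) (simp_all add: S.zero T.zero S.add T.add S.scale T.scale assms(3))
qed

lemma linear_funpow:
  assumes "Vector_Spaces.linear scale scale A"
  shows "Vector_Spaces.linear scale scale (A ^^ k)"
proof (induction k)
  case 0 show ?case using linear_ident by (simp add: id_def)
next
  case (Suc k) then show ?case
    using assms module_hom_compose[of scale scale "A^^k" scale A] by (simp add: module_hom_iff_linear comp_def)
qed

text \<open>Injectivity of \<open>x \<mapsto> \<beta> x\<close> on a finite-dimensional space gives surjectivity onto the dual.\<close>

lemma riesz:
  assumes B: "independent B" "finite B"
    and add: "\<And>x y z. x \<in> span B \<Longrightarrow> y \<in> span B \<Longrightarrow> \<beta> (x + y) z = \<beta> x z + \<beta> y z"
    and scl: "\<And>c x z. x \<in> span B \<Longrightarrow> \<beta> (scale c x) z = c * \<beta> x z"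
    and add2: "\<And>x y z. x \<in> span B \<Longrightarrow> y \<in> span B \<Longrightarrow> z \<in> span B \<Longrightarrow> \<beta> z (x + y) = \<beta> z x + \<beta> z y"
    and scl2: "\<And>c x z. x \<in> span B \<Longrightarrow> z \<in> span B \<Longrightarrow> \<beta> z (scale c x) = c * \<beta> z x"
    and nd: "\<And>x. x \<in> span B \<Longrightarrow> (\<And>y. y \<in> span B \<Longrightarrow> \<beta> x y = 0) \<Longrightarrow> x = 0"
    and phi1: "\<And>x y. x \<in> span B \<Longrightarrow> y \<in> span B \<Longrightarrow> \<phi> (x + y) = \<phi> x + \<phi> y"
    and phi2: "\<And>c x. x \<in> span B \<Longrightarrow> \<phi> (scale c x) = c * \<phi> x"
  shows "\<exists>k\<in>span B. \<forall>y\<in>span B. \<beta> k y = (\<phi> y :: 'f)"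
proof -
  interpret P: vector_space_pair scale scale by unfold_locales
  \<comment> \<open>\<open>\<beta>\<close> and \<open>\<phi>\<close> are assumed linear on
    \<open>span B\<close> only, so the extension of an equality from the basis is done by
    hand.\<close>
  have ext: "(\<forall>y\<in>span B. f y = (g y :: 'f))"
    if "\<And>x y. x \<in> span B \<Longrightarrow> y \<in> span B \<Longrightarrow> f (x + y) = f x + f y"
      "\<And>c x. x \<in> span B \<Longrightarrow> f (scale c x) = c * f x"
      "\<And>x y. x \<in> span B \<Longrightarrow> y \<in> span B \<Longrightarrow> g (x + y) = g x + g y"
      "\<And>c x. x \<in> span B \<Longrightarrow> g (scale c x) = c * g x"
      "\<And>b. b \<in> B \<Longrightarrow> f b = g b" for f g
  proof
    fix y assume "y \<in> span B"
    then have "y \<in> span B \<and> f y = g y"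
    proof (induction rule: span_induct_alt)
      case base
      have "f (scale 0 0) = 0 * f 0" "g (scale 0 0) = 0 * g 0" using that span_zero by blast+
      then show ?case by (simp add: span_zero)
    next
      case (step c x y)
      have "f x = g x" "x \<in> span B" "scale c x \<in> span B"
        using step(1) that(5) span_base span_scale by auto
      moreover have "f (scale c x + y) = f (scale c x) + f y" "g (scale c x + y) = g (scale c x) + g y"
        "f (scale c x) = c * f x" "g (scale c x) = c * g x"
        using that(1-4) calculation step by auto
      ultimately show ?case using step by (simp add: span_add)
    qed
    then show "f y = g y" by simp
  qed
  \<comment> \<open>The coordinates of \<open>T x\<close> are the values of \<open>\<beta> x\<close>
    on the basis. Nondegeneracy makes \<open>T\<close> injective, hence onto, and a preimage of the
    vector with coordinates \<open>\<phi> c\<close> represents \<open>\<phi>\<close>.\<close>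
  define T where "T = P.construct B (\<lambda>b. \<Sum>c\<in>B. scale (\<beta> b c) c)"
  have Tl: "Vector_Spaces.linear scale scale T" unfolding T_def by (rule P.linear_construct[OF B(1)])
  interpret T: Vector_Spaces.linear scale scale T by fact
  have Tx: "T x = (\<Sum>c\<in>B. scale (\<beta> x c) c)" if "x \<in> span B" for x
  proof -
  from that have "x \<in> span B \<and> T x = (\<Sum>c\<in>B. scale (\<beta> x c) c)"
  proof (induction rule: span_induct_alt)
    case base
    have "\<beta> 0 c = 0" for c using scl[of 0 0] span_zero by simp
    then show ?case by (simp add: T.zero span_zero)
  next
    case (step c x y)
    have "T x = (\<Sum>c\<in>B. scale (\<beta> x c) c)" using step(1) unfolding T_def
      by (simp add: P.construct_basis[OF B(1)])
    then show ?case using step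
      by (simp add: T.add T.scale add scl span_base span_add span_scale scale_left_distrib sum.distrib scale_sum_right)
  qed
  then show ?thesis by simp
  qed
  have Tin: "T x \<in> span B" if "x \<in> span B" for x
    using that by (simp add: Tx span_sum span_scale span_base)
  have inj: "inj_on T (span B)"
  proof (subst T.inj_on_iff_eq_0)
    show "subspace (span B)" by simp
    show "\<forall>x\<in>span B. T x = 0 \<longrightarrow> x = 0"
    proof (intro ballI impI)
      fix x assume x: "x \<in> span B" "T x = 0"
      have "\<beta> x c = 0" if "c \<in> B" for c
        using independentD[OF B(1,2) subset_refl, of "\<beta> x"] x that Tx by simp
      then have "\<forall>y\<in>span B. \<beta> x y = 0"
        by (intro ext) (use x add2 scl2 in auto)
      then show "x = 0" using nd x by blast
    qed
  qed
  have ind: "independent (T ` B)" by (rule T.independent_injective_image[OF B(1) inj])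
  have "span (T ` B) = span B"
  proof (rule independent_card_imp_span[OF B(2) ind])
    show "T ` B \<subseteq> span B" using Tin span_base by blast
    show "card (T ` B) = card B" using inj span_superset by (meson card_image inj_on_subset)
  qed
  then have im: "T ` span B = span B" using T.span_image[of B] by simp
  have "(\<Sum>c\<in>B. scale (\<phi> c) c) \<in> span B" by (simp add: span_sum span_scale span_base)
  then obtain k where k: "k \<in> span B" "T k = (\<Sum>c\<in>B. scale (\<phi> c) c)" using im by (metis imageE)
  have "(\<Sum>c\<in>B. scale (\<beta> k c - \<phi> c) c) = 0"
    using k Tx by (simp add: scale_left_diff_distrib sum_subtractf)
  then have "\<beta> k c = \<phi> c" if "c \<in> B" for c
    using independentD[OF B(1,2) subset_refl, of "\<lambda>c. \<beta> k c - \<phi> c"] that by simp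
  then have "\<forall>y\<in>span B. \<beta> k y = \<phi> y"
    by (intro ext) (use k add2 scl2 phi1 phi2 in auto)
  then show ?thesis using k by blast
qed

end

section \<open>Generalized eigenspaces of a complex operator\<close>

locale clin_alg = lin_alg scale for scale :: "complex \<Rightarrow> 'v::ab_group_add \<Rightarrow> 'v"
begin

text \<open>The generalized eigenspace in the whole ambient space; leaving the exponent free avoids
  a bound by a dimension.\<close>

definition geig :: "('v \<Rightarrow> 'v) \<Rightarrow> complex \<Rightarrow> 'v set" where
  "geig A l = {v. \<exists>k. ((\<lambda>v. A v - scale l v) ^^ k) v = 0}"

lemma linear_shift:
  assumes "Vector_Spaces.linear scale scale A"
  shows "Vector_Spaces.linear scale scale (\<lambda>v. A v - scale l v)"
proof -
  interpret A: Vector_Spaces.linear scale scale A by fact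
  show ?thesis
    by unfold_locales (simp_all add: A.add A.scale scale_right_distrib scale_right_diff_distrib scale_left_commute)
qed

lemma geig_step:
  assumes "A v - scale l v \<in> geig A l"
  shows "v \<in> geig A l"
proof -
  obtain k where "((\<lambda>v. A v - scale l v) ^^ k) (A v - scale l v) = 0"
    using assms by (auto simp: geig_def)
  then have "((\<lambda>v. A v - scale l v) ^^ Suc k) v = 0" by (simp add: funpow_Suc_right del: funpow.simps)
  then show ?thesis unfolding geig_def by blast
qed

context
  fixes A assumes lin: "Vector_Spaces.linear scale scale A"
begin

interpretation A: Vector_Spaces.linear scale scale A by (rule lin)

lemma shift_pow_linear: "Vector_Spaces.linear scale scale ((\<lambda>v. A v - scale l v) ^^ k)"
  by (intro linear_funpow linear_shift lin)

lemma shift_pow_mono: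
  assumes "((\<lambda>v. A v - scale l v) ^^ k) v = 0" "k \<le> n"
  shows "((\<lambda>v. A v - scale l v) ^^ n) v = 0"
proof -
  interpret N: Vector_Spaces.linear scale scale "(\<lambda>v. A v - scale l v) ^^ (n - k)"
    by (rule shift_pow_linear)
  have "((\<lambda>v. A v - scale l v) ^^ (n - k + k)) v = 0"
    using assms N.zero by (simp only: funpow_add o_apply)
  then show ?thesis using assms by simp
qed

lemma geig_subspace: "subspace (geig A l)"
proof (rule subspaceI)
  show "0 \<in> geig A l" unfolding geig_def by (auto intro: exI[of _ 0])
next
  fix x y assume "x \<in> geig A l" "y \<in> geig A l"
  then obtain k m where km: "((\<lambda>v. A v - scale l v) ^^ k) x = 0" "((\<lambda>v. A v - scale l v) ^^ m) y = 0"
    unfolding geig_def by blast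
  interpret N: Vector_Spaces.linear scale scale "(\<lambda>v. A v - scale l v) ^^ (max k m)"
    by (rule shift_pow_linear)
  have "((\<lambda>v. A v - scale l v) ^^ (max k m)) (x + y) = 0"
    using shift_pow_mono[OF km(1), of "max k m"] shift_pow_mono[OF km(2), of "max k m"] by (simp add: N.add)
  then show "x + y \<in> geig A l" unfolding geig_def by blast
next
  fix c x assume "x \<in> geig A l"
  then obtain k where k: "((\<lambda>v. A v - scale l v) ^^ k) x = 0" unfolding geig_def by blast
  interpret N: Vector_Spaces.linear scale scale "(\<lambda>v. A v - scale l v) ^^ k"
    by (rule shift_pow_linear)
  have "((\<lambda>v. A v - scale l v) ^^ k) (scale c x) = 0" by (simp add: N.scale k)
  then show "scale c x \<in> geig A l" unfolding geig_def by blast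
qed

lemma geig_shift:
  assumes "v \<in> geig A l"
  shows "A v - scale l v \<in> geig A l"
proof -
  obtain k where k: "((\<lambda>v. A v - scale l v) ^^ k) v = 0" using assms by (auto simp: geig_def)
  then have "((\<lambda>v. A v - scale l v) ^^ Suc k) v = 0" using shift_pow_mono[OF k] by simp
  then have "((\<lambda>v. A v - scale l v) ^^ k) (A v - scale l v) = 0"
    by (simp only: funpow_Suc_right o_apply)
  then show ?thesis unfolding geig_def by blast
qed

lemma geig_image: "v \<in> geig A l \<Longrightarrow> A v \<in> geig A l"
  using subspace_add[OF geig_subspace geig_shift subspace_scale[OF geig_subspace], of v l v l] by simp

lemma geig_shift_image:
  assumes "v \<in> geig A l"
  shows "A v - scale m v \<in> geig A l"
  using subspace_diff[OF geig_subspace geig_image[OF assms] subspace_scale[OF geig_subspace assms]] .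

text \<open>Induction on the exponent that kills \<open>v\<close>, with the exponent hidden: a
  property passes from \<open>(A - l) v\<close> to \<open>v\<close>. Arguments for eigenvectors are
  extended to generalized ones this way.\<close>

lemma geig_induct [consumes 1, case_names zero step]:
  assumes "v \<in> geig A l" "P 0" "\<And>v. v \<in> geig A l \<Longrightarrow> P (A v - scale l v) \<Longrightarrow> P v"
  shows "P v"
proof -
  obtain k where "((\<lambda>v. A v - scale l v) ^^ k) v = 0" using assms by (auto simp: geig_def)
  then show ?thesis
  proof (induction k arbitrary: v)
    case 0 then show ?case using assms(2) by simp
  next
    case (Suc k)
    then have "((\<lambda>v. A v - scale l v) ^^ k) (A v - scale l v) = 0"
      by (simp only: funpow_Suc_right o_apply)
    moreover have "v \<in> geig A l" unfolding geig_def using Suc(2) by blast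
    ultimately show ?case using assms(3) Suc.IH by blast
  qed
qed

lemma geig_shift_inj:
  assumes "v \<in> geig A l" "A v = scale m v" "m \<noteq> l"
  shows "v = 0"
proof -
  have "A v = scale m v \<longrightarrow> v = 0" using assms(1)
  proof (induction rule: geig_induct)
    case zero show ?case by simp
  next
    case (step v)
    show ?case
    proof
      assume e: "A v = scale m v"
      then have "A v - scale l v = scale (m - l) v" by (simp add: scale_left_diff_distrib)
      moreover have "A (scale (m - l) v) = scale m (scale (m - l) v)"
        by (simp add: A.scale e scale_left_commute mult.commute)
      ultimately have "scale (m - l) v = 0" using step by metis
      then show "v = 0" using assms(3) by simp
    qed
  qed
  then show ?thesis using assms by blast
qed

lemma geig_shift_pow_inj:
  assumes "v \<in> geig A l" "((\<lambda>v. A v - scale m v) ^^ k) v = 0" "m \<noteq> l"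
  shows "v = 0"
  using assms
proof (induction k arbitrary: v)
  case (Suc k)
  then have "((\<lambda>v. A v - scale m v) ^^ k) (A v - scale m v) = 0"
    by (simp only: funpow_Suc_right o_apply)
  then have "A v - scale m v = 0" using Suc geig_shift_image by blast
  then show ?case using geig_shift_inj Suc by simp
qed simp

text \<open>A power of \<open>A - m\<close> that kills the component \<open>w m\<close> maps the
  other generalized eigenspaces injectively into themselves, so the induction hypothesis applies to
  the images of the remaining components.\<close>

lemma geig_independent:
  assumes "finite F" "\<And>l. l \<in> F \<Longrightarrow> w l \<in> geig A l" "(\<Sum>l\<in>F. w l) = 0"
  shows "\<forall>l\<in>F. w l = 0"
  using assms
proof (induction F arbitrary: w)
  case (insert m F)
  obtain k where k: "((\<lambda>v. A v - scale m v) ^^ k) (w m) = 0"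
    using insert.prems(1)[of m] by (auto simp: geig_def)
  define N where "N = (\<lambda>v. A v - scale m v) ^^ k"
  interpret N: Vector_Spaces.linear scale scale N
    unfolding N_def by (rule shift_pow_linear)
  have st: "((\<lambda>v. A v - scale m v) ^^ j) v \<in> geig A l" if "v \<in> geig A l" for j v l
    using that by (induction j) (auto intro: geig_shift_image)
  have "N (\<Sum>l\<in>insert m F. w l) = 0" using insert.prems(2) by (simp only: N.zero)
  then have "N (w m) + (\<Sum>l\<in>F. N (w l)) = 0"
    by (simp add: sum.insert[OF insert.hyps(1,2)] N.add N.sum)
  then have "(\<Sum>l\<in>F. N (w l)) = 0" using k by (simp add: N_def[symmetric])
  moreover have "N (w l) \<in> geig A l" if "l \<in> F" for l
    unfolding N_def using that insert.prems(1) by (intro st) simp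
  ultimately have N0: "\<forall>l\<in>F. N (w l) = 0" by (intro insert.IH)
  have *: "\<forall>l\<in>F. w l = 0"
  proof
    fix l assume l: "l \<in> F"
    then have "m \<noteq> l" "w l \<in> geig A l" using insert.hyps(2) insert.prems(1) by auto
    then show "w l = 0" using geig_shift_pow_inj N0 l unfolding N_def by blast
  qed
  then show ?case using insert.prems(2) insert.hyps by simp
qed simp

text \<open>On \<open>geig A m\<close> the operator \<open>A - l\<close> is the nonzero scalar
  \<open>m - l\<close> plus a locally nilpotent operator, hence onto. The invariant subspace
  \<open>U\<close> is carried along because the decomposition is later needed inside eigenspaces of
  another operator.\<close>

lemma geig_solve:
  assumes "u \<in> geig A m" "u \<in> U" "m \<noteq> l" "subspace U" "\<And>x. x \<in> U \<Longrightarrow> A x \<in> U"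
  shows "\<exists>w\<in>geig A m \<inter> U. A w - scale l w = u"
proof -
  have "u \<in> U \<longrightarrow> (\<exists>w\<in>geig A m \<inter> U. A w - scale l w = u)" using assms(1)
  proof (induction rule: geig_induct)
    case zero
    have "0 \<in> geig A m" "0 \<in> U" using subspace_0 geig_subspace assms(4) by auto
    then show ?case by (intro impI bexI[of _ 0]) (auto simp: A.zero)
  next
    case (step u)
    show ?case
    proof
      assume u: "u \<in> U"
      then have "A u - scale m u \<in> U" using assms(4,5) by (simp add: subspace_diff subspace_scale)
      then obtain w where w: "w \<in> geig A m" "w \<in> U" "A w - scale l w = A u - scale m u" using step by blast
      \<comment> \<open>If \<open>w\<close> solves the equation for \<open>(A - m) u\<close>, then
        \<open>(A - l) (u - w) = (m - l) u\<close>.\<close>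
      define z where "z = scale (inverse (m - l)) (u - w)"
      have "z \<in> geig A m \<inter> U" unfolding z_def
        using w u step(1) geig_subspace assms(4) by (auto intro!: subspace_scale subspace_diff)
      moreover have "A z - scale l z = scale (inverse (m - l)) ((A u - scale l u) - (A w - scale l w))"
        unfolding z_def A.scale A.diff
        by (simp add: scale_right_diff_distrib mult.commute algebra_simps)
      then have "A z - scale l z = scale (inverse (m - l)) (scale (m - l) u)"
        using w by (simp add: scale_left_diff_distrib)
      then have "A z - scale l z = u" using assms(3) by simp
      ultimately show "\<exists>w\<in>geig A m \<inter> U. A w - scale l w = u" by blast
    qed
  qed
  then show ?thesis using assms(2) by blast
qed

text \<open>Every component of \<open>(A - l) v\<close> for an eigenvalue other than
  \<open>l\<close> can be solved for, so some \<open>w\<close> in the span has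
  \<open>(A - l) w - (A - l) v\<close> in \<open>geig A l\<close>. Then \<open>w - v\<close> itself
  lies in \<open>geig A l\<close>.\<close>

lemma geig_span_shift:
  assumes U: "subspace U" "\<And>x. x \<in> U \<Longrightarrow> A x \<in> U" and v: "v \<in> U"
    and S: "A v - scale l v \<in> span (\<Union>l. geig A l \<inter> U)"
  shows "v \<in> span (\<Union>l. geig A l \<inter> U)"
proof -
  let ?S = "span (\<Union>l. geig A l \<inter> U)"
  have SU: "?S \<subseteq> U" using U(1) by (intro span_minimal) auto
  have g: "geig A m \<inter> U \<subseteq> ?S" for m
    by (rule order_trans[OF _ span_superset]) blast
  have sb: "subspace (geig A l \<inter> U)" using geig_subspace U(1) by (simp add: subspace_inter)
  have "\<exists>w\<in>?S. A w - scale l w - u \<in> geig A l \<inter> U" if "u \<in> ?S" for u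
    using that
  proof (induction rule: span_induct_alt)
    case base
    show ?case using sb subspace_0 span_zero by (intro bexI[of _ 0]) (auto simp: A.zero)
  next
    case (step c x y)
    obtain w where w: "w \<in> ?S" "A w - scale l w - y \<in> geig A l \<inter> U" using step by blast
    obtain m where m: "x \<in> geig A m" "x \<in> U" using step by blast
    have "\<exists>z\<in>?S. A z - scale l z - x \<in> geig A l \<inter> U"
    proof (cases "m = l")
      case True
      then show ?thesis using m sb subspace_neg[OF sb] span_zero
        by (intro bexI[of _ 0]) (auto simp: A.zero)
    next
      case False
      then obtain z where "z \<in> geig A m \<inter> U" "A z - scale l z = x"
        using geig_solve[OF m False U] by blast
      then show ?thesis using subsetD[OF g, of z m] subspace_0[OF sb] by (intro bexI[of _ z]) simp_all
    qed
    then obtain z where z: "z \<in> ?S" "A z - scale l z - x \<in> geig A l \<inter> U" by blast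
    have "A (scale c z + w) - scale l (scale c z + w) - (scale c x + y)
       = scale c (A z - scale l z - x) + (A w - scale l w - y)"
      by (simp add: A.add A.scale scale_right_distrib scale_right_diff_distrib mult.commute)
    also have "\<dots> \<in> geig A l \<inter> U" using z w sb by (simp only: subspace_add subspace_scale)
    finally show ?case using z w by (intro bexI[of _ "scale c z + w"]) (simp_all add: span_add span_scale)
  qed
  then obtain w where w: "w \<in> ?S" "A w - scale l w - (A v - scale l v) \<in> geig A l \<inter> U" using S by blast
  have "A (w - v) - scale l (w - v) \<in> geig A l \<inter> U"
  proof -
    have "a - b - (c - d) = a - c - (b - d)" for a b c d :: 'v by (simp add: algebra_simps)
    then have "A (w - v) - scale l (w - v) = A w - scale l w - (A v - scale l v)"
      by (simp only: A.diff scale_right_diff_distrib)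
    then show ?thesis using w(2) by (simp only:)
  qed
  then have "A (w - v) - scale l (w - v) \<in> geig A l" by (rule IntD1)
  then have "w - v \<in> geig A l" by (rule geig_step)
  moreover have "w - v \<in> U" using w SU v subspace_diff[OF U(1)] by blast
  ultimately have "w - v \<in> ?S" using subsetD[OF g, of "w - v" l] by simp
  then have "w - (w - v) \<in> ?S" using w(1) by (rule span_diff[rotated])
  then show ?thesis by simp
qed

text \<open>This is \<open>p(A) v\<close>.\<close>

definition pact :: "complex poly \<Rightarrow> 'v \<Rightarrow> 'v" where
  "pact p v = (\<Sum>i\<le>degree p. scale (coeff p i) ((A ^^ i) v))"

lemma pact_bound:
  assumes "degree p \<le> n"
  shows "pact p v = (\<Sum>i\<le>n. scale (coeff p i) ((A ^^ i) v))"
  unfolding pact_def using assms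
  by (intro sum.mono_neutral_left) (auto simp: coeff_eq_0)

lemma pact_root: "pact ([:- a, 1:] * q) v = pact q (A v - scale a v)"
proof -
  define n where "n = degree q"
  have pw: "(A ^^ i) (A v - scale a v) = (A ^^ Suc i) v - scale a ((A ^^ i) v)" for i
  proof -
    interpret N: Vector_Spaces.linear scale scale "A ^^ i" by (rule linear_funpow[OF lin])
    show ?thesis by (simp add: N.diff N.scale funpow_Suc_right del: funpow.simps)
  qed
  have "degree ([:- a, 1:] * q) \<le> Suc n" unfolding n_def
    using degree_mult_le[of "[:- a, 1:]" q] by simp
  then have "pact ([:- a, 1:] * q) v = (\<Sum>i\<le>Suc n. scale (coeff ([:- a, 1:] * q) i) ((A ^^ i) v))"
    by (rule pact_bound)
  also have "\<dots> = (\<Sum>i\<le>Suc n. scale (coeff (pCons 0 q) i) ((A ^^ i) v)) - (\<Sum>i\<le>Suc n. scale (a * coeff q i) ((A ^^ i) v))"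
    by (simp add: sum_subtractf[symmetric] scale_left_diff_distrib[symmetric] del: sum.atMost_Suc)
  also have "(\<Sum>i\<le>Suc n. scale (coeff (pCons 0 q) i) ((A ^^ i) v)) = (\<Sum>i\<le>n. scale (coeff q i) ((A ^^ Suc i) v))"
    by (subst sum.atMost_Suc_shift) simp
  also have "(\<Sum>i\<le>Suc n. scale (a * coeff q i) ((A ^^ i) v)) = (\<Sum>i\<le>n. scale (a * coeff q i) ((A ^^ i) v))"
    by (simp add: n_def coeff_eq_0)
  also have "(\<Sum>i\<le>n. scale (coeff q i) ((A ^^ Suc i) v)) - (\<Sum>i\<le>n. scale (a * coeff q i) ((A ^^ i) v)) = pact q (A v - scale a v)"
    unfolding pact_def n_def[symmetric] pw
    by (simp add: sum_subtractf[symmetric] scale_right_diff_distrib mult.commute)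
  finally show ?thesis .
qed

text \<open>The \<open>card B + 1\<close> iterates \<open>v, A v, ..., A^n v\<close> lie in the span
  of \<open>card B\<close> vectors.\<close>

lemma ex_annihilating_poly:
  assumes "finite B" "\<And>i. (A ^^ i) v \<in> span B"
  shows "\<exists>p. p \<noteq> 0 \<and> pact p v = 0"
proof -
  define n where "n = card B"
  have "\<exists>c. (\<exists>i\<le>n. c i \<noteq> 0) \<and> (\<Sum>i\<le>n. scale (c i) ((A ^^ i) v)) = 0"
  proof (cases "inj_on (\<lambda>i. (A ^^ i) v) {..n}")
    case True
    let ?T = "(\<lambda>i. (A ^^ i) v) ` {..n}"
    have "card ?T = Suc n" using True by (simp add: card_image)
    then have "dependent ?T" using independent_span_bound[OF assms(1), of ?T] assms(2)
      unfolding n_def by fastforce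
    then obtain u where u: "\<exists>x\<in>?T. u x \<noteq> 0" "(\<Sum>x\<in>?T. scale (u x) x) = 0"
      using dependent_finite[of ?T] by auto
    show ?thesis using u True
      by (intro exI[of _ "\<lambda>i. u ((A ^^ i) v)"]) (auto simp: sum.reindex)
  next
    case False
    then obtain i j where ij: "i \<le> n" "j \<le> n" "i \<noteq> j" "(A ^^ i) v = (A ^^ j) v"
      unfolding inj_on_def by auto
    \<comment> \<open>Coinciding iterates collapse the set to which the dimension bound would apply;
      here the polynomial is simply \<open>x^i - x^j\<close>.\<close>
    let ?c = "\<lambda>k. if k = i then 1 else if k = j then -1 else (0::complex)"
    have "(\<Sum>k\<le>n. scale (?c k) ((A ^^ k) v)) = (\<Sum>k\<in>{i,j}. scale (?c k) ((A ^^ k) v))"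
      using ij by (intro sum.mono_neutral_right) auto
    also have "\<dots> = 0" using ij by simp
    finally show ?thesis using ij by (intro exI[of _ ?c]) auto
  qed
  then obtain c where c: "\<exists>i\<le>n. c i \<noteq> 0" "(\<Sum>i\<le>n. scale (c i) ((A ^^ i) v)) = 0" by blast
  define p where "p = (\<Sum>i\<le>n. monom (c i) i)"
  have cf: "coeff p i = (if i \<le> n then c i else 0)" for i
    unfolding p_def coeff_sum by (simp add: if_distrib cong: if_cong)
  have "degree p \<le> n" by (rule degree_le) (simp add: cf)
  then have "pact p v = 0" using c(2) by (simp add: pact_bound cf)
  moreover have "p \<noteq> 0" using c(1) cf by (metis coeff_0)
  ultimately show ?thesis by blast
qed

text \<open>Primary decomposition inside an invariant subspace, by induction on the degree of a
  polynomial annihilating the single vector \<open>v\<close>: a root \<open>a\<close> leaves a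
  polynomial of smaller degree for \<open>(A - a) v\<close>, and \<open>geig_span_shift\<close>
  climbs back to \<open>v\<close>.\<close>

lemma geig_span:
  assumes "finite B" "U \<subseteq> span B" "subspace U" "\<And>x. x \<in> U \<Longrightarrow> A x \<in> U"
  shows "U \<subseteq> span (\<Union>l. geig A l \<inter> U)"
proof
  fix v assume v: "v \<in> U"
  have inv: "(A ^^ i) v \<in> U" for i by (induction i) (simp_all add: v assms(4))
  have "(A ^^ i) v \<in> span B" for i using inv assms(2) by blast
  then obtain p where p: "p \<noteq> 0" "pact p v = 0" using ex_annihilating_poly[OF assms(1), of v] by blast
  show "v \<in> span (\<Union>l. geig A l \<inter> U)" using p v
  proof (induction "degree p" arbitrary: p v)
    case 0
    have "coeff p 0 \<noteq> 0" using leading_coeff_0_iff[of p] 0(1,2) by simp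
    then have "v = 0" using 0(1,3) by (simp add: pact_def)
    then show ?case by (simp add: span_zero)
  next
    case (Suc n)
    have "\<not> constant (poly p)" using Suc(2) constant_degree[of p] by simp
    then obtain a where "poly p a = 0" using fundamental_theorem_of_algebra by blast
    then have "[:- a, 1:] dvd p" by (simp only: poly_eq_0_iff_dvd)
    then obtain q where q: "p = [:- a, 1:] * q" by (rule dvdE)
    then have "q \<noteq> 0" using Suc(3) by auto
    then have "n = degree q" using Suc(2) q by (subst (asm) q, subst (asm) degree_mult_eq) auto
    moreover have "pact q (A v - scale a v) = 0" using Suc(4) q pact_root by simp
    moreover have "A v - scale a v \<in> U" using Suc(5) assms(3,4) by (simp add: subspace_diff subspace_scale)
    ultimately have "A v - scale a v \<in> span (\<Union>l. geig A l \<inter> U)" using Suc(1) \<open>q \<noteq> 0\<close> by blast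
    then show ?case using geig_span_shift[OF assms(3,4) Suc(5)] by blast
  qed
qed

end

end

section \<open>Trace formulas and operators diagonal on the generalized eigenspaces\<close>

context clin_alg
begin

context
  fixes A B
  assumes lin: "Vector_Spaces.linear scale scale A" and finB: "finite B"
    and inv: "\<And>x. x \<in> span B \<Longrightarrow> A x \<in> span B"
begin

interpretation A: Vector_Spaces.linear scale scale A by (rule lin)

text \<open>Stands in for a basis in which \<open>A\<close> is triangular. No order on
  \<open>E\<close> is fixed; of the triangular matrix only what the trace formulas use is recorded,
  the diagonal entries of \<open>A\<close> and of its square.\<close>

definition eigen_adapted :: "'v set \<Rightarrow> ('v \<Rightarrow> complex) \<Rightarrow> bool" where
  "eigen_adapted E lam \<longleftrightarrow> independent E \<and> E \<subseteq> span B \<and> (\<forall>x\<in>span E. A x \<in> span E) \<and>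
     (\<forall>e\<in>E. e \<in> geig A (lam e) \<and> representation E (A e) e = lam e
        \<and> representation E (A (A e)) e = (lam e)\<^sup>2)"

text \<open>Modulo \<open>span E\<close> the vector \<open>v\<close> is an eigenvector for
  \<open>l\<close>, so \<open>A v\<close> and \<open>A (A v)\<close> have the coordinates
  \<open>l\<close> and \<open>l^2\<close> along it, while coordinates of vectors in
  \<open>span E\<close> do not change.\<close>

lemma eigen_adapted_extend:
  assumes E: "eigen_adapted E lam" and v: "v \<in> geig A l" "v \<in> span B" "v \<notin> span E"
    and Av: "A v - scale l v \<in> span E"
  shows "eigen_adapted (insert v E) (lam(v := l))"
proof -
  have iE: "independent E" and EB: "E \<subseteq> span B" and EA: "\<And>x. x \<in> span E \<Longrightarrow> A x \<in> span E"
    using E unfolding eigen_adapted_def by auto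
  have i: "independent (insert v E)" using independent_insertI v(3) iE by blast
  have vE: "v \<notin> E" using v(3) span_base by blast
  have sub: "span E \<subseteq> span (insert v E)" by (intro span_mono) blast
  have vs: "v \<in> span (insert v E)" by (simp add: span_base)
  define u where "u = A v - scale l v"
  have u: "u \<in> span E" and Av': "A v = u + scale l v" using Av by (simp_all add: u_def)
  have Avs: "A v \<in> span (insert v E)" unfolding Av' using u sub vs by (intro span_add span_scale) auto
  have "A x \<in> span (insert v E)" if "x \<in> span (insert v E)" for x
    using that
  proof (induction rule: span_induct_alt)
    case base show ?case by (simp add: A.zero span_zero)
  next
    case (step c x y)
    have "A x \<in> span (insert v E)"
      using step(1) Avs EA[OF span_base] sub by auto
    then show ?case using step(2) by (simp add: A.add A.scale span_add span_scale)
  qed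
  moreover have re: "representation (insert v E) x = representation E x" if "x \<in> span E" for x
    using representation_extend[OF i that] by blast
  moreover have r0: "representation E x v = 0" for x
    using vE representation_ne_zero by blast
  have rv: "representation (insert v E) (scale c v) v = c" for c
    using representation_scale[OF i vs] representation_basis[OF i, of v] by simp
  have ru: "representation (insert v E) (x + scale c v) v = c" if "x \<in> span E" for x c
    using that representation_add[OF i, of "scale c v" x] re[OF that] r0 rv sub vs by (simp add: span_scale subset_iff)
  have "A (A v) = (A u + scale l u) + scale (l\<^sup>2) v"
    by (simp add: Av' A.add A.scale scale_right_distrib power2_eq_square)
  then have "representation (insert v E) (A (A v)) v = l\<^sup>2"
    using ru[of "A u + scale l u" "l\<^sup>2"] u EA by (simp add: span_add span_scale)
  moreover have "representation (insert v E) (A v) v = l" using ru[OF u] Av' by simp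
  moreover have "\<forall>e\<in>E. e \<noteq> v" using vE by blast
  moreover have "A e \<in> span E" "A (A e) \<in> span E" if "e \<in> E" for e using that EA span_base by blast+
  ultimately show ?thesis using i E v EB unfolding eigen_adapted_def by (auto simp: re)
qed

lemma ex_eigen_adapted: "\<exists>E lam. eigen_adapted E lam \<and> finite E \<and> span E = span B"
proof -
  define P where "P n \<longleftrightarrow> (\<exists>E lam. eigen_adapted E lam \<and> card E = n)" for n
  have bnd: "finite E \<and> card E \<le> card B" if "eigen_adapted E lam" for E lam
    using independent_span_bound[OF finB, of E] that unfolding eigen_adapted_def by blast
  have "eigen_adapted {} (\<lambda>_. 0)" unfolding eigen_adapted_def by (simp add: A.zero independent_empty span_zero)
  then have "P 0" unfolding P_def by (intro exI[of _ "{}"] exI[of _ "\<lambda>_. 0"]) simp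
  moreover have "\<forall>n. P n \<longrightarrow> n \<le> card B" unfolding P_def using bnd by blast
  ultimately obtain n where n: "P n" "\<And>m. P m \<Longrightarrow> m \<le> n" using ex_has_greatest_nat[of P 0 "\<lambda>x. x" "Suc (card B)"] by (auto simp: less_Suc_eq_le)
  then obtain E lam where E: "eigen_adapted E lam" "card E = n" unfolding P_def by blast
  have fE: "finite E" using bnd E by blast
  have "span E = span B"
  proof (rule ccontr)
    assume ne: "span E \<noteq> span B"
    have "span E \<subseteq> span B" using E(1) unfolding eigen_adapted_def by (simp add: span_minimal)
    moreover have "span B \<subseteq> span (\<Union>l. geig A l \<inter> span B)"
      by (rule geig_span[OF lin finB order_refl subspace_span inv])
    ultimately have "\<not> (\<Union>l. geig A l \<inter> span B) \<subseteq> span E"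
      using ne span_minimal[of "\<Union>l. geig A l \<inter> span B" "span E"] by auto
    then obtain l v where v: "v \<in> geig A l" "v \<in> span B" "v \<notin> span E" by blast
    \<comment> \<open>Applying \<open>A - l\<close> to \<open>v\<close> until the next step falls
      into \<open>span E\<close> yields a vector that can be added; this ends because
      \<open>v\<close> is a generalized eigenvector.\<close>
    have "v \<in> span B \<and> v \<notin> span E \<longrightarrow>
        (\<exists>w. w \<in> geig A l \<and> w \<in> span B \<and> w \<notin> span E \<and> A w - scale l w \<in> span E)" using v(1)
    proof (induction rule: geig_induct[OF lin, consumes 1, case_names zero step])
      case zero show ?case by (simp add: span_zero)
    next
      case (step v)
      have "A v - scale l v \<in> span B" if "v \<in> span B" using that inv by (simp add: span_diff span_scale)
      then show ?case using step by blast
    qed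
    then obtain w where w: "w \<in> geig A l" "w \<in> span B" "w \<notin> span E" "A w - scale l w \<in> span E"
      using v by blast
    have "w \<notin> E" using w(3) span_base by blast
    then have "card (insert w E) = Suc n" using fE E(2) by simp
    then have "P (Suc n)" unfolding P_def using eigen_adapted_extend[OF E(1) w] by blast
    then show False using n(2) by fastforce
  qed
  then show ?thesis using E fE by blast
qed

text \<open>An operator \<open>D\<close> acting as the scalar \<open>f l\<close> on each generalized
  eigenspace is diagonal in \<open>E\<close>, so the traces of \<open>A D\<close> and
  \<open>D D\<close> see only diagonal entries, and the nilpotent part of \<open>A\<close> drops
  out.\<close>

lemma spectral_basis:
  obtains E lam where "finite E" "independent E" "span E = span B"
    "\<And>e. e \<in> E \<Longrightarrow> e \<in> geig A (lam e)"
    "\<And>l v. v \<in> geig A l \<Longrightarrow> v \<in> span B \<Longrightarrow> v \<in> span {e\<in>E. lam e = l}"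
    "independent B \<Longrightarrow> tr B (\<lambda>x. A (A x)) = (\<Sum>e\<in>E. (lam e)\<^sup>2)"
    "\<And>f D. independent B \<Longrightarrow> Vector_Spaces.linear scale scale D \<Longrightarrow>
       (\<And>l v. v \<in> geig A l \<Longrightarrow> v \<in> span B \<Longrightarrow> D v = scale (f l) v) \<Longrightarrow>
       tr B (\<lambda>x. A (D x)) = (\<Sum>e\<in>E. lam e * f (lam e)) \<and> tr B (\<lambda>x. D (D x)) = (\<Sum>e\<in>E. (f (lam e))\<^sup>2)"
proof -
  obtain E lam where E: "eigen_adapted E lam" and f: "finite E" and sp: "span E = span B"
    using ex_eigen_adapted by blast
  have i: "independent E" and g: "\<And>e. e \<in> E \<Longrightarrow> e \<in> geig A (lam e)"
    and r1: "\<And>e. e \<in> E \<Longrightarrow> representation E (A e) e = lam e"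
    and r2: "\<And>e. e \<in> E \<Longrightarrow> representation E (A (A e)) e = (lam e)\<^sup>2"
    using E unfolding eigen_adapted_def by auto
  have inE: "e \<in> span B" if "e \<in> E" for e using that sp span_base by blast
  have "v \<in> span {e\<in>E. lam e = l}" if v: "v \<in> geig A l" "v \<in> span B" for l v
  proof -
    let ?r = "representation E v"
    define F where "F = insert l (lam ` E)"
    have "finite F" "l \<in> F" by (simp_all add: F_def f)
    define s where "s m = (\<Sum>e\<in>{e\<in>E. lam e = m}. scale (?r e) e)" for m
    have sv: "(\<Sum>e\<in>E. scale (?r e) e) = v" using sum_representation[OF i f] v sp by simp
    have "(\<Sum>m\<in>F. s m) = (\<Sum>e\<in>E. scale (?r e) e)"
      unfolding s_def by (rule sum.group) (auto simp: F_def f)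
    then have s: "(\<Sum>m\<in>F. s m) = v" using sv by simp
    have sg: "s m \<in> geig A m" for m
      unfolding s_def using g by (intro subspace_sum subspace_scale geig_subspace lin) auto
    \<comment> \<open>Replacing the component \<open>s l\<close> by \<open>s l - v\<close> gives a
      vanishing sum of vectors from distinct generalized eigenspaces, hence
      \<open>v = s l\<close>.\<close>
    have "(\<Sum>m\<in>F. (if m = l then s m - v else s m)) = (\<Sum>m\<in>F. s m - (if m = l then v else 0))"
      by (intro sum.cong) auto
    also have "\<dots> = 0"
      using \<open>finite F\<close> \<open>l \<in> F\<close> by (simp add: sum_subtractf s)
    finally have "\<forall>m\<in>F. (if m = l then s m - v else s m) = 0"
      by (intro geig_independent[OF lin])
        (use f sg v in \<open>auto simp: F_def intro!: subspace_diff geig_subspace lin\<close>)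
    then have "v = s l" unfolding F_def by auto
    moreover have "s l \<in> span {e\<in>E. lam e = l}"
      unfolding s_def by (intro span_sum span_scale span_base)
    ultimately show ?thesis by simp
  qed
  moreover have "tr B (\<lambda>x. A (A x)) = (\<Sum>e\<in>E. (lam e)\<^sup>2)" if iB: "independent B"
  proof -
    have "Vector_Spaces.linear scale scale (\<lambda>x. A (A x))"
      by unfold_locales (simp_all add: A.add A.scale)
    then have "tr B (\<lambda>x. A (A x)) = tr E (\<lambda>x. A (A x))"
      using inv by (intro tr_basis_independent iB finB i f sp[symmetric]) auto
    then show ?thesis unfolding tr_def by (simp add: r2)
  qed
  moreover have "tr B (\<lambda>x. A (D x)) = (\<Sum>e\<in>E. lam e * h (lam e)) \<and> tr B (\<lambda>x. D (D x)) = (\<Sum>e\<in>E. (h (lam e))\<^sup>2)"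
    if iB: "independent B" and D: "Vector_Spaces.linear scale scale D"
      and h: "\<And>l v. v \<in> geig A l \<Longrightarrow> v \<in> span B \<Longrightarrow> D v = scale (h l) v" for h D
  proof -
    interpret D: Vector_Spaces.linear scale scale D by (rule D)
    have De: "D e = scale (h (lam e)) e" if "e \<in> E" for e using that h g inE by blast
    have DE: "D x \<in> span E" if "x \<in> span E" for x
      using that by (induction rule: span_induct_alt)
        (simp_all add: D.zero span_zero D.add D.scale De span_add span_scale span_base)
    have "tr B (\<lambda>x. A (D x)) = tr E (\<lambda>x. A (D x))"
      using inv DE sp by (intro tr_basis_independent iB finB i f sp[symmetric])
        (unfold_locales, auto simp: A.add A.scale D.add D.scale)
    moreover have "tr B (\<lambda>x. D (D x)) = tr E (\<lambda>x. D (D x))"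
      using DE sp by (intro tr_basis_independent iB finB i f sp[symmetric])
        (unfold_locales, auto simp: D.add D.scale)
    moreover have "tr E (\<lambda>x. A (D x)) = (\<Sum>e\<in>E. lam e * h (lam e))"
      unfolding tr_def
    proof (rule sum.cong[OF refl])
      fix e assume e: "e \<in> E"
      have "A e \<in> span E" using inv inE e sp by simp
      then show "representation E (A (D e)) e = lam e * h (lam e)"
        using representation_scale[OF i] r1[OF e] by (simp add: De[OF e] A.scale)
    qed
    moreover have "tr E (\<lambda>x. D (D x)) = (\<Sum>e\<in>E. (h (lam e))\<^sup>2)"
      unfolding tr_def
    proof (rule sum.cong[OF refl])
      fix e assume e: "e \<in> E"
      have "e \<in> span E" using e span_base by blast
      then show "representation E (D (D e)) e = (h (lam e))\<^sup>2"
        using representation_scale[OF i] representation_basis[OF i e] by (simp add: De[OF e] D.scale power2_eq_square)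
    qed
    ultimately show ?thesis by simp
  qed
  ultimately show ?thesis using that[OF f i sp g] by blast
qed

text \<open>The source of all operators built from a spectrum: \<open>f\<close> will be complex
  conjugation, \<open>i Im\<close>, and the indicators of \<open>l = 0\<close> and of
  \<open>Im l > 0\<close>, the last two giving spectral projections.\<close>

lemma ex_diagonal_operator:
  "\<exists>D. Vector_Spaces.linear scale scale D \<and> (\<forall>x\<in>span B. D x \<in> span B)
    \<and> (\<forall>l. \<forall>v\<in>geig A l \<inter> span B. D v = scale (f l) v)"
proof -
  interpret P: vector_space_pair scale scale by unfold_locales
  obtain E lam where f: "finite E" and i: "independent E" and sp: "span E = span B"
    and *: "\<And>l v. v \<in> geig A l \<Longrightarrow> v \<in> span B \<Longrightarrow> v \<in> span {e\<in>E. lam e = l}"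
    using spectral_basis by metis
  define D where "D = P.construct E (\<lambda>e. scale (f (lam e)) e)"
  have Dl: "Vector_Spaces.linear scale scale D" unfolding D_def by (rule P.linear_construct[OF i])
  interpret D: Vector_Spaces.linear scale scale D by (rule Dl)
  have De: "D e = scale (f (lam e)) e" if "e \<in> E" for e
    unfolding D_def using P.construct_basis[OF i that] .
  have "D x \<in> span B" if "x \<in> span E" for x
    using that by (induction rule: span_induct_alt)
      (simp_all add: sp[symmetric] D.zero span_zero D.add D.scale De span_add span_scale span_base)
  moreover have "D v = scale (f l) v" if "v \<in> geig A l" "v \<in> span B" for l v
    using *[OF that]
    by (induction rule: span_induct_alt)
      (auto simp: D.zero D.add D.scale De scale_right_distrib mult.commute)
  ultimately show ?thesis using Dl sp by auto
qed

end

end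

section \<open>Lie algebras with a real form\<close>

locale lie_alg = lin_alg scale for scale :: "'f::field \<Rightarrow> 'v::ab_group_add \<Rightarrow> 'v" +
  fixes br :: "'v \<Rightarrow> 'v \<Rightarrow> 'v"
  assumes br_add_left: "br (x + y) z = br x z + br y z"
    and br_add_right: "br x (y + z) = br x y + br x z"
    and br_scale_left: "br (scale c x) y = scale c (br x y)"
    and br_scale_right: "br x (scale c y) = scale c (br x y)"
    and br_self: "br x x = 0"
    and jacobi: "br x (br y z) = br (br x y) z + br y (br x z)"
begin

lemma br_linear: "Vector_Spaces.linear scale scale (br x)"
  by unfold_locales (simp_all add: br_add_right br_scale_right)

lemma br_zero_left [simp]: "br 0 y = 0"
  using br_scale_left[of 0 0 y] by simp

lemma br_zero_right [simp]: "br x 0 = 0"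
  using br_scale_right[of x 0 0] by simp

lemma br_anti: "br x y = - br y x"
proof -
  have "br x y + br y x = br (x + y) (x + y)"
    unfolding br_add_left br_add_right br_self[of x] br_self[of y] by (simp add: add.commute)
  then have "br x y + br y x = 0" by (simp only: br_self)
  then show ?thesis by (simp add: eq_neg_iff_add_eq_0)
qed

lemma br_minus_left: "br (- x) y = - br x y"
  using br_scale_left[of "-1" x y] by simp

lemma br_minus_right: "br x (- y) = - br x y"
  using br_scale_right[of x "-1" y] by simp

lemma br_diff_left: "br (x - y) z = br x z - br y z"
  using br_add_left[of x "- y" z] by (simp add: br_minus_left)

lemma br_diff_right: "br x (y - z) = br x y - br x z"
  using br_add_right[of x y "- z"] by (simp add: br_minus_right)

section \<open>Engel's theorem\<close>

definition subalg :: "'v set \<Rightarrow> bool" where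
  "subalg K \<longleftrightarrow> subspace K \<and> (\<forall>x\<in>K. \<forall>y\<in>K. br x y \<in> K)"

definition nil_on :: "'v set \<Rightarrow> 'v set \<Rightarrow> bool" where
  "nil_on V K \<longleftrightarrow> (\<forall>x\<in>K. \<forall>v\<in>V. \<exists>n. (br x ^^ n) v = 0)"

lemma ex_maximal_subalg:
  assumes "finite B" "K \<subseteq> span B" "subspace K" "K \<noteq> {0}"
  obtains M where "subalg M" "M \<subset> K" "\<And>L. subalg L \<Longrightarrow> M \<subseteq> L \<Longrightarrow> L \<subset> K \<Longrightarrow> L = M"
proof -
  define P where "P n \<longleftrightarrow> (\<exists>M. subalg M \<and> M \<subset> K \<and> dim M = n)" for n
  have "0 \<in> K" using assms(3) by (rule subspace_0)
  then have z: "subalg {0}" "{0} \<subset> K" using assms(4) by (auto simp: subalg_def)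
  have "\<forall>n. P n \<longrightarrow> n < dim K"
    unfolding P_def subalg_def using fin_dim_psubset[OF assms(1,2)] by blast
  moreover have "P (dim {0})" unfolding P_def using z by blast
  ultimately obtain n where n: "P n" "\<forall>m. P m \<longrightarrow> m \<le> n"
    using ex_has_greatest_nat[of P "dim {0}" "\<lambda>x. x" "dim K"] by auto
  then obtain M where M: "subalg M" "M \<subset> K" "dim M = n" unfolding P_def by blast
  have "L = M" if "subalg L" "M \<subseteq> L" "L \<subset> K" for L
  proof (rule ccontr)
    assume "L \<noteq> M"
    then have "dim M < dim L"
      using fin_dim_psubset[OF assms(1), of L M] that M assms(2) unfolding subalg_def by blast
    moreover have "dim L \<le> n" using n(2) that unfolding P_def by blast
    ultimately show False using M by simp
  qed
  then show ?thesis using that M by blast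
qed

text \<open>As \<open>[y, y] = 0\<close> and \<open>y\<close> normalizes \<open>M\<close>, brackets
  in the enlarged algebra even fall into \<open>M\<close>. The second conclusion is what makes
  derived algebras shrink.\<close>

lemma subalg_insert:
  assumes "subalg M" "\<And>k. k \<in> M \<Longrightarrow> br k y \<in> M"
  shows "subalg (span (insert y M))"
    and "u \<in> span (insert y M) \<Longrightarrow> v \<in> span (insert y M) \<Longrightarrow> br u v \<in> M"
proof -
  have sM: "subspace M" and sp: "span M = M" using assms(1) by (auto simp: subalg_def)
  show *: "br u v \<in> M" if uv: "u \<in> span (insert y M)" "v \<in> span (insert y M)" for u v
  proof -
    obtain c d where c: "u - scale c y \<in> M" and d: "v - scale d y \<in> M"
      using uv by (auto simp: span_insert sp)
    define k where "k = u - scale c y"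
    define l where "l = v - scale d y"
    have e: "u = k + scale c y" "v = l + scale d y" by (simp_all add: k_def l_def)
    have "br u v = br k l + scale d (br k y) - scale c (br l y)"
      unfolding e by (simp add: br_add_left br_add_right br_scale_left br_scale_right br_self br_anti[of y l])
    moreover have "br k l \<in> M" "br k y \<in> M" "br l y \<in> M"
      using c d assms unfolding subalg_def k_def l_def by auto
    ultimately show ?thesis using sM by (simp add: subspace_add subspace_diff subspace_scale)
  qed
  have "M \<subseteq> span (insert y M)" using span_superset by blast
  then show "subalg (span (insert y M))" unfolding subalg_def using * by auto
qed

text \<open>Engel's theorem in a relative form that needs no quotient spaces: an algebra of ad-nilpotent
  elements acting on \<open>W / U\<close> kills a nonzero vector.\<close>

lemma engel:
  assumes "finite B" "subalg K" "K \<subseteq> span B" "nil_on (span B) K"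
    and "subspace W" "subspace U" "U \<subset> W" "W \<subseteq> span B"
    and "\<And>k w. k \<in> K \<Longrightarrow> w \<in> W \<Longrightarrow> br k w \<in> W" "\<And>k w. k \<in> K \<Longrightarrow> w \<in> U \<Longrightarrow> br k w \<in> U"
  shows "\<exists>w\<in>W - U. \<forall>k\<in>K. br k w \<in> U"
  using assms(2-)
proof (induction "dim K" arbitrary: K U W rule: less_induct)
  case less
  note K = less.prems(1-3) and UW = less.prems(4-7)
  show ?case
  proof (cases "K = {0}")
    case True
    then show ?thesis using UW subspace_0[OF UW(2)] by auto
  next
    case False
    have sK: "subspace K" using K(1) by (simp add: subalg_def)
    obtain M where M: "subalg M" "M \<subset> K" "\<And>L. subalg L \<Longrightarrow> M \<subseteq> L \<Longrightarrow> L \<subset> K \<Longrightarrow> L = M"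
      using ex_maximal_subalg[OF assms(1) K(2) sK False] by metis
    have dM: "dim M < dim K"
      using fin_dim_psubset[OF assms(1) K(2) _ M(2)] M(1) by (simp add: subalg_def)
    have nM: "nil_on (span B) M" using K(3) M(2) unfolding nil_on_def by blast
    have sM: "subspace M" using M(1) by (simp add: subalg_def)
    have MB: "M \<subseteq> span B" using M K by blast
    \<comment> \<open>The induction hypothesis for \<open>M\<close> acting on \<open>K / M\<close>
      produces \<open>y\<close> outside \<open>M\<close> that normalizes \<open>M\<close>; by
      maximality of \<open>M\<close> then \<open>K = M + span y\<close>.\<close>
    have "\<exists>w\<in>K - M. \<forall>k\<in>M. br k w \<in> M"
      by (rule less.hyps[OF dM M(1) MB nM sK sM M(2) K(2)])
        (use M K in \<open>auto simp: subalg_def\<close>)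
    then obtain y where y: "y \<in> K" "y \<notin> M" "\<And>k. k \<in> M \<Longrightarrow> br k y \<in> M" by blast
    have sub: "subalg (span (insert y M))" by (rule subalg_insert(1)[OF M(1) y(3)])
    have "span (insert y M) \<subseteq> K" using M(2) y(1) sK by (intro span_minimal) auto
    moreover have "M \<subseteq> span (insert y M)" "y \<in> span (insert y M)"
      using span_superset[of "insert y M"] by auto
    ultimately have KM: "K = span (insert y M)" using M(3)[OF sub] y(2) by blast
    have "\<exists>w\<in>W - U. \<forall>k\<in>M. br k w \<in> U"
      by (rule less.hyps[OF dM M(1) MB nM UW]) (use M(2) less.prems(8,9) in blast)+
    then obtain w0 where w0: "w0 \<in> W" "w0 \<notin> U" "\<And>k. k \<in> M \<Longrightarrow> br k w0 \<in> U" by blast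
    obtain n where "(br y ^^ n) w0 = 0" using K(3) y(1) w0(1) UW(4) unfolding nil_on_def by blast
    then have n: "(br y ^^ n) w0 \<in> U" using subspace_0[OF UW(2)] by simp
    \<comment> \<open>The vectors of \<open>W / U\<close> killed by \<open>M\<close> are preserved
      by \<open>ad y\<close>, because \<open>[k, y]\<close> lies in \<open>M\<close>. Since
      \<open>ad y\<close> is nilpotent at \<open>w0\<close>, the last iterate outside
      \<open>U\<close> is killed by \<open>y\<close> as well.\<close>
    have "\<exists>w\<in>W - U. (\<forall>k\<in>M. br k w \<in> U) \<and> br y w \<in> U"
      using n w0
    proof (induction n arbitrary: w0)
      case (Suc n)
      show ?case
      proof (cases "br y w0 \<in> U")
        case False
        have "br k (br y w0) \<in> U" if k: "k \<in> M" for k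
        proof -
          have "br (br k y) w0 \<in> U" using y(3)[OF k] Suc.prems(4) by blast
          moreover have "br y (br k w0) \<in> U" using less.prems(9) y(1) Suc.prems(4)[OF k] by blast
          ultimately show ?thesis unfolding jacobi[of k y w0] using UW(2) subspace_add by blast
        qed
        moreover have "(br y ^^ n) (br y w0) \<in> U" using Suc.prems(1) by (simp only: funpow_Suc_right o_apply)
        moreover have "br y w0 \<in> W" using less.prems(8) y(1) Suc.prems(2) by blast
        ultimately show ?thesis using Suc.IH False by blast
      qed (use Suc.prems in blast)
    qed simp
    then obtain w where w: "w \<in> W - U" "\<And>k. k \<in> M \<Longrightarrow> br k w \<in> U" "br y w \<in> U" by blast
    have "br k w \<in> U" if "k \<in> K" for k
      using that unfolding KM
    proof (induction rule: span_induct_alt)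
      case base show ?case using subspace_0[OF UW(2)] by simp
    next
      case (step c x z)
      then have "br x w \<in> U" using w by blast
      then show ?case using step UW(2) by (simp add: br_add_left br_scale_left subspace_add subspace_scale)
    qed
    then show ?thesis using w(1) by blast
  qed
qed

text \<open>Engel's theorem for a maximal subalgebra \<open>M\<close> acting on \<open>K / M\<close>
  gives \<open>K = M + span y\<close> with \<open>y\<close> normalizing \<open>M\<close>, so all
  brackets fall into the proper subspace \<open>M\<close>.\<close>

lemma engel_derived:
  assumes "finite B" "subalg K" "K \<subseteq> span B" "nil_on (span B) K" "K \<noteq> {0}"
  shows "span {br x y |x y. x \<in> K \<and> y \<in> K} \<subset> K"
proof -
  have sK: "subspace K" using assms(2) by (simp add: subalg_def)
  obtain M where M: "subalg M" "M \<subset> K" "\<And>L. subalg L \<Longrightarrow> M \<subseteq> L \<Longrightarrow> L \<subset> K \<Longrightarrow> L = M"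
    using ex_maximal_subalg[OF assms(1,3) sK assms(5)] by metis
  have sM: "subspace M" using M(1) by (simp add: subalg_def)
  have "\<exists>w\<in>K - M. \<forall>k\<in>M. br k w \<in> M"
  proof (rule engel[OF assms(1) M(1) _ _ sK sM M(2) assms(3)])
    show "M \<subseteq> span B" "nil_on (span B) M" using M(2) assms(3,4) by (auto simp: nil_on_def)
  qed (use M assms(2) in \<open>auto simp: subalg_def\<close>)
  then obtain y where y: "y \<in> K" "y \<notin> M" "\<And>k. k \<in> M \<Longrightarrow> br k y \<in> M" by blast
  have sub: "subalg (span (insert y M))" by (rule subalg_insert(1)[OF M(1) y(3)])
  have "span (insert y M) \<subseteq> K" using M(2) y(1) sK by (intro span_minimal) auto
  moreover have "M \<subseteq> span (insert y M)" "y \<in> span (insert y M)"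
    using span_superset[of "insert y M"] by auto
  ultimately have KM: "K = span (insert y M)" using M(3)[OF sub] y(2) by blast
  have "{br x y |x y. x \<in> K \<and> y \<in> K} \<subseteq> M"
    using subalg_insert(2)[OF M(1) y(3)] unfolding KM by blast
  then show ?thesis using span_minimal[OF _ sM] M(2) by blast
qed

end

lemma derived_series_shift:
  "derived_series s br I (Suc k) = derived_series s br (derived_series s br I 1) k"
  by (induction k) auto


locale real_lie_alg = lie_alg scale br for scale :: "real \<Rightarrow> 'v::ab_group_add \<Rightarrow> 'v" and br
begin

text \<open>The derived algebra is again a subalgebra of ad-nilpotent elements, and
  \<open>engel_derived\<close> makes it strictly smaller.\<close>

lemma engel_solvable:
  assumes "finite B" "subalg K" "K \<subseteq> span B" "nil_on (span B) K"
  shows "lie_solvable scale br K"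
  using assms(2-)
proof (induction "dim K" arbitrary: K rule: less_induct)
  case less
  show ?case
  proof (cases "K = {0}")
    case True
    then have "derived_series scale br K 0 = {0}" by simp
    then show ?thesis unfolding lie_solvable_def by blast
  next
    case False
    define D where "D = derived_series scale br K 1"
    have D: "D = span {br x y |x y. x \<in> K \<and> y \<in> K}" by (simp add: D_def)
    have DK: "D \<subset> K" unfolding D using engel_derived[OF assms(1) less.prems False] .
    have "dim D < dim K" using fin_dim_psubset[OF assms(1) less.prems(2) _ DK] D by simp
    moreover have "subalg D" unfolding subalg_def
    proof (intro conjI ballI)
      show "subspace D" by (simp add: D)
      fix x y assume "x \<in> D" "y \<in> D"
      then have "br x y \<in> {br x y |x y. x \<in> K \<and> y \<in> K}" using DK by blast
      then show "br x y \<in> D" unfolding D by (rule span_base)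
    qed
    moreover have "D \<subseteq> span B" "nil_on (span B) D" using DK less.prems unfolding nil_on_def by blast+
    ultimately have "lie_solvable scale br D" using less.hyps by blast
    then obtain k where "derived_series scale br D k = {0}" unfolding lie_solvable_def by blast
    then have "derived_series scale br K (Suc k) = {0}" unfolding D_def by (subst derived_series_shift)
    then show ?thesis unfolding lie_solvable_def by blast
  qed
qed

end

text \<open>The bracket is defined on the whole ambient space, with values in \<open>span Bs\<close>, so that no carrier
  conditions are needed for bilinearity.\<close>

locale real_form = clin_alg scale + lie_alg scale br
  for scale :: "complex \<Rightarrow> 'v::ab_group_add \<Rightarrow> 'v" and br +
  fixes Bs :: "'v set" and \<sigma> :: "'v \<Rightarrow> 'v"
  assumes Bs: "independent Bs" "finite Bs"
    and br_in: "br x y \<in> span Bs"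
    and sig_add: "\<sigma> (x + y) = \<sigma> x + \<sigma> y"
    and sig_scale: "\<sigma> (scale c x) = scale (cnj c) (\<sigma> x)"
    and sig_sig: "\<sigma> (\<sigma> x) = x"
    and sig_Bs: "b \<in> Bs \<Longrightarrow> \<sigma> b = b"
    and sig_br: "x \<in> span Bs \<Longrightarrow> y \<in> span Bs \<Longrightarrow> \<sigma> (br x y) = br (\<sigma> x) (\<sigma> y)"
begin

abbreviation G :: "'v set" where "G \<equiv> span Bs"

definition G0 :: "'v set" where "G0 = {x \<in> G. \<sigma> x = x}"

abbreviation rscale :: "real \<Rightarrow> 'v \<Rightarrow> 'v" where "rscale r \<equiv> scale (of_real r)"

text \<open>The same space with scalars restricted to the reals: semisimplicity, and hence Engel's
  theorem, are applied to subspaces of the real form.\<close>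

sublocale R: real_lie_alg rscale br
  by (unfold_locales; (rule jacobi)?)
    (simp_all add: scale_right_distrib scale_left_distrib br_add_left br_add_right br_scale_left
      br_scale_right br_self)

lemma sig_0: "\<sigma> 0 = 0"
  using sig_scale[of 0 0] by simp

lemma sig_minus: "\<sigma> (- x) = - \<sigma> x"
  using sig_scale[of "-1" x] by simp

lemma sig_diff: "\<sigma> (x - y) = \<sigma> x - \<sigma> y"
  using sig_add[of x "- y"] by (simp add: sig_minus)

lemma sig_sum: "\<sigma> (sum f S) = (\<Sum>i\<in>S. \<sigma> (f i))"
  by (induction S rule: infinite_finite_induct) (simp_all add: sig_0 sig_add)

lemma sig_rep:
  assumes "v \<in> G"
  shows "\<sigma> v = (\<Sum>b\<in>Bs. scale (cnj (representation Bs v b)) b)"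
proof -
  have "\<sigma> v = \<sigma> (\<Sum>b\<in>Bs. scale (representation Bs v b) b)"
    using sum_representation[OF Bs assms] by simp
  then show ?thesis by (simp add: sig_sum sig_scale sig_Bs)
qed

lemma sig_in: "v \<in> G \<Longrightarrow> \<sigma> v \<in> G"
  by (simp add: sig_rep span_sum span_scale span_base)

lemma representation_sig:
  assumes "v \<in> G" "b \<in> Bs"
  shows "representation Bs (\<sigma> v) b = cnj (representation Bs v b)"
  unfolding sig_rep[OF assms(1)] using Bs assms(2)
  by (simp add: representation_sum representation_scale span_base span_scale representation_basis if_distrib cong: if_cong)

lemma G0_in: "x \<in> G0 \<Longrightarrow> x \<in> G" and G0_sig: "x \<in> G0 \<Longrightarrow> \<sigma> x = x"
  by (auto simp: G0_def)

lemma G0_subspace: "R.subspace G0"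
  by (auto simp: R.subspace_def G0_def span_zero span_add span_scale sig_0 sig_add sig_scale)

lemma G0_br: "x \<in> G0 \<Longrightarrow> y \<in> G0 \<Longrightarrow> br x y \<in> G0"
  by (simp add: G0_def br_in sig_br)

text \<open>Conjugation fixes \<open>Bs\<close>, so a fixed vector has real coordinates. This is
  what bounds real dimensions of subspaces of \<open>G0\<close>.\<close>

lemma G0_span: "G0 \<subseteq> R.span Bs"
proof
  fix x assume x: "x \<in> G0"
  have "cnj (representation Bs x b) = representation Bs x b" if "b \<in> Bs" for b
    using representation_sig[of x b] that x by (simp add: G0_def)
  then have "of_real (Re (representation Bs x b)) = representation Bs x b" if "b \<in> Bs" for b
    using that by (metis Reals_cnj_iff of_real_Re)
  then have "x = (\<Sum>b\<in>Bs. rscale (Re (representation Bs x b)) b)"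
    using sum_representation[OF Bs] x G0_in by simp
  then show "x \<in> R.span Bs" by (metis (no_types, lifting) R.span_base R.span_scale R.span_sum)
qed

definition re :: "'v \<Rightarrow> 'v" where "re x = scale (1/2) (x + \<sigma> x)"
definition im :: "'v \<Rightarrow> 'v" where "im x = scale (- \<i> / 2) (x - \<sigma> x)"

lemma re_G0: "x \<in> G \<Longrightarrow> re x \<in> G0"
  by (auto simp: G0_def re_def sig_in sig_scale sig_add sig_sig span_scale span_add add.commute)

lemma im_G0:
  assumes "x \<in> G"
  shows "im x \<in> G0"
proof -
  have "\<sigma> (im x) = scale (cnj (- \<i> / 2)) (\<sigma> x - x)"
    by (simp only: im_def sig_scale sig_diff sig_sig)
  also have "\<dots> = scale (- (- \<i> / 2)) (- (x - \<sigma> x))" by simp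
  also have "\<dots> = im x" unfolding im_def by (simp only: scale_minus_left scale_minus_right minus_minus)
  finally have "\<sigma> (im x) = im x" .
  moreover have "im x \<in> G" unfolding im_def using assms by (intro span_scale span_diff sig_in)
  ultimately show ?thesis by (simp add: G0_def)
qed

lemma re_im: "x = re x + scale \<i> (im x)"
proof -
  have "re x + scale \<i> (im x) = scale (1/2) ((x + \<sigma> x) + (x - \<sigma> x))"
    unfolding re_def im_def by (simp only: scale_scale scale_right_distrib) simp
  also have "\<dots> = scale (1/2) (scale 2 x)"
    by (simp flip: scale_left_distrib[of 1 1 x, simplified])
  also have "\<dots> = x" by simp
  finally show ?thesis by simp
qed

section \<open>The Killing form and derivations\<close>

definition kil :: "'v \<Rightarrow> 'v \<Rightarrow> complex" where
  "kil x y = tr Bs (\<lambda>v. br x (br y v))"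

lemma tr_swap':
  assumes "Vector_Spaces.linear scale scale S" "Vector_Spaces.linear scale scale T"
    "\<And>x. x \<in> G \<Longrightarrow> S x \<in> G" "\<And>x. x \<in> G \<Longrightarrow> T x \<in> G"
  shows "tr Bs (\<lambda>x. S (T x)) = tr Bs (\<lambda>x. T (S x))"
  using assms by (intro tr_swap Bs refl) auto

lemma kil_sym: "kil x y = kil y x"
  unfolding kil_def by (intro tr_swap' br_linear br_in)

lemma kil_add_left: "kil (x + y) z = kil x z + kil y z"
  unfolding kil_def by (simp add: br_add_left tr_add Bs br_in)

lemma kil_scale_left: "kil (scale c x) z = c * kil x z"
  unfolding kil_def by (simp add: br_scale_left tr_scale Bs br_in)

lemma kil_add_right: "kil z (x + y) = kil z x + kil z y"
  by (metis kil_add_left kil_sym)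

lemma kil_scale_right: "kil z (scale c x) = c * kil z x"
  by (metis kil_scale_left kil_sym)

lemma kil_zero_left [simp]: "kil 0 y = 0"
  using kil_scale_left[of 0 0 y] by simp

lemma kil_zero_right [simp]: "kil y 0 = 0"
  using kil_sym kil_zero_left by metis

lemma kil_minus_right: "kil z (- x) = - kil z x"
  using kil_scale_right[of z "-1" x] by simp

lemma kil_minus_left: "kil (- x) z = - kil x z"
  using kil_scale_left[of "-1" x z] by simp

lemma kil_diff_left: "kil (x - y) z = kil x z - kil y z"
  using kil_add_left[of x "- y" z] by (simp add: kil_minus_left)

definition derivation :: "('v \<Rightarrow> 'v) \<Rightarrow> bool" where
  "derivation D \<longleftrightarrow> Vector_Spaces.linear scale scale D \<and> (\<forall>x\<in>G. D x \<in> G) \<and>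
     (\<forall>u\<in>G. \<forall>v\<in>G. D (br u v) = br (D u) v + br u (D v))"

text \<open>Cyclicity gives \<open>tr (ad w ad u D) = tr (ad u D ad w)\<close>, and the Leibniz rule
  splits \<open>D ad w\<close> into \<open>ad (D w) + ad w D\<close>. For inner \<open>D\<close>
  this is the invariance of the Killing form; the general case drives the nilpotency argument for
  its radical.\<close>

lemma tr_br_derivation:
  assumes D: "derivation D" and "u \<in> G" "w \<in> G"
  shows "tr Bs (\<lambda>v. br (br u w) (D v)) = - kil u (D w)"
proof -
  have Dl: "Vector_Spaces.linear scale scale D" and DG: "\<And>x. x \<in> G \<Longrightarrow> D x \<in> G"
    using D by (auto simp: derivation_def)
  interpret D: Vector_Spaces.linear scale scale D by (rule Dl)
  have l: "Vector_Spaces.linear scale scale (\<lambda>v. br u (D v))"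
    by unfold_locales (simp_all add: D.add D.scale br_add_right br_scale_right)
  have "tr Bs (\<lambda>v. br (br u w) (D v)) = tr Bs (\<lambda>v. br u (br w (D v)) - br w (br u (D v)))"
    by (rule tr_cong) (simp add: jacobi[of u w])
  also have "\<dots> = tr Bs (\<lambda>v. br u (br w (D v))) - tr Bs (\<lambda>v. br w (br u (D v)))"
    by (intro tr_diff Bs br_in)
  also have "tr Bs (\<lambda>v. br w (br u (D v))) = tr Bs (\<lambda>v. br u (D (br w v)))"
    by (rule tr_swap'[OF br_linear l]) (rule br_in)+
  also have "tr Bs (\<lambda>v. br u (D (br w v))) = tr Bs (\<lambda>v. br u (br (D w) v) + br u (br w (D v)))"
    using D assms(3) by (intro tr_cong) (simp add: derivation_def span_base br_add_right)
  also have "\<dots> = kil u (D w) + tr Bs (\<lambda>v. br u (br w (D v)))"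
    unfolding kil_def by (intro tr_add Bs br_in)
  finally show ?thesis by simp
qed

lemma derivation_br: "derivation (br x)"
  by (auto simp: derivation_def br_linear br_in intro: jacobi)

lemma kil_inv:
  assumes "y \<in> G" "x \<in> G"
  shows "kil (br x y) z = kil x (br y z)"
proof -
  have "kil (br x y) z = - kil x (br z y)"
    unfolding kil_def[of "br x y"] by (rule tr_br_derivation[OF derivation_br assms(2,1)])
  also have "\<dots> = kil x (br y z)" by (simp only: br_anti[of z y] kil_minus_right minus_minus)
  finally show ?thesis .
qed

text \<open>Conjugation fixes \<open>Bs\<close> and commutes with the operator, so every diagonal
  matrix entry is fixed by complex conjugation.\<close>

lemma kil_real:
  assumes "x \<in> G0" "y \<in> G0"
  shows "kil x y \<in> \<real>"
  unfolding kil_def tr_def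
proof (rule sum_in_Reals)
  fix b assume b: "b \<in> Bs"
  then have "b \<in> G0" by (simp add: G0_def span_base sig_Bs)
  then have "\<sigma> (br x (br y b)) = br x (br y b)" using assms G0_br G0_sig by simp
  then show "representation Bs (br x (br y b)) b \<in> \<real>"
    using representation_sig[OF br_in b, of x "br y b"] by (metis Reals_cnj_iff)
qed

lemma geig_span_G: "G \<subseteq> span (\<Union>l. geig (br x) l \<inter> G)"
  by (rule geig_span[OF br_linear Bs(2) order_refl subspace_span]) (rule br_in)

lemma geig_G_induct [consumes 1, case_names zero add]:
  assumes "v \<in> G" "P 0"
    and "\<And>l u w. u \<in> geig (br x) l \<Longrightarrow> u \<in> G \<Longrightarrow> w \<in> G \<Longrightarrow> P w \<Longrightarrow> P (u + w)"
  shows "P v"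
proof -
  have sb: "subspace (geig (br x) l \<inter> G)" for l
    using geig_subspace[OF br_linear] by (simp add: subspace_inter)
  have "v \<in> span (\<Union>l. geig (br x) l \<inter> G)" using geig_span_G assms(1) by blast
  then have "v \<in> G \<and> P v"
  proof (induction rule: span_induct_alt)
    case base show ?case using assms(2) by (simp add: span_zero)
  next
    case (step c u w)
    then obtain l where "u \<in> geig (br x) l \<inter> G" by blast
    then have "scale c u \<in> geig (br x) l \<inter> G" using sb subspace_scale by blast
    then show ?case using assms(3)[of "scale c u" l w] step(2) by (simp add: span_add)
  qed
  then show ?thesis by simp
qed

text \<open>By the Jacobi identity \<open>ad x - (l + m)\<close> acts on \<open>[u, v]\<close> as
  \<open>ad x - l\<close> on the first entry plus \<open>ad x - m\<close> on the second; the
  induction is on the sum of the two exponents.\<close>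

lemma geig_br:
  assumes "u \<in> geig (br x) l" "v \<in> geig (br x) m"
  shows "br u v \<in> geig (br x) (l + m)"
proof -
  have *: "br u v \<in> geig (br x) (l + m)"
    if "((\<lambda>v. br x v - scale l v) ^^ j) u = 0" "((\<lambda>v. br x v - scale m v) ^^ k) v = 0" "j + k = n" for j k n u v
    using that
  proof (induction n arbitrary: j k u v)
    case 0
    then show ?case using subspace_0[OF geig_subspace[OF br_linear]] by simp
  next
    case (Suc n)
    show ?case
    proof (cases "j = 0 \<or> k = 0")
      case True
      then have "u = 0 \<or> v = 0" using Suc.prems by auto
      then show ?thesis using subspace_0[OF geig_subspace[OF br_linear]] by auto
    next
      case False
      then obtain j' k' where jk: "j = Suc j'" "k = Suc k'" by (meson not0_implies_Suc)
      have 1: "br (br x u - scale l u) v \<in> geig (br x) (l + m)"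
        using Suc.IH[of j' "br x u - scale l u" k v] Suc.prems jk by (simp add: funpow_Suc_right del: funpow.simps)
      have 2: "br u (br x v - scale m v) \<in> geig (br x) (l + m)"
        using Suc.IH[of j u k' "br x v - scale m v"] Suc.prems jk by (simp add: funpow_Suc_right del: funpow.simps)
      have e: "br x (br u v) - scale (l + m) (br u v) = br (br x u - scale l u) v + br u (br x v - scale m v)"
        unfolding jacobi[of x u v]
        by (simp add: br_diff_left br_diff_right br_scale_left br_scale_right scale_left_distrib)
      show ?thesis
        by (rule geig_step, subst e) (rule subspace_add[OF geig_subspace[OF br_linear] 1 2])
    qed
  qed
  show ?thesis using assms * unfolding geig_def[of _ l] geig_def[of _ m] by blast
qed

lemma geig_sig:
  assumes x: "x \<in> G0" and v: "v \<in> geig (br x) l" "v \<in> G"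
  shows "\<sigma> v \<in> geig (br x) (cnj l)"
proof -
  have "v \<in> G \<longrightarrow> \<sigma> v \<in> geig (br x) (cnj l)" using v(1)
  proof (induction rule: geig_induct[OF br_linear, consumes 1, case_names zero step])
    case zero
    show ?case using subspace_0[OF geig_subspace[OF br_linear]] by (simp add: sig_0)
  next
    case (step v)
    show ?case
    proof
      assume v: "v \<in> G"
      then have "br x v - scale l v \<in> G" by (simp add: span_diff span_scale br_in)
      then have "\<sigma> (br x v - scale l v) \<in> geig (br x) (cnj l)" using step by blast
      moreover have "\<sigma> (br x v - scale l v) = br x (\<sigma> v) - scale (cnj l) (\<sigma> v)"
        using x v by (simp add: sig_diff sig_scale sig_br G0_in G0_sig)
      ultimately have "br x (\<sigma> v) - scale (cnj l) (\<sigma> v) \<in> geig (br x) (cnj l)" by simp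
      then show "\<sigma> v \<in> geig (br x) (cnj l)" by (rule geig_step)
    qed
  qed
  then show ?thesis using v(2) by blast
qed

text \<open>Brackets add eigenvalues, so additivity of \<open>f\<close> is exactly the Leibniz rule
  on generalized eigenvectors. The applications use conjugation and \<open>i Im\<close>, which are
  additive but not complex linear.\<close>

lemma diagonal_derivation:
  assumes D: "Vector_Spaces.linear scale scale D" "\<forall>x\<in>G. D x \<in> G"
    and Df: "\<forall>l. \<forall>v\<in>geig (br x) l \<inter> G. D v = scale (f l) v"
    and f: "\<And>l m. f (l + m) = f l + f m"
  shows "derivation D"
proof -
  interpret D: Vector_Spaces.linear scale scale D by (rule D)
  have "D (br u v) = br (D u) v + br u (D v)" if "u \<in> G" "v \<in> G" for u v
    using that(1)
  proof (induction rule: geig_G_induct[where x=x])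
    case zero show ?case by (simp add: D.zero)
  next
    case (add l u u')
    have "D (br u v) = br (D u) v + br u (D v)" using that(2)
    proof (induction rule: geig_G_induct[where x=x])
      case zero show ?case by (simp add: D.zero)
    next
      case add': (add m w w')
      have "br u w \<in> geig (br x) (l + m) \<inter> G" using geig_br add add' br_in by blast
      then have "D (br u w) = br (D u) w + br u (D w)"
        using Df[rule_format, of "br u w" "l + m"] Df[rule_format, of u l] Df[rule_format, of w m] add(1,2) add'(1,2)
        by (simp add: f scale_left_distrib br_scale_left br_scale_right)
      then show ?case using add' by (simp add: br_add_right D.add)
    qed
    then show ?case using add by (simp add: br_add_left D.add)
  qed
  then show ?thesis using D by (simp add: derivation_def)
qed

text \<open>Conjugation exchanges the generalized eigenspaces of \<open>l\<close> and
  \<open>cnj l\<close>; a function \<open>f\<close> compatible with that gives an operator defined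
  over the real form.\<close>

lemma diagonal_sig:
  assumes x: "x \<in> G0" and D: "Vector_Spaces.linear scale scale D"
    and Df: "\<forall>l. \<forall>v\<in>geig (br x) l \<inter> G. D v = scale (f l) v"
    and f: "\<And>l. f (cnj l) = cnj (f l)" and v: "v \<in> G"
  shows "D (\<sigma> v) = \<sigma> (D v)"
proof -
  interpret D: Vector_Spaces.linear scale scale D by (rule D)
  show ?thesis using v
  proof (induction rule: geig_G_induct[where x=x])
    case zero show ?case by (simp add: D.zero sig_0)
  next
    case (add l u w)
    have "\<sigma> u \<in> geig (br x) (cnj l) \<inter> G" using geig_sig x add sig_in by blast
    then show ?case using Df[rule_format, of "\<sigma> u" "cnj l"] Df[rule_format, of u l] add
      by (simp add: D.add sig_add sig_scale f)
  qed
qed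

end

section \<open>The radical of the Killing form\<close>

context real_form
begin

text \<open>Orthogonality is required against all of \<open>G\<close>, since it will be applied to
  vectors \<open>D u\<close> that need not be real.\<close>

definition real_radical :: "'v set" where
  "real_radical = {x \<in> G0. \<forall>y\<in>G. kil x y = 0}"

lemma br_real_radical:
  assumes "x \<in> G0" "y \<in> real_radical"
  shows "br x y \<in> real_radical"
proof -
  have y: "y \<in> G0" "\<And>z. z \<in> G \<Longrightarrow> kil y z = 0" using assms by (auto simp: real_radical_def)
  have "kil (br x y) z = 0" if "z \<in> G" for z
  proof -
    have "kil (br x y) z = - kil (br y x) z" by (simp only: br_anti[of x y] kil_minus_left)
    also have "kil (br y x) z = kil y (br x z)" using y(1) assms(1) by (simp add: kil_inv G0_in)
    finally show ?thesis using y(2) br_in by simp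
  qed
  then show ?thesis using assms y by (simp add: real_radical_def G0_br)
qed

lemma real_radical_subspace: "R.subspace real_radical"
  using G0_subspace
  by (auto simp: R.subspace_def real_radical_def kil_add_left kil_scale_left)

text \<open>The trick of Cartan's criterion: for the diagonal derivation \<open>D\<close> with
  eigenvalues \<open>cnj l\<close>, the trace of \<open>ad z D\<close> is the sum of all
  \<open>|l|^2\<close>. Moving \<open>D\<close> into the Killing form shows that this trace vanishes
  for brackets with the radical, so 0 is the only eigenvalue of \<open>ad z\<close>.\<close>

lemma radical_bracket_nilpotent:
  assumes z: "z \<in> R.span {br x y |x y. x \<in> G0 \<and> y \<in> real_radical}" and "v \<in> G"
  shows "\<exists>n. (br z ^^ n) v = 0"
proof -
  obtain D where D: "Vector_Spaces.linear scale scale D" "\<forall>x\<in>G. D x \<in> G"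
    "\<forall>l. \<forall>v\<in>geig (br z) l \<inter> G. D v = scale (cnj l) v"
    using ex_diagonal_operator[OF br_linear Bs(2) br_in, of z cnj] by blast
  have der: "derivation D" by (rule diagonal_derivation[OF D]) simp
  obtain E lam where E: "finite E" "independent E" "span E = G"
    "\<And>e. e \<in> E \<Longrightarrow> e \<in> geig (br z) (lam e)"
    and t: "\<And>f D. independent Bs \<Longrightarrow> Vector_Spaces.linear scale scale D \<Longrightarrow>
       (\<And>l v. v \<in> geig (br z) l \<Longrightarrow> v \<in> G \<Longrightarrow> D v = scale (f l) v) \<Longrightarrow>
       tr Bs (\<lambda>x. br z (D x)) = (\<Sum>e\<in>E. lam e * f (lam e)) \<and> tr Bs (\<lambda>x. D (D x)) = (\<Sum>e\<in>E. (f (lam e))\<^sup>2)"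
    by (rule spectral_basis[OF br_linear[of z] Bs(2) br_in]) blast
  have "tr Bs (\<lambda>v. br z (D v)) = 0" using z
  proof (induction rule: R.span_induct_alt)
    case base
    show ?case by (simp add: tr_def representation_zero)
  next
    case (step c x y)
    obtain u w where u: "x = br u w" "u \<in> G0" "w \<in> real_radical" using step(1) by blast
    then have w: "w \<in> G0" by (simp add: real_radical_def)
    have "tr Bs (\<lambda>v. br (scale c x + y) (D v)) = tr Bs (\<lambda>v. scale c (br x (D v)) + br y (D v))"
      by (simp add: br_add_left br_scale_left)
    also have "\<dots> = c * tr Bs (\<lambda>v. br x (D v)) + tr Bs (\<lambda>v. br y (D v))"
      by (simp add: tr_add tr_scale Bs br_in span_scale)
    \<comment> \<open>The bracket is reversed so that \<open>tr_br_derivation\<close> leaves the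
      radical element \<open>w\<close> alone and applies \<open>D\<close> to
      \<open>u\<close>.\<close>
    also have "tr Bs (\<lambda>v. br x (D v)) = tr Bs (\<lambda>v. - br (br w u) (D v))"
      unfolding u(1) br_anti[of u w] br_minus_left ..
    also have "\<dots> = - tr Bs (\<lambda>v. br (br w u) (D v))"
      using tr_scale[OF Bs(1), of "\<lambda>v. br (br w u) (D v)" "-1"] br_in by simp
    also have "tr Bs (\<lambda>v. br (br w u) (D v)) = - kil w (D u)"
      using tr_br_derivation[OF der, of w u] u w G0_in by simp
    also have "kil w (D u) = 0" using u D(2) G0_in by (simp add: real_radical_def)
    finally show ?case using step by simp
  qed
  then have "(\<Sum>e\<in>E. lam e * cnj (lam e)) = 0" using t[OF Bs(1) D(1), of cnj] D(3) by simp
  then have "(\<Sum>e\<in>E. complex_of_real ((cmod (lam e))\<^sup>2)) = 0"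
    by (simp only: complex_norm_square)
  then have "(\<Sum>e\<in>E. (cmod (lam e))\<^sup>2) = 0" by (simp flip: of_real_sum of_real_power)
  then have "\<forall>e\<in>E. lam e = 0" using E(1) by (simp add: sum_nonneg_eq_0_iff)
  then have "E \<subseteq> geig (br z) 0" using E(4) by force
  then have "G \<subseteq> geig (br z) 0" using span_minimal[OF _ geig_subspace[OF br_linear]] E(3) by metis
  then have "v \<in> geig (br z) 0" using assms(2) by blast
  then show ?thesis by (simp add: geig_def)
qed

end

section \<open>Semisimplicity: nondegenerate Killing form, inner derivations, elliptic parts\<close>

locale semisimple_real_form = real_form scale br Bs \<sigma>
  for scale :: "complex \<Rightarrow> 'v::ab_group_add \<Rightarrow> 'v" and br Bs \<sigma> +
  assumes ss: "lie_semisimple rscale br G0"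
begin

text \<open>Semisimplicity enters twice. The ideal \<open>N\<close> of brackets with the radical
  consists of ad-nilpotent elements, so it is solvable by Engel and vanishes; then the radical is an
  abelian ideal and vanishes too.\<close>

lemma real_radical_zero: "real_radical = {0}"
proof -
  define N where "N = R.span {br x y |x y. x \<in> G0 \<and> y \<in> real_radical}"
  have radG: "real_radical \<subseteq> G0" by (auto simp: real_radical_def)
  have Nrad: "N \<subseteq> real_radical" unfolding N_def
    using br_real_radical by (intro R.span_minimal real_radical_subspace) auto
  have brN: "br x y \<in> N" if "x \<in> G0" "y \<in> real_radical" for x y
    unfolding N_def using that by (intro R.span_base) blast
  have sN: "R.subspace N" by (simp add: N_def)
  have iN: "lie_ideal rscale br G0 N"
    unfolding lie_ideal_def using Nrad radG brN sN by blast
  have subN: "R.subalg N" unfolding R.subalg_def using sN brN Nrad radG by blast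
  have NB: "N \<subseteq> R.span Bs" using Nrad radG G0_span by blast
  have "R.span Bs \<subseteq> G"
  proof -
    have "R.subspace G" by (auto simp: R.subspace_def span_zero span_add span_scale)
    then show ?thesis using R.span_minimal[of Bs G] span_superset by blast
  qed
  then have "R.nil_on (R.span Bs) N"
    unfolding R.nil_on_def N_def using radical_bracket_nilpotent by blast
  then have "lie_solvable rscale br N" using R.engel_solvable[OF Bs(2) subN NB] by blast
  then have N0: "N = {0}" using ss iN unfolding lie_semisimple_def by blast
  have "derived_series rscale br real_radical 1 = {0}"
  proof -
    have "{br x y |x y. x \<in> real_radical \<and> y \<in> real_radical} \<subseteq> {0}"
      using brN N0 radG by blast
    then show ?thesis using R.span_minimal[of _ "{0}"] R.span_zero by (simp, blast)
  qed
  then have "lie_solvable rscale br real_radical" unfolding lie_solvable_def by blast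
  moreover have "lie_ideal rscale br G0 real_radical"
    unfolding lie_ideal_def using radG real_radical_subspace br_real_radical by blast
  ultimately show ?thesis using ss unfolding lie_semisimple_def by blast
qed

text \<open>Against real \<open>y\<close> the values of \<open>kil\<close> at \<open>re x\<close>
  and \<open>im x\<close> are real, so they vanish separately and both parts lie in the
  radical.\<close>

lemma kil_nondegenerate:
  assumes x: "x \<in> G" and k: "\<And>y. y \<in> G \<Longrightarrow> kil x y = 0"
  shows "x = 0"
proof -
  have 0: "kil (re x) y = 0 \<and> kil (im x) y = 0" if y: "y \<in> G0" for y
  proof -
    have "kil (re x) y + \<i> * kil (im x) y = kil x y"
      by (subst (3) re_im[of x]) (simp add: kil_add_left kil_scale_left)
    also have "\<dots> = 0" using k y G0_in by blast
    finally have "kil (re x) y + \<i> * kil (im x) y = 0" .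
    moreover have "kil (re x) y \<in> \<real>" "kil (im x) y \<in> \<real>"
      using kil_real re_G0 im_G0 x y by auto
    ultimately show ?thesis by (auto simp: complex_eq_iff complex_is_Real_iff)
  qed
  have "kil z y = 0" if z: "\<And>y. y \<in> G0 \<Longrightarrow> kil z y = 0" and y: "y \<in> G" for z y
    by (subst re_im[of y]) (simp add: kil_add_right kil_scale_right z re_G0 im_G0 y)
  then have "re x \<in> real_radical" "im x \<in> real_radical"
    using 0 x by (auto simp: real_radical_def re_G0 im_G0)
  then have "re x = 0" "im x = 0" using real_radical_zero by auto
  then show ?thesis using re_im[of x] by simp
qed

lemma centre_trivial: "x \<in> G \<Longrightarrow> (\<And>v. v \<in> G \<Longrightarrow> br x v = 0) \<Longrightarrow> x = 0"
  by (intro kil_nondegenerate) (auto simp: kil_def tr_def br_in representation_zero)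

text \<open>Nondegeneracy represents the functional \<open>y \<mapsto> tr (D ad y)\<close> as
  \<open>kil d\<close>. For \<open>E = D - ad d\<close> all traces \<open>tr (E ad y)\<close>
  vanish; as \<open>ad (E a)\<close> is the commutator of \<open>E\<close> and \<open>ad a\<close>,
  cyclicity gives \<open>kil (E a) b = tr (E ad [a, b]) = 0\<close>.\<close>

lemma derivation_inner:
  assumes D: "derivation D"
  shows "\<exists>d\<in>G. \<forall>v\<in>G. D v = br d v"
proof -
  have Dl: "Vector_Spaces.linear scale scale D" and DG: "\<And>x. x \<in> G \<Longrightarrow> D x \<in> G"
    using D by (auto simp: derivation_def)
  interpret D: Vector_Spaces.linear scale scale D by (rule Dl)
  have "\<exists>d\<in>G. \<forall>y\<in>G. kil d y = tr Bs (\<lambda>v. D (br y v))"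
  proof (rule riesz[OF Bs])
    show "x = 0" if "x \<in> G" "\<And>y. y \<in> G \<Longrightarrow> kil x y = 0" for x
      using that by (rule kil_nondegenerate)
    show "tr Bs (\<lambda>v. D (br (x + y) v)) = tr Bs (\<lambda>v. D (br x v)) + tr Bs (\<lambda>v. D (br y v))" for x y
      by (simp add: br_add_left D.add tr_add Bs DG br_in)
    show "tr Bs (\<lambda>v. D (br (scale c x) v)) = c * tr Bs (\<lambda>v. D (br x v))" for c x
      by (simp add: br_scale_left D.scale tr_scale Bs DG br_in)
  qed (simp_all add: kil_add_left kil_add_right kil_scale_left kil_scale_right)
  then obtain d where d: "d \<in> G" "\<And>y. y \<in> G \<Longrightarrow> kil d y = tr Bs (\<lambda>v. D (br y v))" by blast
  define E where "E v = D v - br d v" for v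
  have El: "Vector_Spaces.linear scale scale E"
    unfolding E_def
    by unfold_locales (simp_all add: D.add D.scale br_add_right br_scale_right scale_right_diff_distrib)
  have EG: "E x \<in> G" if "x \<in> G" for x unfolding E_def using DG that br_in span_diff by blast
  have Eder: "derivation E"
    unfolding derivation_def
  proof (intro conjI ballI)
    fix u v assume uv: "u \<in> G" "v \<in> G"
    have "D (br u v) = br (D u) v + br u (D v)" using D uv by (simp add: derivation_def)
    then show "E (br u v) = br (E u) v + br u (E v)"
      unfolding E_def jacobi[of d u v] by (simp add: br_diff_left br_diff_right)
  qed (use El EG in auto)
  interpret E: Vector_Spaces.linear scale scale E by (rule El)
  have tE: "tr Bs (\<lambda>v. E (br y v)) = 0" if "y \<in> G" for y
  proof -
    have "tr Bs (\<lambda>v. E (br y v)) = tr Bs (\<lambda>v. D (br y v)) - tr Bs (\<lambda>v. br d (br y v))"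
      unfolding E_def by (intro tr_diff Bs br_in DG)
    then show ?thesis using d(2)[OF that] by (simp add: kil_def)
  qed
  have "E a = 0" if a: "a \<in> G" for a
  proof (rule kil_nondegenerate)
    show "E a \<in> G" using EG a by blast
    fix b assume b: "b \<in> G"
    have l1: "Vector_Spaces.linear scale scale (\<lambda>v. br b (br a v))"
      "Vector_Spaces.linear scale scale (\<lambda>v. br a (br b v))"
      "Vector_Spaces.linear scale scale (\<lambda>v. E (br b v))"
      by (unfold_locales; simp add: br_add_right br_scale_right E.add E.scale)+
    have "kil (E a) b = tr Bs (\<lambda>v. E (br a (br b v)) - br a (E (br b v)))"
      unfolding kil_def using Eder a br_in by (intro tr_cong) (simp add: derivation_def)
    also have "\<dots> = tr Bs (\<lambda>v. E (br a (br b v))) - tr Bs (\<lambda>v. br a (E (br b v)))"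
      by (intro tr_diff Bs br_in EG)
    also have "tr Bs (\<lambda>v. br a (E (br b v))) = tr Bs (\<lambda>v. E (br b (br a v)))"
      by (rule tr_swap'[OF br_linear l1(3)]) (simp_all add: br_in EG)
    also have "tr Bs (\<lambda>v. E (br a (br b v))) - tr Bs (\<lambda>v. E (br b (br a v)))
        = tr Bs (\<lambda>v. E (br a (br b v)) - E (br b (br a v)))"
      by (intro tr_diff[symmetric] Bs br_in EG)
    also have "\<dots> = tr Bs (\<lambda>v. E (br (br a b) v))"
      by (intro tr_cong) (simp add: jacobi[of a b] E.add)
    also have "\<dots> = 0" by (intro tE br_in)
    finally show "kil (E a) b = 0" .
  qed
  then show ?thesis using d(1) by (auto simp: E_def)
qed

text \<open>One equation carries both conditions: \<open>ad c\<close> is scalar on each generalized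
  eigenspace in \<open>G\<close>, and comparison with the eigenvalue \<open>l\<close> shows that
  \<open>l\<close> is imaginary unless that space is zero. Such elements generate relatively compact
  one-parameter groups of automorphisms; topological compactness of sets is a different
  notion.\<close>

definition compact :: "'v \<Rightarrow> bool" where
  "compact c \<longleftrightarrow> c \<in> G0 \<and> (\<forall>l. \<forall>v\<in>geig (br c) l \<inter> G. br c v = scale (\<i> * of_real (Im l)) v)"

text \<open>\<open>l \<mapsto> i Im l\<close> is additive, so the diagonal operator is a derivation
  and thus some \<open>ad c\<close>. It commutes with \<open>\<sigma>\<close> because the function
  commutes with complex conjugation, and the trivial centre turns this into
  \<open>\<sigma> c = c\<close>.\<close>

lemma ex_elliptic_part:
  assumes x: "x \<in> G0"
  obtains c where "c \<in> G0" "\<And>l v. v \<in> geig (br x) l \<Longrightarrow> v \<in> G \<Longrightarrow> br c v = scale (\<i> * of_real (Im l)) v"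
proof -
  let ?f = "\<lambda>l. \<i> * complex_of_real (Im l)"
  obtain D where D: "Vector_Spaces.linear scale scale D" "\<forall>x\<in>G. D x \<in> G"
    "\<forall>l. \<forall>v\<in>geig (br x) l \<inter> G. D v = scale (?f l) v"
    using ex_diagonal_operator[OF br_linear Bs(2) br_in, of x ?f] by blast
  have der: "derivation D" by (rule diagonal_derivation[OF D]) (simp add: distrib_left)
  obtain c where c: "c \<in> G" "\<And>v. v \<in> G \<Longrightarrow> D v = br c v" using derivation_inner[OF der] by blast
  have s: "D (\<sigma> v) = \<sigma> (D v)" if "v \<in> G" for v
    by (rule diagonal_sig[OF x D(1,3) _ that]) simp
  have "\<sigma> c - c = 0"
  proof (rule centre_trivial)
    show "\<sigma> c - c \<in> G" using c(1) by (simp add: sig_in span_diff)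
    fix v assume v: "v \<in> G"
    have "br (\<sigma> c) v = \<sigma> (br c (\<sigma> v))" using sig_br[OF c(1) sig_in[OF v]] by (simp add: sig_sig)
    also have "\<dots> = \<sigma> (D (\<sigma> v))" using c(2)[OF sig_in[OF v]] by simp
    also have "\<dots> = br c v" using s[OF v] c(2)[OF v] by (simp add: sig_sig)
    finally show "br (\<sigma> c - c) v = 0" by (simp add: br_diff_left)
  qed
  then have "c \<in> G0" using c(1) by (simp add: G0_def)
  moreover have "br c v = scale (?f l) v" if "v \<in> geig (br x) l" "v \<in> G" for l v
    using D(3) c(2)[OF that(2)] that by simp
  ultimately show ?thesis using that by blast
qed

end

section \<open>Compact elements and their centralizers\<close>

context semisimple_real_form
begin

lemma eigen_geig: "br c v = scale l v \<Longrightarrow> v \<in> geig (br c) l"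
  unfolding geig_def by (auto intro!: exI[of _ 1])

lemma compact_G0: "compact c \<Longrightarrow> c \<in> G0"
  by (simp add: compact_def)

lemma compact_eigen: "compact c \<Longrightarrow> v \<in> geig (br c) l \<Longrightarrow> v \<in> G \<Longrightarrow> br c v = scale (\<i> * of_real (Im l)) v"
  by (simp add: compact_def)

text \<open>The diagonal operator built from \<open>i Im\<close> agrees with \<open>ad c\<close> on
  eigenvectors with imaginary eigenvalues; if these span, the two coincide on \<open>G\<close>,
  which is the condition in \<open>compact\<close>.\<close>

lemma compactI:
  assumes c: "c \<in> G0" and sp: "G \<subseteq> span {v \<in> G. \<exists>r. br c v = scale (\<i> * of_real r) v}"
  shows "compact c"
proof -
  let ?f = "\<lambda>l. \<i> * complex_of_real (Im l)"
  obtain D where D: "Vector_Spaces.linear scale scale D"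
    "\<forall>l. \<forall>v\<in>geig (br c) l \<inter> G. D v = scale (?f l) v"
    using ex_diagonal_operator[OF br_linear Bs(2) br_in, of c ?f] by blast
  have "D v = br c v" if "v \<in> G" for v
  proof (rule linear_eq_on_span'[OF D(1) br_linear])
    show "v \<in> span {v \<in> G. \<exists>r. br c v = scale (\<i> * of_real r) v}" using sp that by blast
    fix v assume "v \<in> {v \<in> G. \<exists>r. br c v = scale (\<i> * of_real r) v}"
    then obtain r where r: "v \<in> G" "br c v = scale (\<i> * of_real r) v" by blast
    then show "D v = br c v" using D(2)[rule_format, of v "\<i> * of_real r"] eigen_geig by simp
  qed
  then show ?thesis using D(2) c unfolding compact_def by auto
qed

lemma compact_span:
  assumes "compact c"
  shows "G \<subseteq> span {v \<in> G. \<exists>r. br c v = scale (\<i> * of_real r) v}"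
proof -
  have "(\<Union>l. geig (br c) l \<inter> G) \<subseteq> {v \<in> G. \<exists>r. br c v = scale (\<i> * of_real r) v}"
    using compact_eigen[OF assms] by blast
  then show ?thesis using geig_span_G[of c] span_mono by blast
qed

text \<open>Simultaneous diagonalization: \<open>ad c\<close> preserves each eigenspace
  \<open>U\<close> of \<open>ad t\<close> because \<open>[t, c] = 0\<close>, and
  \<open>geig_span\<close> decomposes it inside \<open>U\<close>.\<close>

lemma compact_joint_span:
  assumes t: "compact t" and c: "compact c" and tc: "br t c = 0"
  shows "G \<subseteq> span {w \<in> G. \<exists>r k. br t w = scale (\<i> * of_real r) w \<and> br c w = scale (\<i> * of_real k) w}"
    (is "G \<subseteq> span ?J")
proof -
  have "u \<in> span ?J" if u: "u \<in> G" "br t u = scale (\<i> * of_real r) u" for u r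
  proof -
    define U where "U = {v \<in> G. br t v = scale (\<i> * of_real r) v}"
    have sU: "subspace U" unfolding U_def
      by (auto simp: subspace_def span_zero span_add span_scale br_add_right br_scale_right
          scale_right_distrib mult.commute)
    have cU: "br c v \<in> U" if "v \<in> U" for v
      using that unfolding U_def by (simp add: jacobi[of t c v] tc br_in br_scale_right)
    have "U \<subseteq> G" by (auto simp: U_def)
    then have "U \<subseteq> span (\<Union>l. geig (br c) l \<inter> U)"
      using geig_span[OF br_linear Bs(2) _ sU cU] by blast
    also have "\<dots> \<subseteq> span ?J"
      using compact_eigen[OF c] by (intro span_mono) (auto simp: U_def)
    finally show ?thesis using u by (auto simp: U_def)
  qed
  then have "{v \<in> G. \<exists>r. br t v = scale (\<i> * of_real r) v} \<subseteq> span ?J" by blast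
  then show ?thesis using compact_span[OF t] span_minimal[OF _ subspace_span] by (metis (no_types, lifting) order_trans)
qed

lemma compact_add:
  assumes t: "compact t" and c: "compact c" and tc: "br t c = 0"
  shows "compact (t + rscale s c)"
proof (rule compactI)
  show "t + rscale s c \<in> G0"
    using R.subspace_add[OF G0_subspace compact_G0[OF t] R.subspace_scale[OF G0_subspace compact_G0[OF c]]] .
  have "{w \<in> G. \<exists>r k. br t w = scale (\<i> * of_real r) w \<and> br c w = scale (\<i> * of_real k) w}
      \<subseteq> {v \<in> G. \<exists>r. br (t + rscale s c) v = scale (\<i> * of_real r) v}"
  proof safe
    fix w r k assume "br t w = scale (\<i> * of_real r) w" "br c w = scale (\<i> * of_real k) w"
    then have "br (t + rscale s c) w = scale (\<i> * of_real (r + s * k)) w"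
      by (simp add: br_add_left br_scale_left scale_left_distrib distrib_left mult.left_commute)
    then show "\<exists>r. br (t + rscale s c) w = scale (\<i> * of_real r) w" by blast
  qed
  then show "G \<subseteq> span {v \<in> G. \<exists>r. br (t + rscale s c) v = scale (\<i> * of_real r) v}"
    using compact_joint_span[OF assms] span_mono by blast
qed

lemma finite_eigenvalues: "finite {r::real. \<exists>v\<in>G. v \<noteq> 0 \<and> br c v = scale (\<i> * of_real r) v}"
proof -
  obtain E lam where E: "finite E"
    "\<And>l v. v \<in> geig (br c) l \<Longrightarrow> v \<in> G \<Longrightarrow> v \<in> span {e\<in>E. lam e = l}"
    by (rule spectral_basis[OF br_linear[of c] Bs(2) br_in]) blast
  have "{r::real. \<exists>v\<in>G. v \<noteq> 0 \<and> br c v = scale (\<i> * of_real r) v} \<subseteq> (\<lambda>e. Im (lam e)) ` E"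
  proof safe
    fix r v assume v: "v \<in> G" "v \<noteq> 0" "br c v = scale (\<i> * complex_of_real r) v"
    have "v \<in> span {e\<in>E. lam e = \<i> * of_real r}" using E(2) eigen_geig v by blast
    then have "{e\<in>E. lam e = \<i> * of_real r} \<noteq> {}" using v(2) by (metis span_empty singletonD)
    then obtain e where "e \<in> E" "lam e = \<i> * of_real r" by blast
    then show "r \<in> (\<lambda>e. Im (lam e)) ` E" by (intro image_eqI[of _ _ e]) simp_all
  qed
  then show ?thesis using E(1) finite_surj by blast
qed

definition Z :: "'v \<Rightarrow> 'v set" where "Z t = {v \<in> G. br t v = 0}"

text \<open>Off a finite set of \<open>s\<close>, an eigenvalue \<open>r + s k\<close> of \<open>t + s c\<close> vanishes only if \<open>r = k = 0\<close>.\<close>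

lemma generic_centralizer:
  assumes t: "compact t" and c: "compact c" and tc: "br t c = 0"
  obtains s where "Z (t + rscale s c) \<subseteq> Z t \<inter> Z c"
proof -
  let ?R = "\<lambda>c. {r::real. \<exists>v\<in>G. v \<noteq> 0 \<and> br c v = scale (\<i> * of_real r) v}"
  \<comment> \<open>These are the values of \<open>s\<close> for which some \<open>r + s k\<close>
    can vanish with \<open>k\<close> nonzero. For \<open>k = 0\<close> the quotient is 0 by
    convention; 0 is excluded anyway, so that \<open>br c u\<close> can be recovered at the
    end.\<close>
  have "finite (insert 0 ((\<lambda>(r, k). - r / k) ` (?R t \<times> ?R c)))"
    using finite_eigenvalues by auto
  then obtain s where s: "s \<notin> insert 0 ((\<lambda>(r, k). - r / k) ` (?R t \<times> ?R c))"
    using ex_new_if_finite infinite_UNIV_char_0 by blast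
  define T where "T = t + rscale s c"
  \<comment> \<open>The indicator of the eigenvalue 0 makes \<open>P\<close> the spectral projection
    to the generalized null space of \<open>ad T\<close>. It fixes \<open>Z T\<close>, and
    \<open>ad t\<close> composed with \<open>P\<close> kills all joint eigenvectors, so
    \<open>ad t\<close> kills \<open>Z T\<close>.\<close>
  let ?f = "\<lambda>l::complex. if l = 0 then 1 else (0::complex)"
  obtain P where P: "Vector_Spaces.linear scale scale P" "\<forall>x\<in>G. P x \<in> G"
    "\<forall>l. \<forall>v\<in>geig (br T) l \<inter> G. P v = scale (?f l) v"
    using ex_diagonal_operator[OF br_linear Bs(2) br_in, of T ?f] by blast
  interpret P: Vector_Spaces.linear scale scale P by (rule P(1))
  let ?J = "{w \<in> G. \<exists>r k. br t w = scale (\<i> * of_real r) w \<and> br c w = scale (\<i> * of_real k) w}"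
  have l1: "Vector_Spaces.linear scale scale (\<lambda>v. br t (P v))" "Vector_Spaces.linear scale scale (\<lambda>v. 0)"
    by (unfold_locales; simp add: P.add P.scale br_add_right br_scale_right)+
  have tP: "br t (P w) = 0" if w: "w \<in> ?J" for w
  proof (cases "w = 0")
    case False
    obtain r k where rk: "w \<in> G" "br t w = scale (\<i> * of_real r) w" "br c w = scale (\<i> * of_real k) w"
      using w by blast
    have "br T w = scale (\<i> * of_real (r + s * k)) w"
      unfolding T_def using rk by (simp add: br_add_left br_scale_left scale_left_distrib distrib_left mult.left_commute)
    then have g: "w \<in> geig (br T) (\<i> * of_real (r + s * k)) \<inter> G" using eigen_geig rk by blast
    show ?thesis
    proof (cases "r + s * k = 0")
      case True
      have "r \<in> ?R t" "k \<in> ?R c" using rk False by blast+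
      then have "(\<lambda>(r, k). - r / k) (r, k) \<in> (\<lambda>(r, k). - r / k) ` (?R t \<times> ?R c)" by (intro imageI) simp
      then have m: "- r / k \<in> (\<lambda>(r, k). - r / k) ` (?R t \<times> ?R c)" by (simp only: prod.case)
      have "s \<noteq> - r / k"
      proof
        assume e: "s = - r / k"
        show False by (rule notE[OF s]) (rule insertI2, unfold e, rule m)
      qed
      moreover have "s = - r / k" if "k \<noteq> 0"
      proof -
        have "s * k = - r" using True by linarith
        then show ?thesis using that nonzero_mult_div_cancel_right[of k s] by simp
      qed
      ultimately have "k = 0" by blast
      then have "r = 0" using True by simp
      then show ?thesis using P(3)[rule_format, OF g] rk True by simp
    next
      case False
      then have "\<i> * complex_of_real (r + s * k) \<noteq> 0"
        by (simp only: mult_eq_0_iff of_real_eq_0_iff complex_i_not_zero) simp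
      then have "P w = 0" using P(3)[rule_format, OF g] by simp
      then show ?thesis by simp
    qed
  qed (simp add: P.zero)
  have "u \<in> Z t \<inter> Z c" if u: "u \<in> Z T" for u
  proof -
    have "u \<in> geig (br T) 0 \<inter> G" using u eigen_geig[of T u 0] by (auto simp: Z_def)
    then have "P u = u" using P(3)[rule_format, of u 0] by simp
    moreover have "br t (P u) = 0"
    proof (rule linear_eq_on_span'[OF l1 tP])
      show "u \<in> span ?J" using compact_joint_span[OF assms] u Z_def by blast
    qed assumption
    ultimately have "br t u = 0" by simp
    moreover have "br t u + rscale s (br c u) = 0" using u by (simp add: Z_def T_def br_add_left br_scale_left)
    moreover have "s \<noteq> 0" using s by (metis insertI1)
    ultimately have "br c u = 0" by simp
    then show ?thesis using u \<open>br t u = 0\<close> by (simp add: Z_def)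
  qed
  then show ?thesis using that unfolding T_def by blast
qed

lemma compact_zero: "compact 0"
proof (rule compactI)
  show "0 \<in> G0" using R.subspace_0[OF G0_subspace] .
  have "G \<subseteq> {v \<in> G. \<exists>r. br 0 v = scale (\<i> * of_real r) v}" by (auto intro!: exI[of _ 0])
  then show "G \<subseteq> span {v \<in> G. \<exists>r. br 0 v = scale (\<i> * of_real r) v}"
    using span_superset by (rule order_trans)
qed

lemma Z_subspace: "subspace (Z t)"
  by (auto simp: subspace_def Z_def span_zero span_add span_scale br_add_right br_scale_right)

lemma Z_G: "Z t \<subseteq> G" by (auto simp: Z_def)

text \<open>Minimality of \<open>dim (Z t)\<close> forces equality in the inclusion of
  \<open>generic_centralizer\<close>: \<open>Z (t + s c)\<close> is all of \<open>Z t\<close>, so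
  \<open>Z t\<close> lies in \<open>Z c\<close>. A minimum exists because 0 is compact.\<close>

lemma ex_regular_compact:
  obtains t where "compact t" "\<And>c v. compact c \<Longrightarrow> br t c = 0 \<Longrightarrow> v \<in> Z t \<Longrightarrow> br c v = 0"
proof -
  obtain t where t: "compact t" "\<And>c. compact c \<Longrightarrow> dim (Z t) \<le> dim (Z c)"
    using ex_has_least_nat[of compact 0 "\<lambda>t. dim (Z t)"] compact_zero by blast
  have "Z t \<subseteq> Z c" if c: "compact c" "br t c = 0" for c
  proof -
    obtain s where s: "Z (t + rscale s c) \<subseteq> Z t \<inter> Z c" using generic_centralizer t(1) c by blast
    have "Z (t + rscale s c) = Z t"
    proof (rule ccontr)
      assume "Z (t + rscale s c) \<noteq> Z t"
      then have "dim (Z (t + rscale s c)) < dim (Z t)"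
        using fin_dim_psubset[OF Bs(2) Z_G Z_subspace] s by blast
      then show False using t(2)[OF compact_add[OF t(1) c]] by (meson leD)
    qed
    then show ?thesis using s by blast
  qed
  then show ?thesis using that[OF t(1)] by (auto simp: Z_def)
qed

text \<open>For compact \<open>c\<close> the trace is minus the sum of all \<open>(Im l)^2\<close>,
  so the Killing form is negative on nonzero compact elements: if it vanishes then
  \<open>ad c = 0\<close>, and the centre is trivial.\<close>

lemma kil_compact_zero:
  assumes c: "compact c" and k: "Re (kil c c) = 0"
  shows "c = 0"
proof -
  obtain E lam where E: "finite E" "span E = G"
    "\<And>e. e \<in> E \<Longrightarrow> e \<in> geig (br c) (lam e)"
    and t: "\<And>f D. independent Bs \<Longrightarrow> Vector_Spaces.linear scale scale D \<Longrightarrow>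
       (\<And>l v. v \<in> geig (br c) l \<Longrightarrow> v \<in> G \<Longrightarrow> D v = scale (f l) v) \<Longrightarrow>
       tr Bs (\<lambda>x. br c (D x)) = (\<Sum>e\<in>E. lam e * f (lam e)) \<and> tr Bs (\<lambda>x. D (D x)) = (\<Sum>e\<in>E. (f (lam e))\<^sup>2)"
    by (rule spectral_basis[OF br_linear[of c] Bs(2) br_in]) blast
  have "tr Bs (\<lambda>x. br c (br c x)) = (\<Sum>e\<in>E. lam e * (\<i> * of_real (Im (lam e))))
      \<and> tr Bs (\<lambda>x. br c (br c x)) = (\<Sum>e\<in>E. (\<i> * of_real (Im (lam e)))\<^sup>2)"
    by (rule t[OF Bs(1) br_linear]) (rule compact_eigen[OF c])
  then have "kil c c = (\<Sum>e\<in>E. (\<i> * of_real (Im (lam e)))\<^sup>2)"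
    unfolding kil_def by blast
  then have "(\<Sum>e\<in>E. (Im (lam e))\<^sup>2) = 0" using k by (simp add: power_mult_distrib sum_negf)
  then have "\<forall>e\<in>E. Im (lam e) = 0" using E(1) by (simp add: sum_nonneg_eq_0_iff)
  then have "br c e = 0" if "e \<in> E" for e
    using compact_eigen[OF c E(3)[OF that]] that E(2) span_base by fastforce
  then have "br c v = 0" if "v \<in> G" for v
  proof -
    have "v \<in> span E" using that E(2) by simp
    then show ?thesis
      by (induction rule: span_induct_alt)
        (simp_all add: br_add_right br_scale_right \<open>\<And>e. e \<in> E \<Longrightarrow> br c e = 0\<close>)
  qed
  then show ?thesis using centre_trivial compact_G0[OF c] G0_in by blast
qed

end

section \<open>The centralizer of a regular compact element is abelian\<close>

locale regular_compact = semisimple_real_form scale br Bs \<sigma>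
  for scale :: "complex \<Rightarrow> 'v::ab_group_add \<Rightarrow> 'v" and br Bs \<sigma> +
  fixes t :: 'v
  assumes t: "compact t"
    and reg: "compact c \<Longrightarrow> br t c = 0 \<Longrightarrow> v \<in> Z t \<Longrightarrow> br c v = 0"
begin

text \<open>\<open>K\<close> and \<open>P0\<close> play the roles of the compact and noncompact
  parts in a Cartan decomposition of the real centralizer \<open>Z0\<close>; regularity of
  \<open>t\<close> makes \<open>K\<close> central in \<open>Z t\<close>.\<close>

definition K :: "'v set" where "K = {c. compact c \<and> br t c = 0}"
definition Z0 :: "'v set" where "Z0 = {x \<in> G0. br t x = 0}"
definition P0 :: "'v set" where "P0 = {x \<in> Z0. \<forall>c\<in>K. kil x c = 0}"

lemma t_G0: "t \<in> G0" by (rule compact_G0[OF t])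

lemma K_Z0: "K \<subseteq> Z0" using compact_G0 by (auto simp: K_def Z0_def)

lemma Z0_Z: "Z0 \<subseteq> Z t" using G0_in by (auto simp: Z0_def Z_def)

lemma K_central: "c \<in> K \<Longrightarrow> v \<in> Z t \<Longrightarrow> br c v = 0"
  using reg by (auto simp: K_def)

text \<open>Elements of \<open>K\<close> commute with each other by regularity, so
  \<open>compact_add\<close> applies to their sums.\<close>

lemma K_subspace: "R.subspace K"
proof (rule R.subspaceI)
  show "0 \<in> K" by (simp add: K_def compact_zero)
next
  fix x y assume xy: "x \<in> K" "y \<in> K"
  then have "br x y = 0" using K_central K_Z0 Z0_Z by blast
  then have "compact (x + rscale 1 y)" using xy by (intro compact_add) (auto simp: K_def)
  then show "x + y \<in> K" using xy by (simp add: K_def br_add_right)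
next
  fix c x assume "x \<in> K"
  then show "rscale c x \<in> K"
    using compact_add[OF compact_zero, of x c] by (simp add: K_def br_scale_right)
qed

lemma Z0_subspace: "R.subspace Z0"
  using G0_subspace by (auto simp: R.subspace_def Z0_def br_add_right br_scale_right)

lemma P0_subspace: "R.subspace P0"
  using Z0_subspace by (auto simp: R.subspace_def P0_def kil_add_left kil_scale_left)

lemma Re_kil:
  assumes "x \<in> G0" "y \<in> G0" "Re (kil x y) = 0"
  shows "kil x y = 0"
  using kil_real[OF assms(1,2)] assms(3) by (auto simp: complex_is_Real_iff complex_eq_iff)

text \<open>The Killing form is definite on \<open>K\<close>, so \<open>riesz\<close> supplies the
  orthogonal projection of \<open>z\<close> to \<open>K\<close>. Real parts appear because
  \<open>riesz\<close> is applied over the real scalars.\<close>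

lemma Z0_decomp:
  assumes z: "z \<in> Z0"
  obtains k p where "k \<in> K" "p \<in> P0" "z = k + p"
proof -
  have KG: "K \<subseteq> G0" using K_Z0 by (auto simp: Z0_def)
  obtain S where S: "finite S" "R.independent S" "R.span S = K"
    using R.fin_basis[OF Bs(2) K_subspace order_trans[OF KG G0_span]] .
  have "\<exists>k\<in>R.span S. \<forall>y\<in>R.span S. Re (kil k y) = Re (kil z y)"
  proof (rule R.riesz[OF S(2,1)])
    fix x assume x: "x \<in> R.span S" "\<And>y. y \<in> R.span S \<Longrightarrow> Re (kil x y) = 0"
    then show "x = 0" using kil_compact_zero S(3) by (simp add: K_def)
  qed (simp_all add: kil_add_left kil_add_right kil_scale_left kil_scale_right)
  then obtain k where k: "k \<in> K" "\<And>y. y \<in> K \<Longrightarrow> Re (kil k y) = Re (kil z y)" using S(3) by auto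
  have zk: "z - k \<in> Z0" using R.subspace_diff[OF Z0_subspace z] k(1) K_Z0 by blast
  have "kil (z - k) y = 0" if "y \<in> K" for y
    using k(2)[OF that] zk that KG by (intro Re_kil) (auto simp: Z0_def kil_diff_left)
  then have "z - k \<in> P0" using zk by (simp add: P0_def)
  then show ?thesis using that[of k "z - k"] k(1) by simp
qed

text \<open>The elliptic part \<open>c\<close> of \<open>x\<close> commutes with \<open>t\<close>,
  hence lies in \<open>K\<close> and is orthogonal to \<open>x\<close>. But \<open>kil x c\<close>
  has real part minus the sum of all \<open>(Im l)^2\<close>, so the eigenvalues of
  \<open>ad x\<close> are real and \<open>kil x x\<close> is a sum of squares.\<close>

lemma P0_real_eigenvalues:
  assumes x: "x \<in> P0"
  shows "0 \<le> Re (kil x x)" and "v \<in> geig (br x) l \<Longrightarrow> v \<in> G \<Longrightarrow> v \<noteq> 0 \<Longrightarrow> Im l = 0"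
proof -
  have xZ: "x \<in> G0" "br t x = 0" using x by (auto simp: P0_def Z0_def)
  obtain c where c: "c \<in> G0" "\<And>l v. v \<in> geig (br x) l \<Longrightarrow> v \<in> G \<Longrightarrow> br c v = scale (\<i> * of_real (Im l)) v"
    using ex_elliptic_part[OF xZ(1)] by blast
  obtain E lam where E: "finite E" "span E = G"
    "\<And>e. e \<in> E \<Longrightarrow> e \<in> geig (br x) (lam e)"
    "\<And>l v. v \<in> geig (br x) l \<Longrightarrow> v \<in> G \<Longrightarrow> v \<in> span {e\<in>E. lam e = l}"
    "tr Bs (\<lambda>v. br x (br x v)) = (\<Sum>e\<in>E. (lam e)\<^sup>2)"
    and tD: "\<And>f D. independent Bs \<Longrightarrow> Vector_Spaces.linear scale scale D \<Longrightarrow>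
       (\<And>l v. v \<in> geig (br x) l \<Longrightarrow> v \<in> G \<Longrightarrow> D v = scale (f l) v) \<Longrightarrow>
       tr Bs (\<lambda>v. br x (D v)) = (\<Sum>e\<in>E. lam e * f (lam e)) \<and> tr Bs (\<lambda>x. D (D x)) = (\<Sum>e\<in>E. (f (lam e))\<^sup>2)"
    by (rule spectral_basis[OF br_linear[of x] Bs(2) br_in]) (use Bs(1) in blast)
  have "compact c"
  proof (rule compactI[OF c(1)])
    have "(\<Union>l. geig (br x) l \<inter> G) \<subseteq> {v \<in> G. \<exists>r. br c v = scale (\<i> * of_real r) v}"
      using c(2) by blast
    then show "G \<subseteq> span {v \<in> G. \<exists>r. br c v = scale (\<i> * of_real r) v}"
      using geig_span_G[of x] span_mono by blast
  qed
  moreover have "br t c = 0"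
  proof -
    have "br x t = 0" using xZ(2) by (subst br_anti) simp
    \<comment> \<open>\<open>t\<close> is an eigenvector of \<open>ad x\<close> for the eigenvalue
      0, where \<open>ad c\<close> acts by the scalar \<open>i Im 0 = 0\<close>.\<close>
    then have "t \<in> geig (br x) 0" using eigen_geig[of x t 0] by simp
    then have "br c t = 0" using c(2)[of t 0] t_G0 G0_in by simp
    then show ?thesis by (subst br_anti) simp
  qed
  ultimately have "c \<in> K" by (simp add: K_def)
  then have "kil x c = 0" using x by (simp add: P0_def)
  moreover have "kil x c = (\<Sum>e\<in>E. lam e * (\<i> * of_real (Im (lam e))))"
    unfolding kil_def using tD[OF Bs(1) br_linear[of c], of "\<lambda>l. \<i> * of_real (Im l)"] c(2) by blast
  ultimately have "Re (\<Sum>e\<in>E. lam e * (\<i> * of_real (Im (lam e)))) = 0" by simp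
  then have "(\<Sum>e\<in>E. (Im (lam e))\<^sup>2) = 0" by (simp add: power2_eq_square sum_negf)
  then have I0: "\<forall>e\<in>E. Im (lam e) = 0" using E(1) by (simp add: sum_nonneg_eq_0_iff)
  have "Re (kil x x) = (\<Sum>e\<in>E. (Re (lam e))\<^sup>2)"
    unfolding kil_def E(5) using I0 by (simp add: power2_eq_square)
  then show "0 \<le> Re (kil x x)" by (simp add: sum_nonneg)
  show "Im l = 0" if v: "v \<in> geig (br x) l" "v \<in> G" "v \<noteq> 0"
  proof -
    have "{e\<in>E. lam e = l} \<noteq> {}" using E(4)[OF v(1,2)] v(3) by (metis span_empty singletonD)
    then show ?thesis using I0 by blast
  qed
qed

lemma Z_re_im:
  assumes "v \<in> Z t"
  shows "re v \<in> Z0" "im v \<in> Z0"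
proof -
  have v: "v \<in> G" "br t v = 0" using assms by (auto simp: Z_def)
  have "br t (\<sigma> v) = \<sigma> (br t v)" using sig_br[of t v] v t_G0 G0_in G0_sig by simp
  then have "br t (\<sigma> v) = 0" using v by (simp add: sig_0)
  then show "re v \<in> Z0" "im v \<in> Z0" using v re_G0 im_G0
    by (auto simp: Z0_def re_def im_def br_scale_right br_add_right br_diff_right br_minus_right)
qed

text \<open>As \<open>[z, t] = 0\<close>, invariance makes \<open>z\<close> orthogonal to every
  eigenvector of \<open>ad t\<close> with nonzero eigenvalue. What remains is \<open>Z t\<close>,
  which is spanned by \<open>Z0\<close>.\<close>

lemma Z0_nondegenerate:
  assumes z: "z \<in> Z0" and k: "\<And>y. y \<in> Z0 \<Longrightarrow> kil z y = 0"
  shows "z = 0"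
proof (rule kil_nondegenerate)
  have zG: "z \<in> G" "br t z = 0" using z G0_in by (auto simp: Z0_def)
  have bz: "br z t = 0" using zG by (subst br_anti) simp
  show "z \<in> G" by (rule zG)
  fix y assume "y \<in> G"
  then show "kil z y = 0"
  proof (induction rule: geig_G_induct[where x=t])
    case (add l u w)
    have u: "br t u = scale (\<i> * of_real (Im l)) u" using compact_eigen[OF t] add by blast
    have "kil z u = 0"
    proof (cases "Im l = 0")
      case True
      then have "u \<in> Z t" using u add by (simp add: Z_def)
      then have "kil z (re u + scale \<i> (im u)) = 0"
        unfolding kil_add_right kil_scale_right using k Z_re_im by simp
      then show ?thesis by (simp flip: re_im)
    next
      case False
      have "\<i> * of_real (Im l) * kil z u = kil z (br t u)" by (simp add: u kil_scale_right)
      also have "\<dots> = kil (br z t) u" using zG t_G0 G0_in by (simp add: kil_inv)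
      finally show ?thesis using False bz by simp
    qed
    then show ?case using add by (simp add: kil_add_right)
  qed simp
qed

text \<open>A null vector of a semidefinite form lies in its radical. Being orthogonal to
  \<open>K\<close> as well, \<open>x\<close> is orthogonal to all of \<open>Z0\<close>.\<close>

lemma P0_definite:
  assumes x: "x \<in> P0" and k: "Re (kil x x) = 0"
  shows "x = 0"
proof (rule Z0_nondegenerate)
  show "x \<in> Z0" using x by (simp add: P0_def)
  have G0P: "P0 \<subseteq> G0" by (auto simp: P0_def Z0_def)
  have xy: "kil x y = 0" if y: "y \<in> P0" for y
  proof (rule Re_kil)
    let ?b = "Re (kil x y)" and ?a = "Re (kil y y)"
    have *: "0 \<le> ?a + 2 * s * ?b" for s
    proof -
      have "y + rscale s x \<in> P0" using P0_subspace x y by (simp add: R.subspace_add R.subspace_scale)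
      then have "0 \<le> Re (kil (y + rscale s x) (y + rscale s x))" by (rule P0_real_eigenvalues)
      also have "\<dots> = ?a + 2 * s * ?b"
        using k by (simp add: kil_add_left kil_add_right kil_scale_left kil_scale_right kil_sym[of y x])
      finally show ?thesis .
    qed
    show "?b = 0"
    proof (rule ccontr)
      assume b: "?b \<noteq> 0"
      \<comment> \<open>The nonnegative expression is affine in \<open>s\<close> with slope
        \<open>2 * ?b\<close>; this \<open>s\<close> would give it the value
        \<open>- 1\<close>.\<close>
      have "?a + 2 * (- (?a + 1) / (2 * ?b)) * ?b = - 1" using b by (simp add: field_simps)
      then show False using *[of "- (?a + 1) / (2 * ?b)"] by linarith
    qed
  qed (use x y G0P in auto)
  fix y assume "y \<in> Z0"
  then obtain k p where "k \<in> K" "p \<in> P0" "y = k + p" using Z0_decomp by blast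
  then show "kil x y = 0" using xy x by (simp add: kil_add_right P0_def)
qed

text \<open>The complexification of \<open>P0\<close>, on which generalized eigenspaces of
  \<open>ad x\<close> are available.\<close>

definition P :: "'v set" where "P = {v \<in> Z t. \<forall>c\<in>K. kil v c = 0}"

lemma P_subspace: "subspace P"
  using Z_subspace[of t] by (auto simp: subspace_def P_def kil_add_left kil_scale_left)

lemma P0_P: "P0 \<subseteq> P" using Z0_Z by (auto simp: P0_def P_def)

lemma P_re_im:
  assumes "v \<in> P"
  shows "re v \<in> P0" "im v \<in> P0"
proof -
  have v: "v \<in> Z t" "v \<in> G" "\<And>c. c \<in> K \<Longrightarrow> kil v c = 0" using assms by (auto simp: P_def Z_def)
  have "kil (re v) c = 0 \<and> kil (im v) c = 0" if c: "c \<in> K" for c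
  proof -
    have "kil (re v) c + \<i> * kil (im v) c = kil (re v + scale \<i> (im v)) c"
      by (simp add: kil_add_left kil_scale_left)
    also have "\<dots> = 0" using v(3)[OF c] by (simp flip: re_im)
    finally have "kil (re v) c + \<i> * kil (im v) c = 0" .
    moreover have "c \<in> G0" using c K_Z0 by (auto simp: Z0_def)
    then have "kil (re v) c \<in> \<real>" "kil (im v) c \<in> \<real>"
      using kil_real re_G0 im_G0 v(2) by auto
    ultimately show ?thesis by (auto simp: complex_eq_iff complex_is_Real_iff)
  qed
  then show "re v \<in> P0" "im v \<in> P0" using Z_re_im[OF v(1)] by (auto simp: P0_def)
qed

text \<open>\<open>K\<close> is central in \<open>Z t\<close>, so
  \<open>kil [x, v] c = kil x [v, c] = 0\<close>.\<close>

lemma br_P: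
  assumes x: "x \<in> Z t" and v: "v \<in> P"
  shows "br x v \<in> P"
proof -
  have xv: "x \<in> G" "br t x = 0" "v \<in> G" "br t v = 0" using assms by (auto simp: P_def Z_def)
  have "kil (br x v) c = 0" if c: "c \<in> K" for c
  proof -
    have "br c v = 0" using K_central[OF c] v by (auto simp: P_def)
    then have "br v c = 0" by (subst br_anti) simp
    then show ?thesis using kil_inv[OF xv(3,1), of c] by simp
  qed
  moreover have "br t (br x v) = 0" using jacobi[of t x v] xv by simp
  ultimately show ?thesis by (simp add: P_def Z_def br_in)
qed

text \<open>\<open>ad x\<close> is skew for a form that is definite on \<open>P0\<close>, yet its
  eigenvalues are real. A real eigenvector \<open>a\<close> satisfies
  \<open>l kil a a = kil x [a, a] = 0\<close>, so only the eigenvalue 0 occurs on \<open>P\<close>;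
  then \<open>[x, [x, w]] = 0\<close> forces \<open>[x, w] = 0\<close> because
  \<open>kil [x, w] [x, w] = - kil w [x, [x, w]]\<close>.\<close>

lemma P0_abelian:
  assumes x: "x \<in> P0" and y: "y \<in> P0"
  shows "br x y = 0"
proof -
  have xZ: "x \<in> Z t" and xG: "x \<in> G0" "x \<in> G"
    using x Z0_Z G0_in by (auto simp: P0_def Z0_def Z_def)
  have PG: "P \<subseteq> G" by (auto simp: P_def Z_def)
  have zero: "v = 0" if v: "v \<in> geig (br x) l" "v \<in> P" "l \<noteq> 0" for v l
  proof (rule ccontr)
    assume nz: "v \<noteq> 0"
    then have Il: "Im l = 0" using P0_real_eigenvalues(2)[OF x v(1)] v(2) PG by blast
    then have l: "l = of_real (Re l)" by (simp add: complex_eq_iff)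
    have *: "a = 0" if a: "a \<in> P0" "br x a = rscale (Re l) a" for a
    proof -
      have aG: "a \<in> G" using a(1) P0_P PG by blast
      have "of_real (Re l) * kil a a = kil (br x a) a" by (simp add: a(2) kil_scale_left)
      also have "\<dots> = 0" using aG xG by (simp add: kil_inv br_self)
      finally have "kil a a = 0" using l v(3) by auto
      then show ?thesis using P0_definite a(1) by simp
    qed
    have "v \<in> P \<longrightarrow> v = 0" using v(1)
    proof (induction rule: geig_induct[OF br_linear, consumes 1, case_names zero step])
      case (step v)
      show ?case
      proof
        assume vP: "v \<in> P"
        then have "br x v - scale l v \<in> P" using br_P[OF xZ] P_subspace by (simp add: subspace_diff subspace_scale)
        then have e: "br x v = rscale (Re l) v" using step l by simp
        have vG: "v \<in> G" using vP PG by blast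
        have "br x (\<sigma> v) = \<sigma> (br x v)" using sig_br[of x v] vG xG G0_sig by simp
        also have "\<dots> = rscale (Re l) (\<sigma> v)" by (simp add: e sig_scale)
        finally have s: "br x (\<sigma> v) = rscale (Re l) (\<sigma> v)" .
        \<comment> \<open>The eigenvalue is real, so the real and imaginary parts of the eigenvector
          are eigenvectors in \<open>P0\<close>, to which the real case applies.\<close>
        have "br x (re v) = rscale (Re l) (re v)"
          unfolding re_def br_scale_right br_add_right e s
          by (simp only: scale_right_distrib scale_left_commute)
        moreover have "br x (im v) = rscale (Re l) (im v)"
          unfolding im_def br_scale_right br_diff_right e s
          by (simp only: scale_right_diff_distrib scale_left_commute)
        ultimately have "re v = 0" "im v = 0" using * P_re_im[OF vP] by auto
        then show "v = 0" using re_im[of v] by simp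
      qed
    qed simp
    then show False using v(2) nz by blast
  qed
  have "P \<subseteq> span (\<Union>l. geig (br x) l \<inter> P)"
    using geig_span[OF br_linear Bs(2) PG P_subspace br_P[OF xZ]] .
  also have "\<dots> \<subseteq> geig (br x) 0"
  proof (rule span_minimal[OF _ geig_subspace[OF br_linear]])
    show "(\<Union>l. geig (br x) l \<inter> P) \<subseteq> geig (br x) 0"
      using zero subspace_0[OF geig_subspace[OF br_linear[of x]]] by fastforce
  qed
  finally have yg: "y \<in> geig (br x) 0" using y P0_P by blast
  have brP0: "br x w \<in> P0" if "w \<in> P0" for w
  proof -
    have "br x w \<in> P" using br_P[OF xZ] that P0_P by blast
    moreover have "w \<in> G0" using that by (simp add: P0_def Z0_def)
    then have "br x w \<in> G0" using G0_br xG by blast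
    ultimately show ?thesis by (simp add: P_def P0_def Z_def Z0_def)
  qed
  have "y \<in> P0 \<longrightarrow> br x y = 0" using yg
  proof (induction rule: geig_induct[OF br_linear, consumes 1, case_names zero step])
    case (step w)
    show ?case
    proof
      assume w: "w \<in> P0"
      then have e: "br x (br x w) = 0" using step brP0 by simp
      have wG: "w \<in> G" using w P0_P PG by blast
      have "kil (br x w) (br x w) = - kil (br w x) (br x w)"
        by (simp only: br_anti[of x w] kil_minus_left)
      also have "kil (br w x) (br x w) = kil w (br x (br x w))" by (rule kil_inv[OF xG(2) wG])
      finally show "br x w = 0" using e P0_definite[OF brP0[OF w]] by simp
    qed
  qed simp
  then show ?thesis using y by blast
qed

lemma Z_abelian:
  assumes "u \<in> Z t" "v \<in> Z t"
  shows "br u v = 0"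
proof -
  have *: "br x y = 0" if xy: "x \<in> Z0" "y \<in> Z0" for x y
  proof -
    obtain k p k' p' where kp: "k \<in> K" "p \<in> P0" "x = k + p" "k' \<in> K" "p' \<in> P0" "y = k' + p'"
      using Z0_decomp xy by metis
    have "p \<in> Z t" using kp Z0_Z by (auto simp: P0_def)
    then have "br k' p = 0" using K_central kp by blast
    then have "br p k' = 0" by (subst br_anti) simp
    moreover have "br k y = 0" using K_central kp(1) xy Z0_Z by blast
    ultimately show ?thesis using P0_abelian[OF kp(2,5)] kp(3,6) by (simp add: br_add_left br_add_right)
  qed
  have "br (re u + scale \<i> (im u)) (re v + scale \<i> (im v)) = 0"
    using Z_re_im[OF assms(1)] Z_re_im[OF assms(2)]
    by (simp only: br_add_left br_add_right br_scale_left br_scale_right *) simp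
  then show ?thesis by (simp flip: re_im)
qed

end

section \<open>The subalgebra \<open>q\<close> between \<open>N\<close> and \<open>W\<close>\<close>

context regular_compact
begin

text \<open>With \<open>Z t\<close> abelian, \<open>W = N + Z t\<close> is a Borel subalgebra of
  \<open>G\<close>, with nilradical \<open>N\<close> and Cartan subalgebra
  \<open>Z t\<close>.\<close>

definition N :: "'v set" where
  "N = span {v \<in> G. \<exists>r>0. br t v = scale (\<i> * of_real r) v}"

definition W :: "'v set" where
  "W = span {v \<in> G. \<exists>r\<ge>0. br t v = scale (\<i> * of_real r) v}"

lemma W_G: "W \<subseteq> G" unfolding W_def by (rule span_minimal) auto
lemma N_W: "N \<subseteq> W" unfolding N_def W_def
  by (rule span_mono) (use less_imp_le in blast)

lemma Z_W: "Z t \<subseteq> W"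
proof
  fix v assume "v \<in> Z t"
  then have "v \<in> {v \<in> G. \<exists>r\<ge>0. br t v = scale (\<i> * of_real r) v}"
    by (auto simp: Z_def intro!: exI[of _ 0])
  then show "v \<in> W" unfolding W_def by (rule span_base)
qed

text \<open>Eigenvalues add, so only the bracket of two elements of \<open>Z t\<close> could miss
  \<open>N\<close>, and it vanishes since \<open>Z t\<close> is abelian.\<close>

lemma br_W_N:
  assumes "u \<in> W" "v \<in> W"
  shows "br u v \<in> N"
  using assms(1) unfolding W_def
proof (induction rule: span_induct_alt)
  case base show ?case by (simp add: N_def span_zero)
next
  case (step a x y)
  then obtain r where r: "x \<in> G" "0 \<le> r" "br t x = scale (\<i> * of_real r) x" by blast
  have "br x v \<in> N" using assms(2) unfolding W_def
  proof (induction rule: span_induct_alt)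
    case base show ?case by (simp add: N_def span_zero)
  next
    case step': (step b z w)
    then obtain s where s: "z \<in> G" "0 \<le> s" "br t z = scale (\<i> * of_real s) z" by blast
    have "br x z \<in> N"
    proof (cases "r = 0 \<and> s = 0")
      case True
      then have "x \<in> Z t" "z \<in> Z t" using r s by (auto simp: Z_def)
      then have "br x z = 0" by (rule Z_abelian)
      then show ?thesis by (simp add: N_def span_zero)
    next
      case False
      then have "0 < r + s" using r(2) s(2) by linarith
      moreover have "br t (br x z) = scale (\<i> * of_real (r + s)) (br x z)"
        unfolding jacobi[of t x z] r s
        by (simp add: br_scale_left br_scale_right scale_left_distrib distrib_left)
      ultimately have "br x z \<in> {v \<in> G. \<exists>r>0. br t v = scale (\<i> * of_real r) v}"
        using br_in by blast
      then show ?thesis unfolding N_def by (rule span_base)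
    qed
    then show ?case using step' by (simp add: N_def br_add_right br_scale_right span_add span_scale)
  qed
  then show ?case using step by (simp add: N_def br_add_left br_scale_left span_add span_scale)
qed

text \<open>The spectral projection to eigenvalues with positive imaginary part is the identity on
  \<open>N\<close> and zero on its conjugate.\<close>

lemma N_conj: "N \<inter> \<sigma> ` N = {0}"
proof -
  let ?f = "\<lambda>l. if Im l > 0 then 1 else (0::complex)"
  obtain P where P: "Vector_Spaces.linear scale scale P"
    "\<forall>l. \<forall>v\<in>geig (br t) l \<inter> G. P v = scale (?f l) v"
    using ex_diagonal_operator[OF br_linear Bs(2) br_in, of t ?f] by blast
  interpret P: Vector_Spaces.linear scale scale P by (rule P(1))
  have 1: "P v = v" if "v \<in> N" for v
    using that unfolding N_def
  proof (induction rule: span_induct_alt)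
    case (step c x y)
    then obtain r where r: "x \<in> G" "0 < r" "br t x = scale (\<i> * of_real r) x" by blast
    then have "P x = x" using P(2)[rule_format, of x "\<i> * of_real r"] eigen_geig by simp
    then show ?case using step by (simp add: P.add P.scale)
  qed (simp add: P.zero)
  have 2: "P (\<sigma> v) = 0" if "v \<in> N" for v
    using that unfolding N_def
  proof (induction rule: span_induct_alt)
    case (step c x y)
    then obtain r where r: "x \<in> G" "0 < r" "br t x = scale (\<i> * of_real r) x" by blast
    have "br t (\<sigma> x) = \<sigma> (br t x)" using sig_br[of t x] r t_G0 G0_in G0_sig by simp
    then have "br t (\<sigma> x) = scale (- \<i> * of_real r) (\<sigma> x)" by (simp add: r sig_scale)
    then have "P (\<sigma> x) = 0"
      using P(2)[rule_format, of "\<sigma> x" "- \<i> * of_real r"] eigen_geig[of t "\<sigma> x"] r sig_in[OF r(1)] by simp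
    then show ?case using step by (simp add: P.add P.scale sig_add sig_scale)
  qed (simp add: P.zero sig_0)
  have "v = 0" if "v \<in> N" "v \<in> \<sigma> ` N" for v using 1 2 that by fastforce
  moreover have "0 \<in> N" by (simp add: N_def span_zero)
  ultimately show ?thesis using sig_0 by force
qed

text \<open>The decomposition \<open>G = \<sigma> N + Z + N\<close> in the form in which it is used.
  Eigenvectors with negative \<open>Im l\<close> are conjugates of elements of \<open>N\<close>, and
  the complex subspace \<open>S\<close> contains \<open>Z t\<close> once it contains its real
  part.\<close>

lemma G_decomp:
  assumes "subspace S" "N \<subseteq> S" "\<sigma> ` N \<subseteq> S" "Z0 \<subseteq> S"
  shows "G \<subseteq> S"
proof
  fix v assume "v \<in> G"
  then show "v \<in> S"
  proof (induction rule: geig_G_induct[where x=t])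
    case zero show ?case using assms(1) by (rule subspace_0)
  next
    case (add l u w)
    have u: "br t u = scale (\<i> * of_real (Im l)) u" using compact_eigen[OF t] add by blast
    consider "Im l > 0" | "Im l = 0" | "Im l < 0" by linarith
    then have "u \<in> S"
    proof cases
      case 1
      then have "u \<in> {v \<in> G. \<exists>r>0. br t v = scale (\<i> * of_real r) v}" using u add by blast
      then have "u \<in> N" unfolding N_def by (rule span_base)
      then show ?thesis using assms(2) by blast
    next
      case 2
      then have "u \<in> Z t" using u add by (simp add: Z_def)
      then have "re u + scale \<i> (im u) \<in> S"
        using Z_re_im assms(1,4) by (intro subspace_add subspace_scale) auto
      then show ?thesis by (simp flip: re_im)
    next
      case 3
      have "br t (\<sigma> u) = \<sigma> (br t u)" using sig_br[of t u] add t_G0 G0_in G0_sig by simp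
      then have "br t (\<sigma> u) = scale (\<i> * of_real (- Im l)) (\<sigma> u)"
        by (simp add: u sig_scale)
      then have "\<sigma> u \<in> {v \<in> G. \<exists>r>0. br t v = scale (\<i> * of_real r) v}"
        using 3 sig_in[OF add(2)] by (auto intro!: exI[of _ "- Im l"])
      then have "\<sigma> u \<in> N" unfolding N_def by (rule span_base)
      then have "\<sigma> (\<sigma> u) \<in> S" using assms(3) by blast
      then show ?thesis by (simp add: sig_sig)
    qed
    then show ?case using add assms(1) subspace_add by blast
  qed
qed

text \<open>Closure under brackets is automatic between \<open>N\<close> and \<open>W\<close>, so
  only linear algebra remains: maximality of \<open>dim q\<close> leaves
  \<open>q + \<sigma> q\<close> with codimension at most one in \<open>G\<close>, and
  \<open>z\<close> spans what may be missing.\<close>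

lemma ex_half_dimensional:
  "\<exists>q z. subspace q \<and> q \<subseteq> G \<and> (\<forall>x\<in>q. \<forall>y\<in>q. br x y \<in> q) \<and> q \<inter> \<sigma> ` q = {0}
     \<and> G \<subseteq> span (insert z (q \<union> \<sigma> ` q))"
proof -
  define Q where "Q q \<longleftrightarrow> subspace q \<and> N \<subseteq> q \<and> q \<subseteq> W \<and> q \<inter> \<sigma> ` q = {0}" for q
  have "Q N" unfolding Q_def using N_W N_conj by (simp add: N_def)
  moreover have "\<forall>q. Q q \<longrightarrow> dim q < Suc (card Bs)"
    using dim_le_card[OF _ Bs(2)] W_G unfolding Q_def by (meson le_imp_less_Suc order_trans)
  ultimately obtain q where q: "Q q" "\<And>q'. Q q' \<Longrightarrow> dim q' \<le> dim q"
    using ex_has_greatest_nat[of Q N dim "Suc (card Bs)"] by blast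
  have sq: "subspace q" and Nq: "N \<subseteq> q" and qW: "q \<subseteq> W" and qq: "q \<inter> \<sigma> ` q = {0}"
    using q(1) by (auto simp: Q_def)
  define S where "S = span (q \<union> \<sigma> ` q)"
  have qS: "q \<subseteq> S" "\<sigma> ` q \<subseteq> S" unfolding S_def using span_superset[of "q \<union> \<sigma> ` q"] by auto
  have sS: "subspace S" by (simp add: S_def)
  have "\<exists>z. G \<subseteq> span (insert z (q \<union> \<sigma> ` q))"
  proof (rule ccontr)
    assume no: "\<nexists>z. G \<subseteq> span (insert z (q \<union> \<sigma> ` q))"
    have "\<not> Z0 \<subseteq> span (insert z (q \<union> \<sigma> ` q))" for z
    proof
      assume Z: "Z0 \<subseteq> span (insert z (q \<union> \<sigma> ` q))"
      have "q \<union> \<sigma> ` q \<subseteq> span (insert z (q \<union> \<sigma> ` q))"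
        using span_superset[of "insert z (q \<union> \<sigma> ` q)"] by blast
      then have "G \<subseteq> span (insert z (q \<union> \<sigma> ` q))"
        using Nq by (intro G_decomp subspace_span Z) auto
      then show False using no by blast
    qed
    \<comment> \<open>Used with \<open>z = 0\<close> and with \<open>z = z1\<close>, this yields two
      real elements of the centralizer that are independent modulo
      \<open>q + \<sigma> q\<close>.\<close>
    then have ex: "\<exists>y\<in>Z0. y \<notin> span (insert z (q \<union> \<sigma> ` q))" for z by blast
    obtain z1 where z1: "z1 \<in> Z0" "z1 \<notin> S" using ex[of 0] by (auto simp: S_def)
    obtain z2 where z2: "z2 \<in> Z0" "z2 \<notin> span (insert z1 (q \<union> \<sigma> ` q))" using ex[of z1] by blast
    \<comment> \<open>\<open>w\<close> and its conjugate \<open>z1 - i z2\<close> span the same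
      complex plane as \<open>z1\<close> and \<open>z2\<close>, so \<open>w\<close> can be added to
      \<open>q\<close> while the intersection with the conjugate stays zero.\<close>
    define w where "w = z1 + scale \<i> z2"
    have sw: "\<sigma> w = z1 - scale \<i> z2"
      using z1 z2 by (simp add: w_def sig_add sig_scale Z0_def G0_def)
    define q' where "q' = span (insert w q)"
    have spq: "span q = q" using sq by simp
    have wW: "w \<in> W"
    proof -
      have "z1 \<in> W" "z2 \<in> W" using z1 z2 Z_W Z0_Z by blast+
      then show ?thesis unfolding w_def W_def by (simp add: span_add span_scale)
    qed
    have key: "c = 0 \<and> d = 0" if "scale c z1 + scale d z2 \<in> S" for c d
    proof -
      have "d = 0"
      proof (rule ccontr)
        assume d: "d \<noteq> 0"
        have S1: "S \<subseteq> span (insert z1 (q \<union> \<sigma> ` q))" unfolding S_def by (intro span_mono) blast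
        have "z1 \<in> span (insert z1 (q \<union> \<sigma> ` q))" by (simp add: span_base)
        then have "scale (inverse d) ((scale c z1 + scale d z2) - scale c z1) \<in> span (insert z1 (q \<union> \<sigma> ` q))"
          using that S1 by (intro span_scale span_diff) auto
        then show False using d z2 by simp
      qed
      moreover have "c = 0"
      proof (rule ccontr)
        assume c: "c \<noteq> 0"
        have "scale (inverse c) (scale c z1) \<in> S"
          using that \<open>d = 0\<close> subspace_scale[OF sS, of "scale c z1" "inverse c"] by simp
        then show False using c z1 by simp
      qed
      ultimately show ?thesis by simp
    qed
    have "v = 0" if v: "v \<in> q'" "v \<in> \<sigma> ` q'" for v
    proof -
      obtain v' where v': "v' \<in> q'" "v = \<sigma> v'" using v(2) by blast
      obtain c where c: "v - scale c w \<in> q" using v(1) by (auto simp: q'_def span_insert spq)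
      obtain d where d: "v' - scale d w \<in> q" using v'(1) by (auto simp: q'_def span_insert spq)
      \<comment> \<open>From \<open>v = \<sigma> v'\<close> a relation between \<open>w\<close> and
        \<open>\<sigma> w\<close> modulo \<open>S\<close> results. In terms of \<open>z1\<close> and
        \<open>z2\<close> it says \<open>c = cnj d\<close> and \<open>c = - cnj d\<close>, so both
        coefficients vanish.\<close>
      have "\<sigma> (v' - scale d w) - (v - scale c w) \<in> S"
        by (rule subspace_diff[OF sS]) (use c d qS in blast)+
      moreover have "\<sigma> (v' - scale d w) - (v - scale c w) = scale c w - scale (cnj d) (\<sigma> w)"
        by (simp add: sig_diff sig_scale v')
      moreover have "scale c w - scale (cnj d) (\<sigma> w) = scale (c - cnj d) z1 + scale (\<i> * (c + cnj d)) z2"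
        unfolding sw unfolding w_def
        by (simp add: scale_right_distrib scale_right_diff_distrib scale_left_diff_distrib
            scale_left_distrib distrib_left mult.commute)
      ultimately have "scale (c - cnj d) z1 + scale (\<i> * (c + cnj d)) z2 \<in> S" by simp
      then have "c - cnj d = 0 \<and> \<i> * (c + cnj d) = 0" by (rule key)
      then have "c = 0" "cnj d = 0" by auto
      then have "v \<in> q" "v' \<in> q" using c d by auto
      then have "v \<in> q \<inter> \<sigma> ` q" using v'(2) by blast
      then show "v = 0" using qq by blast
    qed
    moreover have "0 \<in> q'" by (simp add: q'_def span_zero)
    ultimately have "q' \<inter> \<sigma> ` q' = {0}" using sig_0 by force
    moreover have qq': "q \<subseteq> q'" unfolding q'_def using span_superset[of "insert w q"] by blast
    moreover have "q' \<subseteq> W" unfolding q'_def using qW wW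
      by (intro span_minimal) (auto simp: W_def)
    ultimately have "Q q'" unfolding Q_def using Nq by (auto simp: q'_def)
    then have le: "dim q' \<le> dim q" by (rule q(2))
    have "w \<notin> q"
    proof
      assume "w \<in> q"
      then have "scale 1 z1 + scale \<i> z2 \<in> S" using qS by (auto simp: w_def)
      then show False using key[of 1 \<i>] by simp
    qed
    moreover have "w \<in> q'" by (simp add: q'_def span_base)
    ultimately have "q \<subset> q'" using qq' by blast
    then have "dim q < dim q'"
      using fin_dim_psubset[OF Bs(2) _ sq] \<open>q' \<subseteq> W\<close> W_G by blast
    then show False using le by simp
  qed
  then obtain z where z: "G \<subseteq> span (insert z (q \<union> \<sigma> ` q))" by blast
  have "\<forall>x\<in>q. \<forall>y\<in>q. br x y \<in> q" using br_W_N qW Nq by blast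
  moreover have "q \<subseteq> G" using qW W_G by blast
  ultimately show ?thesis using sq qq z by blast
qed

end

section \<open>Counting dimensions\<close>

context semisimple_real_form
begin

text \<open>A basis of \<open>q\<close> together with its conjugate is independent, and one further
  vector makes the span contain \<open>G\<close>; so \<open>card Bs\<close> is
  \<open>2 dim q\<close> or \<open>2 dim q + 1\<close>.\<close>

lemma ex_half_dimensional_subalgebra:
  obtains q where "subspace q" "q \<subseteq> G" "\<And>x y. x \<in> q \<Longrightarrow> y \<in> q \<Longrightarrow> br x y \<in> q"
    "q \<inter> \<sigma> ` q = {0}" "dim q = card Bs div 2"
proof -
  obtain t where t: "compact t" "\<And>c v. compact c \<Longrightarrow> br t c = 0 \<Longrightarrow> v \<in> Z t \<Longrightarrow> br c v = 0"
    using ex_regular_compact by blast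
  interpret t: regular_compact scale br Bs \<sigma> t
    by unfold_locales (use t in auto)
  obtain q z where q: "subspace q" "q \<subseteq> G" "\<forall>x\<in>q. \<forall>y\<in>q. br x y \<in> q" "q \<inter> \<sigma> ` q = {0}"
    and z: "G \<subseteq> span (insert z (q \<union> \<sigma> ` q))"
    using t.ex_half_dimensional by blast
  obtain S where S: "finite S" "independent S" "span S = q" "card S = dim q"
    using fin_basis[OF Bs(2) q(1,2)] .
  have Sq: "S \<subseteq> q" using S(3) span_superset by blast
  have inj: "inj \<sigma>" using sig_sig by (metis injI)
  have S0: "0 \<notin> S" using S(2) dependent_zero by blast
  have disj: "S \<inter> \<sigma> ` S = {}"
  proof -
    have "S \<inter> \<sigma> ` S \<subseteq> {0}"
      unfolding q(4)[symmetric] by (intro Int_mono image_mono Sq)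
    then show ?thesis using S0 by (metis Int_iff subset_singletonD insertI1)
  qed
  have SG: "S \<subseteq> G" using Sq q(2) by (rule order_trans)
  have "S \<union> \<sigma> ` S \<subseteq> G" using sig_in[OF subsetD[OF SG]] SG by (simp add: image_subset_iff)
  have sqs: "\<sigma> ` q \<subseteq> span (\<sigma> ` S)"
  proof
    fix v assume "v \<in> \<sigma> ` q"
    then obtain u where u: "u \<in> span S" "v = \<sigma> u" using S(3) by blast
    have "\<sigma> u \<in> span (\<sigma> ` S)" using u(1)
      by (induction rule: span_induct_alt) (auto simp: sig_0 sig_add sig_scale span_zero span_add span_scale span_base)
    then show "v \<in> span (\<sigma> ` S)" using u by simp
  qed
  have ind: "independent (S \<union> \<sigma> ` S)"
  proof (subst dependent_finite)
    show "finite (S \<union> \<sigma> ` S)" using S(1) by simp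
    show "\<not> (\<exists>u. (\<exists>v\<in>S \<union> \<sigma> ` S. u v \<noteq> 0) \<and> (\<Sum>v\<in>S \<union> \<sigma> ` S. scale (u v) v) = 0)"
    proof (intro notI, elim exE conjE)
      fix u assume nz: "\<exists>v\<in>S \<union> \<sigma> ` S. u v \<noteq> 0" and e: "(\<Sum>v\<in>S \<union> \<sigma> ` S. scale (u v) v) = 0"
      define a where "a = (\<Sum>v\<in>S. scale (u v) v)"
      \<comment> \<open>\<open>\<sigma>\<close> is antilinear, so the coefficients on the conjugate
        half have to be conjugated to write that half as \<open>\<sigma> b\<close>.\<close>
      define b where "b = (\<Sum>v\<in>S. scale (cnj (u (\<sigma> v))) v)"
      have "(\<Sum>v\<in>\<sigma> ` S. scale (u v) v) = \<sigma> b"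
        unfolding b_def using inj
        by (subst sum.reindex) (auto simp: inj_on_def sig_sum sig_scale)
      then have ab: "a + \<sigma> b = 0" using e S(1) disj by (simp add: sum.union_disjoint a_def)
      have aq: "a \<in> q" "b \<in> q" unfolding a_def b_def using Sq q(1) by (auto intro!: subspace_sum subspace_scale)
      have "a = \<sigma> (- b)" using ab by (simp add: sig_minus eq_neg_iff_add_eq_0)
      moreover have "- b \<in> q" using aq q(1) by (simp add: subspace_neg)
      ultimately have "a \<in> q \<inter> \<sigma> ` q" using aq by blast
      then have a0: "a = 0" using q(4) by blast
      then have "\<sigma> (\<sigma> b) = 0" using ab by (simp add: sig_0)
      then have b0: "b = 0" by (simp add: sig_sig)
      have "u v = 0" if "v \<in> S" for v
        using independentD[OF S(2,1) subset_refl, of u] a0 that by (simp add: a_def)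
      moreover have "cnj (u (\<sigma> v)) = 0" if "v \<in> S" for v
        using independentD[OF S(2,1) subset_refl, of "\<lambda>v. cnj (u (\<sigma> v))"] b0 that by (simp add: b_def)
      ultimately show False using nz by auto
    qed
  qed
  have c: "card (S \<union> \<sigma> ` S) = 2 * dim q"
    using disj S inj by (simp add: card_Un_disjoint card_image inj_on_def)
  have "2 * dim q \<le> card Bs"
    using independent_span_bound[OF Bs(2) ind] \<open>S \<union> \<sigma> ` S \<subseteq> G\<close> c by simp
  moreover have "card Bs \<le> Suc (2 * dim q)"
  proof -
    have "insert z (q \<union> \<sigma> ` q) \<subseteq> span (insert z (S \<union> \<sigma> ` S))"
    proof -
      have "span S \<subseteq> span (insert z (S \<union> \<sigma> ` S))" "span (\<sigma> ` S) \<subseteq> span (insert z (S \<union> \<sigma> ` S))"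
        by (auto intro!: span_mono)
      then show ?thesis using S(3) sqs by (auto simp: span_base)
    qed
    then have "G \<subseteq> span (insert z (S \<union> \<sigma> ` S))"
      using z span_minimal[OF _ subspace_span] by (meson order_trans)
    then have "Bs \<subseteq> span (insert z (S \<union> \<sigma> ` S))" using span_superset by blast
    then have "card Bs \<le> card (insert z (S \<union> \<sigma> ` S))"
      using independent_span_bound[OF _ Bs(1)] S(1) by simp
    also have "\<dots> \<le> Suc (card (S \<union> \<sigma> ` S))" using S(1) by (simp add: card_insert_if)
    finally show ?thesis using c by simp
  qed
  ultimately have "dim q = card Bs div 2" by linarith
  then show ?thesis using that q by blast
qed

end

section \<open>Smooth functions\<close>

lemma frechet_derivative_eq: "(f has_derivative D) (at x) \<Longrightarrow> frechet_derivative f (at x) = D"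
  using frechet_derivative_at by metis

lemma C_k_on_subset: "C_k_on k S f \<Longrightarrow> T \<subseteq> S \<Longrightarrow> C_k_on k T f"
  by (induction k arbitrary: f) (auto intro: continuous_on_subset)

lemma C_k_on_cong:
  assumes "open S" "\<And>x. x \<in> S \<Longrightarrow> f x = g x" "C_k_on k S f"
  shows "C_k_on k S g"
  using assms(2,3)
proof (induction k arbitrary: f g)
  case 0
  then show ?case by (simp cong: continuous_on_cong)
next
  case (Suc k)
  have d: "(g has_derivative frechet_derivative f (at x)) (at x)" if "x \<in> S" for x
  proof -
    have "(f has_derivative frechet_derivative f (at x)) (at x)"
      using Suc.prems that by (simp add: frechet_derivative_works[symmetric])
    then show ?thesis using has_derivative_transform_within_open[OF _ assms(1) that] Suc.prems(1) by blast
  qed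
  have "C_k_on k S (\<lambda>x. frechet_derivative g (at x) v)" for v
    by (rule Suc.IH[where f="\<lambda>x. frechet_derivative f (at x) v"])
      (use Suc.prems(2) in \<open>simp_all add: frechet_derivative_eq[OF d]\<close>)
  then show ?case using d by (auto simp: differentiable_def)
qed

text \<open>Accepts any explicit formula for the derivative, so the inductions below work with
  derivative rules instead of \<open>frechet_derivative\<close> of a composite.\<close>

lemma C_k_on_SucI:
  assumes "open S" "\<And>x. x \<in> S \<Longrightarrow> (f has_derivative D x) (at x)" "\<And>v. C_k_on k S (\<lambda>x. D x v)"
  shows "C_k_on (Suc k) S f"
proof -
  have "C_k_on k S (\<lambda>x. frechet_derivative f (at x) v)" for v
    by (rule C_k_on_cong[OF assms(1) _ assms(3)[of v]]) (simp add: frechet_derivative_eq[OF assms(2)])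
  then show ?thesis using assms(2) by (auto simp: differentiable_def)
qed

lemma C_k_on_SucD:
  assumes "C_k_on (Suc k) S f" "x \<in> S"
  shows "(f has_derivative frechet_derivative f (at x)) (at x)"
  using assms by (simp add: frechet_derivative_works[symmetric])

lemma C_k_on_SucD2: "C_k_on (Suc k) S f \<Longrightarrow> C_k_on k S (\<lambda>x. frechet_derivative f (at x) v)"
  by simp

lemma C_k_on_pred: "C_k_on (Suc k) S f \<Longrightarrow> C_k_on k S f"
proof (induction k arbitrary: f)
  case 0
  then show ?case
    by (auto intro!: continuous_at_imp_continuous_on differentiable_imp_continuous_within)
next
  case (Suc k)
  then show ?case by (metis C_k_on.simps(2))
qed

lemma C_k_on_local:
  assumes "\<And>x. x \<in> S \<Longrightarrow> \<exists>T. open T \<and> x \<in> T \<and> C_k_on k T f"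
  shows "C_k_on k S f"
  using assms
proof (induction k arbitrary: f)
  case 0
  show ?case unfolding C_k_on.simps
  proof (rule continuous_at_imp_continuous_on, rule ballI)
    fix x assume "x \<in> S"
    then show "isCont f x" using 0 by (metis C_k_on.simps(1) continuous_on_eq_continuous_at)
  qed
next
  case (Suc k)
  have "f differentiable (at x)" if "x \<in> S" for x using Suc.prems[OF that] by auto
  moreover have "C_k_on k S (\<lambda>x. frechet_derivative f (at x) v)" for v
    by (rule Suc.IH) (use Suc.prems in fastforce)
  ultimately show ?case by simp
qed

lemma C_k_on_const: "open S \<Longrightarrow> C_k_on k S (\<lambda>x. c)"
proof (induction k arbitrary: c)
  case (Suc k)
  show ?case by (rule C_k_on_SucI[OF Suc.prems has_derivative_const]) (rule Suc.IH[OF Suc.prems])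
qed simp

lemma C_k_on_bounded_linear:
  assumes "bounded_linear L" "open S"
  shows "C_k_on k S L"
proof (cases k)
  case 0
  then show ?thesis using assms(1) by (simp add: linear_continuous_on)
next
  case (Suc j)
  show ?thesis unfolding Suc
    by (rule C_k_on_SucI[OF assms(2) bounded_linear_imp_has_derivative[OF assms(1)]])
      (rule C_k_on_const[OF assms(2)])
qed

lemma C_k_on_bounded_linear_comp:
  assumes "bounded_linear L" "open S" "C_k_on k S f"
  shows "C_k_on k S (\<lambda>x. L (f x))"
  using assms(3)
proof (induction k arbitrary: f)
  case 0
  then show ?case using bounded_linear.continuous_on[OF assms(1)] by simp
next
  case (Suc k)
  show ?case
    by (rule C_k_on_SucI[OF assms(2) bounded_linear.has_derivative[OF assms(1) C_k_on_SucD[OF Suc.prems]]], assumption)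
      (rule Suc.IH[OF C_k_on_SucD2[OF Suc.prems]])
qed

lemma C_k_on_add:
  assumes "open S" "C_k_on k S f" "C_k_on k S g"
  shows "C_k_on k S (\<lambda>x. f x + g x)"
  using assms(2,3)
proof (induction k arbitrary: f g)
  case 0
  then show ?case by (simp add: continuous_on_add)
next
  case (Suc k)
  show ?case
    by (rule C_k_on_SucI[OF assms(1) has_derivative_add[OF C_k_on_SucD[OF Suc.prems(1)] C_k_on_SucD[OF Suc.prems(2)]]])
      (auto intro!: Suc.IH C_k_on_SucD2 Suc.prems simp del: C_k_on.simps)
qed

lemma C_k_on_sum:
  assumes "open S" "\<And>i. i \<in> I \<Longrightarrow> C_k_on k S (f i)"
  shows "C_k_on k S (\<lambda>x. \<Sum>i\<in>I. f i x)"
  using assms(2)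
  by (induction I rule: infinite_finite_induct) (auto intro!: C_k_on_const C_k_on_add assms(1))

lemma (in bounded_bilinear) C_k_on_bilinear:
  assumes "open S" "C_k_on k S f" "C_k_on k S g"
  shows "C_k_on k S (\<lambda>x. prod (f x) (g x))"
  using assms(2,3)
proof (induction k arbitrary: f g)
  case 0
  then show ?case by (simp add: continuous_on)
next
  case (Suc k)
  show ?case
  proof (rule C_k_on_SucI[OF assms(1) FDERIV[OF C_k_on_SucD[OF Suc.prems(1)] C_k_on_SucD[OF Suc.prems(2)]]])
    fix v
    show "C_k_on k S (\<lambda>x. prod (f x) (frechet_derivative g (at x) v) + prod (frechet_derivative f (at x) v) (g x))"
      by (rule C_k_on_add[OF assms(1) Suc.IH[OF C_k_on_pred[OF Suc.prems(1)] C_k_on_SucD2[OF Suc.prems(2)]]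
            Suc.IH[OF C_k_on_SucD2[OF Suc.prems(1)] C_k_on_pred[OF Suc.prems(2)]]])
  qed
qed

text \<open>A finite Parseval frame. The calculus below uses this expansion property, and
  \<open>B = {}\<close> covers model spaces of dimension 0.\<close>

definition on_basis :: "'a::real_inner set \<Rightarrow> bool" where
  "on_basis B \<longleftrightarrow> finite B \<and> (\<forall>x. x = (\<Sum>b\<in>B. (x \<bullet> b) *\<^sub>R b))"

lemma on_basis_expand: "on_basis B \<Longrightarrow> linear L \<Longrightarrow> L x = (\<Sum>b\<in>B. (x \<bullet> b) *\<^sub>R L b)"
  unfolding on_basis_def by (metis (no_types, lifting) linear_sum linear_scale sum.cong)

text \<open>The chain rule differentiates \<open>g\<close> in a direction that varies with
  \<open>x\<close>. Expanding the direction along \<open>B\<close> leaves finitely many fixed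
  directions, and the induction hypothesis applies to each of these partial derivatives of
  \<open>g\<close>.\<close>

lemma C_k_on_compose:
  fixes f :: "'a::real_normed_vector \<Rightarrow> 'e::real_inner" and g :: "'e \<Rightarrow> 'b::real_normed_vector"
  assumes B: "on_basis (B :: 'e set)" and S: "open S"
  shows "C_k_on k S f \<Longrightarrow> C_k_on k T g \<Longrightarrow> f ` S \<subseteq> T \<Longrightarrow> C_k_on k S (\<lambda>x. g (f x))"
proof (induction k arbitrary: g)
  case 0
  then show ?case using continuous_on_compose2[of T g S f] by auto
next
  case (Suc k)
  have fT: "f x \<in> T" if "x \<in> S" for x using Suc.prems(3) that by blast
  have d: "((\<lambda>x. g (f x)) has_derivative
      (\<lambda>v. \<Sum>b\<in>B. (frechet_derivative f (at x) v \<bullet> b) *\<^sub>R frechet_derivative g (at (f x)) b)) (at x)"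
    if x: "x \<in> S" for x
  proof -
    have dg: "(g has_derivative frechet_derivative g (at (f x))) (at (f x))"
      using C_k_on_SucD[OF Suc.prems(2) fT[OF x]] .
    have "((\<lambda>x. g (f x)) has_derivative
       (\<lambda>v. frechet_derivative g (at (f x)) (frechet_derivative f (at x) v))) (at x)"
      using diff_chain_at[OF C_k_on_SucD[OF Suc.prems(1) x] dg] by (simp add: o_def)
    then show ?thesis
      by (subst (asm) on_basis_expand[OF B has_derivative_linear[OF dg]])
  qed
  show ?case
  proof (rule C_k_on_SucI[OF S d])
    fix v
    show "C_k_on k S (\<lambda>x. \<Sum>b\<in>B. (frechet_derivative f (at x) v \<bullet> b) *\<^sub>R frechet_derivative g (at (f x)) b)"
    proof (intro C_k_on_sum[OF S] bounded_bilinear.C_k_on_bilinear[OF bounded_bilinear_scaleR S])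
      fix b
      show "C_k_on k S (\<lambda>x. frechet_derivative f (at x) v \<bullet> b)"
        by (rule C_k_on_bounded_linear_comp[OF bounded_linear_inner_left S C_k_on_SucD2[OF Suc.prems(1)]])
      show "C_k_on k S (\<lambda>x. frechet_derivative g (at (f x)) b)"
        by (rule Suc.IH[OF C_k_on_pred[OF Suc.prems(1)] C_k_on_SucD2[OF Suc.prems(2)] Suc.prems(3)])
    qed
  qed
qed

lemma smooth_on_subset: "smooth_on S f \<Longrightarrow> T \<subseteq> S \<Longrightarrow> smooth_on T f"
  unfolding smooth_on_def using C_k_on_subset by blast

lemma smooth_on_cong: "open S \<Longrightarrow> smooth_on S f \<Longrightarrow> (\<And>x. x \<in> S \<Longrightarrow> f x = g x) \<Longrightarrow> smooth_on S g"
  unfolding smooth_on_def using C_k_on_cong by blast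

lemma smooth_on_local:
  assumes "\<And>x. x \<in> S \<Longrightarrow> \<exists>T. open T \<and> x \<in> T \<and> smooth_on T f"
  shows "smooth_on S f"
  unfolding smooth_on_def
proof (intro allI C_k_on_local)
  fix k x assume "x \<in> S"
  then show "\<exists>T. open T \<and> x \<in> T \<and> C_k_on k T f" using assms unfolding smooth_on_def by blast
qed

lemma smooth_on_const: "open S \<Longrightarrow> smooth_on S (\<lambda>x. c)"
  unfolding smooth_on_def by (simp add: C_k_on_const)

lemma smooth_on_bounded_linear: "bounded_linear L \<Longrightarrow> open S \<Longrightarrow> smooth_on S L"
  unfolding smooth_on_def by (simp add: C_k_on_bounded_linear)

lemma smooth_on_bounded_linear_comp:
  "bounded_linear L \<Longrightarrow> open S \<Longrightarrow> smooth_on S f \<Longrightarrow> smooth_on S (\<lambda>x. L (f x))"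
  unfolding smooth_on_def by (simp add: C_k_on_bounded_linear_comp[where L=L and f=f])

lemma smooth_on_add: "open S \<Longrightarrow> smooth_on S f \<Longrightarrow> smooth_on S g \<Longrightarrow> smooth_on S (\<lambda>x. f x + g x)"
  unfolding smooth_on_def by (simp add: C_k_on_add[where f=f and g=g])

lemma smooth_on_sum: "open S \<Longrightarrow> (\<And>i. i \<in> I \<Longrightarrow> smooth_on S (f i)) \<Longrightarrow> smooth_on S (\<lambda>x. \<Sum>i\<in>I. f i x)"
  unfolding smooth_on_def by (simp add: C_k_on_sum[where f=f])

lemma smooth_on_mult:
  fixes f g :: "'a::real_normed_vector \<Rightarrow> 'b::real_normed_algebra"
  shows "open S \<Longrightarrow> smooth_on S f \<Longrightarrow> smooth_on S g \<Longrightarrow> smooth_on S (\<lambda>x. f x * g x)"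
  unfolding smooth_on_def by (simp add: bounded_bilinear.C_k_on_bilinear[OF bounded_bilinear_mult, where f=f and g=g])

lemma smooth_on_inner:
  "open S \<Longrightarrow> smooth_on S f \<Longrightarrow> smooth_on S g \<Longrightarrow> smooth_on S (\<lambda>x. f x \<bullet> g x)"
  unfolding smooth_on_def by (simp add: bounded_bilinear.C_k_on_bilinear[OF bounded_bilinear_inner, where f=f and g=g])

lemma smooth_on_compose:
  fixes f :: "'a::real_normed_vector \<Rightarrow> 'e::real_inner"
  shows "on_basis (B :: 'e set) \<Longrightarrow> open S \<Longrightarrow> smooth_on S f \<Longrightarrow> smooth_on T g \<Longrightarrow> f ` S \<subseteq> T \<Longrightarrow> smooth_on S (\<lambda>x. g (f x))"
  unfolding smooth_on_def
  using C_k_on_compose[where B=B and f=f and g=g and S=S and T=T] by (simp add: image_subset_iff)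

lemma smooth_on_minus: "open S \<Longrightarrow> smooth_on S f \<Longrightarrow> smooth_on S (\<lambda>x. - f x)"
  using smooth_on_bounded_linear_comp[OF bounded_linear_minus[OF bounded_linear_ident], of S f] .

lemma smooth_on_diff: "open S \<Longrightarrow> smooth_on S f \<Longrightarrow> smooth_on S g \<Longrightarrow> smooth_on S (\<lambda>x. f x - g x)"
  using smooth_on_add[of S f "\<lambda>x. - g x"] smooth_on_minus[of S g] by simp

lemma smooth_on_ident: "open S \<Longrightarrow> smooth_on S (\<lambda>x. x)"
  by (rule smooth_on_bounded_linear[OF bounded_linear_ident])

lemma smooth_on_Pair:
  fixes f :: "'a::real_normed_vector \<Rightarrow> 'b::real_normed_vector" and g :: "'a \<Rightarrow> 'c::real_normed_vector"
  assumes "open S" "smooth_on S f" "smooth_on S g"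
  shows "smooth_on S (\<lambda>x. (f x, g x))"
proof -
  have "bounded_linear (\<lambda>x::'b. (x, 0::'c))" "bounded_linear (\<lambda>y::'c. (0::'b, y))"
    by (intro bounded_linear_Pair bounded_linear_ident bounded_linear_zero)+
  then have "smooth_on S (\<lambda>x. (f x, 0) + (0, g x))"
    using assms smooth_on_bounded_linear_comp[of "\<lambda>x::'b. (x, 0::'c)" S f]
      smooth_on_bounded_linear_comp[of "\<lambda>y::'c. (0::'b, y)" S g] by (intro smooth_on_add) simp_all
  then show ?thesis by simp
qed

lemma smooth_on_frechet: "smooth_on S f \<Longrightarrow> smooth_on S (\<lambda>x. frechet_derivative f (at x) v)"
  unfolding smooth_on_def using C_k_on_SucD2[where f=f and v=v and S=S] by (simp del: C_k_on.simps)

lemma smooth_on_has_derivative: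
  "smooth_on S f \<Longrightarrow> x \<in> S \<Longrightarrow> (f has_derivative frechet_derivative f (at x)) (at x)"
  unfolding smooth_on_def using C_k_on_SucD[where f=f and x=x and S=S] by blast

lemma smooth_on_continuous: "smooth_on S f \<Longrightarrow> continuous_on S f"
  unfolding smooth_on_def using C_k_on.simps(1) by blast

lemma ex_on_basis:
  assumes "finite (B :: 'e::real_inner set)" "span B = UNIV"
  obtains E :: "'e::real_inner set" where "on_basis E" "card E = dim (UNIV :: 'e::real_inner set)"
    "\<And>a b. a \<in> E \<Longrightarrow> b \<in> E \<Longrightarrow> a \<bullet> b = (if a = b then 1 else 0)"
proof -
  obtain C where C: "finite C" "span C = span B" "pairwise orthogonal C"
    using basis_orthogonal[OF assms(1)] by blast
  define E where "E = (\<lambda>x. x /\<^sub>R norm x) ` (C - {0})"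
  have sp: "span (C - {0}) = UNIV" using C(2) assms(2) by simp
  have ort: "a \<bullet> b = (if a = b then 1 else 0)" if ab: "a \<in> E" "b \<in> E" for a b
  proof -
    obtain x y where xy: "x \<in> C - {0}" "y \<in> C - {0}" "a = x /\<^sub>R norm x" "b = y /\<^sub>R norm y"
      using ab unfolding E_def by blast
    show ?thesis
    proof (cases "x = y")
      case True
      then show ?thesis using xy by (simp add: dot_square_norm power2_eq_square)
    next
      case False
      then have "x \<bullet> y = 0" using C(3) xy by (auto simp: pairwise_def orthogonal_def)
      then have "a \<bullet> b = 0" using xy by simp
      moreover have "a \<bullet> a \<noteq> 0" using xy by simp
      ultimately show ?thesis by metis
    qed
  qed
  have fE: "finite E" using C(1) by (simp add: E_def)
  have spE: "span E = UNIV"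
  proof -
    have "C - {0} \<subseteq> span E"
    proof
      fix x assume x: "x \<in> C - {0}"
      then have "x = norm x *\<^sub>R (x /\<^sub>R norm x)" by simp
      moreover have "x /\<^sub>R norm x \<in> span E" using x by (auto simp: E_def intro: span_base)
      ultimately show "x \<in> span E" by (metis span_scale)
    qed
    then show ?thesis using sp span_minimal[OF _ subspace_span] by (metis top.extremum_uniqueI)
  qed
  have ex: "x = (\<Sum>b\<in>E. (x \<bullet> b) *\<^sub>R b)" for x
  proof -
    have "x \<in> span E" using spE by simp
    then obtain u where u: "x = (\<Sum>v\<in>E. u v *\<^sub>R v)" using span_finite[OF fE] by auto
    have "x \<bullet> b = u b" if "b \<in> E" for b
      unfolding u inner_sum_left using fE that by (simp add: ort if_distrib cong: if_cong)
    then show ?thesis using u by simp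
  qed
  then have on: "on_basis E" using fE by (simp add: on_basis_def)
  have "independent E"
  proof (rule independent_if_scalars_zero[OF fE])
    fix f x assume e: "(\<Sum>v\<in>E. f v *\<^sub>R v) = 0" "x \<in> E"
    have "(\<Sum>v\<in>E. f v *\<^sub>R v) \<bullet> x = f x"
      unfolding inner_sum_left using fE e(2) by (simp add: ort if_distrib cong: if_cong)
    then show "f x = 0" using e(1) by simp
  qed
  then have "card E = dim (UNIV :: 'e set)" using dim_eq_card[of E UNIV] spE by simp
  then show ?thesis using that on ort by blast
qed

text \<open>The model type is merely an inner product space, so the Heine-Borel property is drawn
  from the frame: the ball is a closed subset of a finite sum of compact segments.\<close>

lemma compact_cball_on_basis:
  fixes c :: "'e::real_inner"
  assumes B: "on_basis (B :: 'e set)"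
  shows "compact (cball c r)"
proof -
  have fB: "finite B" and ex: "\<And>x. x = (\<Sum>b\<in>B. (x \<bullet> b) *\<^sub>R b)" using B by (auto simp: on_basis_def)
  have cp: "compact {\<Sum>b\<in>F. u b *\<^sub>R b |u. \<forall>b\<in>F. \<bar>u b\<bar> \<le> M b}" if "finite F" for F :: "'e set" and M
    using that
  proof (induction F)
    case empty
    then show ?case by (simp)
  next
    case (insert a F)
    have "compact ((\<lambda>s. s *\<^sub>R a) ` {- M a..M a})"
      by (intro compact_continuous_image continuous_intros compact_Icc)
    then have "compact {x + y |x y. x \<in> (\<lambda>s. s *\<^sub>R a) ` {- M a..M a} \<and> y \<in> {\<Sum>b\<in>F. u b *\<^sub>R b |u. \<forall>b\<in>F. \<bar>u b\<bar> \<le> M b}}"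
      by (rule compact_sums[OF _ insert.IH])
    also have "{x + y |x y. x \<in> (\<lambda>s. s *\<^sub>R a) ` {- M a..M a} \<and> y \<in> {\<Sum>b\<in>F. u b *\<^sub>R b |u. \<forall>b\<in>F. \<bar>u b\<bar> \<le> M b}}
        = {\<Sum>b\<in>insert a F. u b *\<^sub>R b |u. \<forall>b\<in>insert a F. \<bar>u b\<bar> \<le> M b}" (is "?L = ?R")
    proof
      show "?L \<subseteq> ?R"
      proof
        fix z assume "z \<in> ?L"
        then obtain s u where z: "- M a \<le> s" "s \<le> M a" "\<forall>b\<in>F. \<bar>u b\<bar> \<le> M b" "z = s *\<^sub>R a + (\<Sum>b\<in>F. u b *\<^sub>R b)" by auto
        have "z = (\<Sum>b\<in>insert a F. (u(a := s)) b *\<^sub>R b)"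
          using insert.hyps z(4) by (simp add: sum.insert) (rule sum.cong, auto)
        moreover have "\<forall>b\<in>insert a F. \<bar>(u(a := s)) b\<bar> \<le> M b" using z by auto
        ultimately show "z \<in> ?R" by blast
      qed
      show "?R \<subseteq> ?L"
      proof
        fix z assume "z \<in> ?R"
        then obtain u where u: "z = (\<Sum>b\<in>insert a F. u b *\<^sub>R b)" "\<forall>b\<in>insert a F. \<bar>u b\<bar> \<le> M b" by blast
        then have "z = u a *\<^sub>R a + (\<Sum>b\<in>F. u b *\<^sub>R b)" using insert.hyps by simp
        moreover have "u a *\<^sub>R a \<in> (\<lambda>s. s *\<^sub>R a) ` {- M a..M a}"
          using u(2) by (intro imageI) (simp add: abs_le_iff)
        ultimately show "z \<in> ?L" using u(2) by blast
      qed
    qed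
    finally show ?case .
  qed
  \<comment> \<open>The bound on \<open>x \<bullet> b\<close> comes from the Cauchy-Schwarz
    inequality and \<open>norm x \<le> norm c + |r|\<close>.\<close>
  have cT: "compact {\<Sum>b\<in>B. u b *\<^sub>R b |u. \<forall>b\<in>B. \<bar>u b\<bar> \<le> (norm c + \<bar>r\<bar>) * norm b}"
    using cp[OF fB, of "\<lambda>b. (norm c + \<bar>r\<bar>) * norm b"] .
  have "cball c r \<subseteq> {\<Sum>b\<in>B. u b *\<^sub>R b |u. \<forall>b\<in>B. \<bar>u b\<bar> \<le> (norm c + \<bar>r\<bar>) * norm b}"
  proof
    fix x assume "x \<in> cball c r"
    then have "norm x \<le> norm c + \<bar>r\<bar>"
      using norm_triangle_ineq2[of x c] by (simp add: dist_norm norm_minus_commute)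
    then have bd: "\<bar>x \<bullet> b\<bar> \<le> (norm c + \<bar>r\<bar>) * norm b" for b
      by (rule order_trans[OF Cauchy_Schwarz_ineq2 mult_right_mono]) simp
    show "x \<in> {\<Sum>b\<in>B. u b *\<^sub>R b |u. \<forall>b\<in>B. \<bar>u b\<bar> \<le> (norm c + \<bar>r\<bar>) * norm b}"
      by (intro CollectI exI[of _ "\<lambda>b. x \<bullet> b"] conjI ballI) (rule ex, rule bd)
  qed
  then show ?thesis using closed_Int_compact[OF closed_cball[of c r] cT] by (simp only: Int_absorb2)
qed

section \<open>Flat functions and bumps\<close>

definition flat :: "real poly \<Rightarrow> real \<Rightarrow> real" where
  "flat p x = (if x \<le> 0 then 0 else poly p (1 / x) * exp (- (1 / x)))"

text \<open>With \<open>y = 1 / x\<close>, the derivative of \<open>p(y) exp(-y)\<close> in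
  \<open>x\<close> is \<open>y^2 (p(y) - p'(y)) exp(-y)\<close>. Hence the family
  \<open>flat\<close> is closed under derivatives, and smoothness follows by induction for all
  \<open>p\<close> at once.\<close>

definition flat_deriv :: "real poly \<Rightarrow> real poly" where
  "flat_deriv p = monom 1 2 * (p - pderiv p)"

lemma poly_exp_tendsto_0: "((\<lambda>y. poly p y * exp (- y)) \<longlongrightarrow> (0::real)) at_top"
proof -
  have "((\<lambda>y. \<Sum>i\<le>degree p. coeff p i * (y ^ i / exp y)) \<longlongrightarrow> (\<Sum>i\<le>degree p. coeff p i * 0)) at_top"
    by (intro tendsto_sum tendsto_mult tendsto_const tendsto_power_div_exp_0)
  moreover have "(\<lambda>y. \<Sum>i\<le>degree p. coeff p i * (y ^ i / exp y)) = (\<lambda>y. poly p y * exp (- y))"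
    by (simp add: poly_altdef sum_distrib_right sum_divide_distrib exp_minus field_simps)
  ultimately show ?thesis by simp
qed

lemma flat_has_derivative: "(flat p has_real_derivative flat (flat_deriv p) x) (at x)"
proof -
  consider "x < 0" | "x = 0" | "x > 0" by linarith
  then show ?thesis
  proof cases
    case 1
    have "((\<lambda>x. 0) has_real_derivative 0) (at x)" by simp
    then have "(flat p has_real_derivative 0) (at x)"
      by (rule has_field_derivative_transform_within_open[of _ _ _ "{..<0}"]) (use 1 in \<open>auto simp: flat_def\<close>)
    then show ?thesis using 1 by (simp add: flat_def)
  next
    case 3
    have "((\<lambda>x. poly p (1 / x) * exp (- (1 / x))) has_real_derivative
        poly (pderiv p) (1 / x) * (- 1 / x\<^sup>2) * exp (- (1 / x)) + poly p (1 / x) * (exp (- (1 / x)) * (1 / x\<^sup>2))) (at x)"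
      using 3 by (auto intro!: derivative_eq_intros simp: power2_eq_square field_simps)
    moreover have "poly (pderiv p) (1 / x) * (- 1 / x\<^sup>2) * exp (- (1 / x)) + poly p (1 / x) * (exp (- (1 / x)) * (1 / x\<^sup>2))
        = flat (flat_deriv p) x"
      using 3 by (simp add: flat_def flat_deriv_def poly_monom power_divide field_simps)
    ultimately have "((\<lambda>x. poly p (1 / x) * exp (- (1 / x))) has_real_derivative flat (flat_deriv p) x) (at x)" by simp
    then show ?thesis
      by (rule has_field_derivative_transform_within_open[of _ _ _ "{0<..}"]) (use 3 in \<open>auto simp: flat_def\<close>)
  next
    case 2
    have "((\<lambda>h. flat p h / h) \<longlongrightarrow> 0) (at_right 0)"
    proof -
      \<comment> \<open>At 0 the difference quotient is \<open>y p(y) exp(-y)\<close> with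
        \<open>y = 1 / h\<close>; the factor \<open>y\<close> is the shift
        \<open>pCons 0 p\<close>.\<close>
      have "((\<lambda>h. poly (pCons 0 p) (inverse h) * exp (- inverse h)) \<longlongrightarrow> 0) (at_right 0)"
        by (rule filterlim_compose[OF poly_exp_tendsto_0 filterlim_inverse_at_top_right])
      then show ?thesis
        by (rule Lim_transform_eventually)
          (auto simp: eventually_at_filter flat_def field_simps inverse_eq_divide)
    qed
    moreover have "((\<lambda>h. flat p h / h) \<longlongrightarrow> 0) (at_left 0)"
      by (rule Lim_transform_eventually[OF tendsto_const]) (auto simp: eventually_at_filter flat_def)
    ultimately have "((\<lambda>h. flat p h / h) \<longlongrightarrow> 0) (at 0)" by (simp add: filterlim_at_split)
    then show ?thesis using 2 by (simp add: has_field_derivative_iff flat_def)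
  qed
qed

lemma C_k_on_flat: "C_k_on k UNIV (flat p)"
proof (induction k arbitrary: p)
  case 0
  then show ?case
    unfolding C_k_on.simps using flat_has_derivative
    by (intro continuous_at_imp_continuous_on ballI DERIV_isCont)
next
  case (Suc k)
  show ?case
  proof (rule C_k_on_SucI[OF open_UNIV])
    show "(flat p has_derivative (*) (flat (flat_deriv p) x)) (at x)" for x
      using flat_has_derivative[of p x] by (simp add: has_field_derivative_def)
    show "C_k_on k UNIV (\<lambda>x. flat (flat_deriv p) x * v)" for v
      by (rule C_k_on_bounded_linear_comp[OF bounded_linear_mult_left open_UNIV Suc.IH])
  qed
qed

text \<open>The squared norm, written as an inner product, is smooth everywhere. The value at the
  centre is positive but not normalized to 1.\<close>

definition bump :: "'e::real_inner \<Rightarrow> real \<Rightarrow> 'e \<Rightarrow> real" where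
  "bump c r x = flat 1 (r\<^sup>2 - (x - c) \<bullet> (x - c))"

lemma smooth_bump: "smooth_on UNIV (bump c r)"
proof -
  have on: "on_basis {1::real}" by (simp add: on_basis_def)
  have "smooth_on UNIV (\<lambda>x. r\<^sup>2 - (x - c) \<bullet> (x - c))"
    by (intro smooth_on_diff smooth_on_inner smooth_on_const smooth_on_ident open_UNIV)
  moreover have "smooth_on UNIV (flat 1)" unfolding smooth_on_def using C_k_on_flat by blast
  ultimately show ?thesis unfolding bump_def[abs_def] using smooth_on_compose[OF on open_UNIV] by blast
qed

lemma bump_zero: "r \<ge> 0 \<Longrightarrow> x \<notin> cball c r \<Longrightarrow> bump c r x = 0"
proof -
  assume "r \<ge> 0" "x \<notin> cball c r"
  then have "r < norm (x - c)" by (simp add: dist_norm norm_minus_commute)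
  then have "r\<^sup>2 < (norm (x - c))\<^sup>2" using \<open>r \<ge> 0\<close> by (intro power_strict_mono) auto
  then show ?thesis by (simp add: bump_def flat_def power2_norm_eq_inner)
qed

lemma bump_centre: "r > 0 \<Longrightarrow> bump c r c > 0"
  by (simp add: bump_def flat_def)

section \<open>Differentiation under the integral and Hadamard's lemma\<close>

context
  fixes B :: "'e::real_inner set"
  assumes B: "on_basis B"
begin

text \<open>The inner map contributes a factor \<open>s\<close>, so the derivative in direction
  \<open>v\<close> is an integral of the same shape with \<open>m + 1\<close>. The weight
  \<open>s ^ m\<close> is there to close the induction in
  \<open>smooth_param_integral\<close>.\<close>

lemma param_integral_has_derivative:
  fixes G :: "'e \<Rightarrow> 'b::banach"
  assumes G: "C_k_on 1 (ball c \<rho>) G" and y: "y \<in> ball c \<rho>"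
  shows "((\<lambda>y. integral {0..1} (\<lambda>s. s ^ m *\<^sub>R G (c + s *\<^sub>R (y - c)))) has_derivative
     (\<lambda>v. integral {0..1} (\<lambda>s. s ^ Suc m *\<^sub>R frechet_derivative G (at (c + s *\<^sub>R (y - c))) v))) (at y)"
    (is "(?I has_derivative ?D) (at y)")
proof -
  let ?D' = "\<lambda>z. frechet_derivative G (at z)"
  let ?z = "\<lambda>y s. c + s *\<^sub>R (y - c)"
  have fB: "finite B" using B by (simp add: on_basis_def)
  have G1: "C_k_on (Suc 0) (ball c \<rho>) G" using G by simp
  have dG: "(G has_derivative ?D' z) (at z)" if "z \<in> ball c \<rho>" for z
    using C_k_on_SucD[OF G1 that] .
  have cG: "continuous_on (ball c \<rho>) G" using C_k_on_pred[OF G1] by simp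
  have cD: "continuous_on (ball c \<rho>) (\<lambda>z. ?D' z v)" for v using C_k_on_SucD2[OF G1] by simp
  have zin: "?z y s \<in> ball c \<rho>" if "y \<in> ball c \<rho>" "s \<in> {0..1}" for y s
  proof -
    have "norm (s *\<^sub>R (y - c)) \<le> norm (y - c)" using that(2) by (simp add: mult_left_le_one_le)
    then show ?thesis using that(1) by (simp add: dist_norm norm_minus_commute)
  qed
  have int: "(\<lambda>s. s ^ n *\<^sub>R F (?z y s)) integrable_on {0..1}"
    if "continuous_on (ball c \<rho>) F" "y \<in> ball c \<rho>" for n y and F :: "'e \<Rightarrow> 'b"
  proof (rule integrable_continuous_interval)
    have "continuous_on {0..1} (\<lambda>s. F (?z y s))"
      by (rule continuous_on_compose2[OF that(1)]) (auto intro!: continuous_intros zin that(2))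
    then show "continuous_on {0..1} (\<lambda>s. s ^ n *\<^sub>R F (?z y s))" by (intro continuous_intros)
  qed
  define N where "N = (\<Sum>b\<in>B. norm b)"
  have N0: "N \<ge> 0" by (simp add: N_def sum_nonneg)
  let ?K = "?z y ` {0..1}"
  have K: "compact ?K" by (intro compact_continuous_image continuous_intros compact_Icc)
  have linD: "linear ?D"
  proof
    have l: "linear (?D' (?z y s))" if "s \<in> {0..1}" for s using has_derivative_linear[OF dG[OF zin[OF y that]]] .
    fix u v
    have "?D (u + v) = integral {0..1} (\<lambda>s. s ^ Suc m *\<^sub>R ?D' (?z y s) u + s ^ Suc m *\<^sub>R ?D' (?z y s) v)"
      by (intro integral_cong) (simp add: linear_add[OF l] scaleR_add_right)
    then show "?D (u + v) = ?D u + ?D v"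
      using integral_add[OF int[OF cD y] int[OF cD y], of "Suc m" u "Suc m" v] by simp
  next
    have l: "linear (?D' (?z y s))" if "s \<in> {0..1}" for s using has_derivative_linear[OF dG[OF zin[OF y that]]] .
    fix r v
    have "?D (r *\<^sub>R v) = integral {0..1} (\<lambda>s. r *\<^sub>R (s ^ Suc m *\<^sub>R ?D' (?z y s) v))"
      by (intro integral_cong) (simp add: linear_scale[OF l] scaleR_left_commute)
    then show "?D (r *\<^sub>R v) = r *\<^sub>R ?D v" by (simp only: integral_cmul)
  qed
  have bl: "bounded_linear ?D"
  proof (rule bounded_linear_intro[where K="\<Sum>b\<in>B. norm b * norm (?D b)"])
    show "?D (u + v) = ?D u + ?D v" "?D (r *\<^sub>R v) = r *\<^sub>R ?D v" for u v r
      using linear_add[OF linD] linear_scale[OF linD] by auto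
    fix v
    have "norm (?D v) = norm (\<Sum>b\<in>B. (v \<bullet> b) *\<^sub>R ?D b)" by (subst on_basis_expand[OF B linD]) simp
    also have "\<dots> \<le> (\<Sum>b\<in>B. \<bar>v \<bullet> b\<bar> * norm (?D b))" by (rule order_trans[OF norm_sum]) simp
    also have "\<dots> \<le> (\<Sum>b\<in>B. norm v * norm b * norm (?D b))"
      by (intro sum_mono mult_right_mono Cauchy_Schwarz_ineq2 norm_ge_zero)
    finally show "norm (?D v) \<le> norm v * (\<Sum>b\<in>B. norm b * norm (?D b))"
      by (simp add: sum_distrib_left mult.assoc)
  qed
  show ?thesis unfolding has_derivative_within_alt
  proof (intro conjI allI impI bl)
    fix \<epsilon> :: real assume \<epsilon>: "0 < \<epsilon>"
    \<comment> \<open>A linear map bounded by \<open>\<eta>\<close> on each vector of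
      \<open>B\<close> has operator norm at most \<open>\<eta> * N\<close>; the denominator
      \<open>N + 1\<close> is positive even if \<open>N = 0\<close>.\<close>
    define \<eta> where "\<eta> = \<epsilon> / (N + 1)"
    have \<eta>: "0 < \<eta>" "\<eta> * N \<le> \<epsilon>" using \<epsilon> N0 by (auto simp: \<eta>_def field_simps)
    \<comment> \<open>A Lebesgue number for the compact segment \<open>?K\<close>: one
      \<open>\<delta>\<close> controls the variation of the derivative near all its points. The
      radius \<open>2 * d\<close> and the bound \<open>\<eta> / 2\<close> leave room for the
      triangle inequality.\<close>
    have "\<exists>\<delta>>0. \<forall>z\<in>?K. \<forall>w. dist w z < \<delta> \<longrightarrow> w \<in> ball c \<rho> \<and> (\<forall>b\<in>B. norm (?D' w b - ?D' z b) < \<eta>)"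
    proof -
      have "\<exists>d>0. \<forall>w. dist w z < 2 * d \<longrightarrow> w \<in> ball c \<rho> \<and> (\<forall>b\<in>B. norm (?D' w b - ?D' z b) < \<eta> / 2)"
        if z: "z \<in> ?K" for z
      proof -
        have zb: "z \<in> ball c \<rho>" using z zin[OF y] by blast
        have "\<forall>\<^sub>F w in nhds z. w \<in> ball c \<rho> \<and> (\<forall>b\<in>B. norm (?D' w b - ?D' z b) < \<eta> / 2)"
        proof (intro eventually_conj)
          show "\<forall>\<^sub>F w in nhds z. w \<in> ball c \<rho>" using zb by (intro eventually_nhds_in_open) auto
          show "\<forall>\<^sub>F w in nhds z. \<forall>b\<in>B. norm (?D' w b - ?D' z b) < \<eta> / 2"
          proof (rule eventually_ball_finite[OF fB], rule ballI)
            fix b assume "b \<in> B"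
            have "isCont (\<lambda>z. ?D' z b) z" using cD zb by (simp add: continuous_on_eq_continuous_at)
            then have "((\<lambda>z. ?D' z b) \<longlongrightarrow> ?D' z b) (nhds z)"
              using tendsto_at_iff_tendsto_nhds[of "\<lambda>z. ?D' z b" z] by (simp add: isCont_def)
            then show "\<forall>\<^sub>F w in nhds z. norm (?D' w b - ?D' z b) < \<eta> / 2"
              using tendstoD[of "\<lambda>z. ?D' z b" "?D' z b" "nhds z" "\<eta>/2"] \<eta> by (simp add: dist_norm)
          qed
        qed
        then obtain d where d: "0 < d" "\<And>w. dist w z < d \<Longrightarrow> w \<in> ball c \<rho> \<and> (\<forall>b\<in>B. norm (?D' w b - ?D' z b) < \<eta> / 2)"
          unfolding eventually_nhds_metric by blast
        then show ?thesis by (intro exI[of _ "d/2"]) auto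
      qed
      then obtain d where d: "\<And>z. z \<in> ?K \<Longrightarrow> d z > 0"
        "\<And>z w. z \<in> ?K \<Longrightarrow> dist w z < 2 * d z \<Longrightarrow> w \<in> ball c \<rho> \<and> (\<forall>b\<in>B. norm (?D' w b - ?D' z b) < \<eta> / 2)"
        by metis
      obtain F where F: "F \<subseteq> ?K" "finite F" "?K \<subseteq> (\<Union>z\<in>F. ball z (d z))"
      proof (rule compactE_image[OF K, of ?K "\<lambda>z. ball z (d z)"])
        show "?K \<subseteq> (\<Union>z\<in>?K. ball z (d z))" using d(1) by fastforce
      qed auto
      have Fne: "F \<noteq> {}" using F(3) by auto
      define \<delta> where "\<delta> = Min (d ` F)"
      have \<delta>: "0 < \<delta>" "\<And>z. z \<in> F \<Longrightarrow> \<delta> \<le> d z" using F Fne d(1) by (auto simp: \<delta>_def)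
      have "w \<in> ball c \<rho> \<and> (\<forall>b\<in>B. norm (?D' w b - ?D' z b) < \<eta>)" if z: "z \<in> ?K" and w: "dist w z < \<delta>" for z w
      proof -
        obtain x where x: "x \<in> F" "z \<in> ball x (d x)" using F(3) z by blast
        have xK: "x \<in> ?K" using x F by blast
        have 1: "dist z x < d x" using x(2) by (simp add: dist_commute)
        then have "dist w x < 2 * d x" using w \<delta>(2)[OF x(1)] dist_triangle[of w x z] by linarith
        then have wx: "w \<in> ball c \<rho>" "\<forall>b\<in>B. norm (?D' w b - ?D' x b) < \<eta> / 2" using d(2)[OF xK] by auto
        have zx: "\<forall>b\<in>B. norm (?D' z b - ?D' x b) < \<eta> / 2" using d(2)[OF xK, of z] 1 d(1)[OF xK] by auto
        have "norm (?D' w b - ?D' z b) < \<eta>" if "b \<in> B" for b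
          using norm_triangle_ineq4[of "?D' w b - ?D' x b" "?D' z b - ?D' x b"] wx(2) zx that by fastforce
        then show ?thesis using wx(1) by blast
      qed
      then show ?thesis using \<delta>(1) by blast
    qed
    then obtain \<delta> where \<delta>: "0 < \<delta>"
      "\<And>z w. z \<in> ?K \<Longrightarrow> dist w z < \<delta> \<Longrightarrow> w \<in> ball c \<rho> \<and> (\<forall>b\<in>B. norm (?D' w b - ?D' z b) < \<eta>)" by blast
    have main: "norm (?I y' - ?I y - ?D (y' - y)) \<le> \<epsilon> * norm (y' - y)" if y': "norm (y' - y) < \<delta>" for y'
    proof -
      have yb: "y' \<in> ball c \<rho>"
      proof -
        have "y \<in> ?K" by (intro image_eqI[of _ _ 1]) auto
        then show ?thesis using \<delta>(2) y' by (simp add: dist_norm)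
      qed
      have pt: "norm (s ^ m *\<^sub>R G (?z y' s) - s ^ m *\<^sub>R G (?z y s) - s ^ Suc m *\<^sub>R ?D' (?z y s) (y' - y)) \<le> \<epsilon> * norm (y' - y)"
        if s: "s \<in> {0..1}" for s
      proof -
        let ?a = "?z y s" and ?b = "?z y' s"
        have aK: "?a \<in> ?K" using s by blast
        have ba: "?b - ?a = s *\<^sub>R (y' - y)" by (simp add: algebra_simps)
        have nba: "norm (?b - ?a) \<le> norm (y' - y)" unfolding ba using s by (simp add: mult_left_le_one_le)
        have l: "linear (?D' ?a)" using has_derivative_linear[OF dG[OF zin[OF y s]]] .
        have seg: "?a + u *\<^sub>R (?b - ?a) \<in> ball ?a \<delta>" if "u \<in> {0..1}" for u
        proof -
          have "norm (u *\<^sub>R (?b - ?a)) \<le> norm (?b - ?a)" using that by (simp add: mult_left_le_one_le)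
          then show ?thesis using nba y' by (simp add: dist_norm)
        qed
        have "norm (G ?b - G ?a - ?D' ?a (?b - ?a)) \<le> norm (?b - ?a) * \<epsilon>"
        proof (rule differentiable_bound_linearization[where S="ball ?a \<delta>" and f'="?D'" and ?x0.0="?a"])
          show "?a + u *\<^sub>R (?b - ?a) \<in> ball ?a \<delta>" if "u \<in> {0..1}" for u using seg that .
          show "(G has_derivative ?D' w) (at w within ball ?a \<delta>)" if "w \<in> ball ?a \<delta>" for w
            using dG \<delta>(2)[OF aK, of w] that by (auto intro: has_derivative_at_withinI simp: dist_commute)
          show "onorm (?D' w - ?D' ?a) \<le> \<epsilon>" if w: "w \<in> ball ?a \<delta>" for w
            unfolding fun_diff_def
          proof (rule onorm_bound)
            show "0 \<le> \<epsilon>" using \<epsilon> by simp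
            fix v
            have wb: "w \<in> ball c \<rho>" "\<forall>b\<in>B. norm (?D' w b - ?D' ?a b) < \<eta>"
              using \<delta>(2)[OF aK, of w] w by (auto simp: dist_commute)
            have lw: "linear (\<lambda>i. ?D' w i - ?D' ?a i)"
              using has_derivative_linear[OF dG[OF wb(1)]] l by (rule linear_compose_sub)
            have "norm (?D' w v - ?D' ?a v) = norm (\<Sum>b\<in>B. (v \<bullet> b) *\<^sub>R (?D' w b - ?D' ?a b))"
              using on_basis_expand[OF B lw, of v] by simp
            also have "\<dots> \<le> (\<Sum>b\<in>B. \<bar>v \<bullet> b\<bar> * norm (?D' w b - ?D' ?a b))" by (rule order_trans[OF norm_sum]) simp
            also have "\<dots> \<le> (\<Sum>b\<in>B. norm v * norm b * \<eta>)"
              using wb(2) by (intro sum_mono mult_mono Cauchy_Schwarz_ineq2) (auto intro: less_imp_le)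
            also have "\<dots> = (\<eta> * N) * norm v" by (simp add: N_def sum_distrib_left sum_distrib_right mult_ac)
            also have "\<dots> \<le> \<epsilon> * norm v" using \<eta>(2) by (simp add: mult_right_mono)
            finally show "norm (?D' w v - ?D' ?a v) \<le> \<epsilon> * norm v" .
          qed
          show "?a \<in> ball ?a \<delta>" using \<delta>(1) by simp
        qed
        then have "norm (G ?b - G ?a - s *\<^sub>R ?D' ?a (y' - y)) \<le> \<epsilon> * norm (y' - y)"
          using mult_right_mono[OF nba less_imp_le[OF \<epsilon>]] unfolding ba linear_scale[OF l] mult.commute[of \<epsilon>]
          by (rule order_trans)
        then have "s ^ m * norm (G ?b - G ?a - s *\<^sub>R ?D' ?a (y' - y)) \<le> 1 * (\<epsilon> * norm (y' - y))"
          using s by (intro mult_mono) (auto simp: power_le_one)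
        moreover have "s ^ m *\<^sub>R G ?b - s ^ m *\<^sub>R G ?a - s ^ Suc m *\<^sub>R ?D' ?a (y' - y)
            = s ^ m *\<^sub>R (G ?b - G ?a - s *\<^sub>R ?D' ?a (y' - y))"
          by (simp add: scaleR_diff_right mult.commute)
        ultimately show ?thesis using s by simp
      qed
      have i3: "(\<lambda>s. s ^ m *\<^sub>R G (?z y' s) - s ^ m *\<^sub>R G (?z y s) - s ^ Suc m *\<^sub>R ?D' (?z y s) (y' - y)) integrable_on {0..1}"
        by (intro integrable_diff int[OF cG yb] int[OF cG y] int[OF cD y])
      have "?I y' - ?I y - ?D (y' - y) =
        integral {0..1} (\<lambda>s. s ^ m *\<^sub>R G (?z y' s) - s ^ m *\<^sub>R G (?z y s) - s ^ Suc m *\<^sub>R ?D' (?z y s) (y' - y))"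
        by (simp only: integral_diff[OF int[OF cG yb] int[OF cG y]]
            integral_diff[OF integrable_diff[OF int[OF cG yb] int[OF cG y]] int[OF cD y]])
      also have "norm \<dots> \<le> integral {0..1} (\<lambda>s::real. \<epsilon> * norm (y' - y))"
        by (rule integral_norm_bound_integral[OF i3 _ pt]) auto
      finally show ?thesis by simp
    qed
    show "\<exists>d>0. \<forall>y'\<in>UNIV. norm (y' - y) < d \<longrightarrow> norm (?I y' - ?I y - ?D (y' - y)) \<le> \<epsilon> * norm (y' - y)"
      using \<delta>(1) main by blast
  qed
qed

lemma smooth_param_integral:
  fixes G :: "'e \<Rightarrow> 'b::banach"
  assumes "smooth_on (ball c \<rho>) G"
  shows "smooth_on (ball c \<rho>) (\<lambda>y. integral {0..1} (\<lambda>s. s ^ m *\<^sub>R G (c + s *\<^sub>R (y - c))))"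
proof -
  have "C_k_on k (ball c \<rho>) (\<lambda>y. integral {0..1} (\<lambda>s. s ^ m *\<^sub>R G (c + s *\<^sub>R (y - c))))" for k
    using assms
  proof (induction k arbitrary: G m)
    case 0
    have G: "C_k_on 1 (ball c \<rho>) G" using 0 unfolding smooth_on_def by blast
    show ?case unfolding C_k_on.simps
      using has_derivative_continuous[OF param_integral_has_derivative[OF G]]
      by (intro continuous_at_imp_continuous_on) blast
  next
    case (Suc k)
    have G: "C_k_on 1 (ball c \<rho>) G" using Suc.prems unfolding smooth_on_def by blast
    show ?case
      by (rule C_k_on_SucI[OF open_ball param_integral_has_derivative[OF G]], assumption)
        (rule Suc.IH[OF smooth_on_frechet[OF Suc.prems]])
  qed
  then show ?thesis by (simp add: smooth_on_def)
qed

text \<open>\<open>h b\<close> is the average of a partial derivative over the segment from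
  \<open>c\<close> to \<open>y\<close>. The formula is the fundamental theorem of calculus on that
  segment, with the direction \<open>y - c\<close> expanded along \<open>B\<close>.\<close>

lemma hadamard:
  fixes f :: "'e \<Rightarrow> 'b::banach"
  assumes f: "smooth_on (ball c \<rho>) f"
  obtains h where "\<And>b. smooth_on (ball c \<rho>) (h b)"
    "\<And>y. y \<in> ball c \<rho> \<Longrightarrow> f y = f c + (\<Sum>b\<in>B. ((y - c) \<bullet> b) *\<^sub>R h b y)"
    "\<And>b. h b c = frechet_derivative f (at c) b"
proof -
  let ?D = "\<lambda>z. frechet_derivative f (at z)"
  \<comment> \<open>The factor \<open>s ^ 0\<close> matches the shape of
    \<open>smooth_param_integral\<close>.\<close>
  define h where "h b y = integral {0..1} (\<lambda>s. s ^ 0 *\<^sub>R ?D (c + s *\<^sub>R (y - c)) b)" for b y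
  have 1: "smooth_on (ball c \<rho>) (h b)" for b
    unfolding h_def by (rule smooth_param_integral[OF smooth_on_frechet[OF f]])
  have 3: "h b c = ?D c b" for b by (simp add: h_def)
  have 2: "f y = f c + (\<Sum>b\<in>B. ((y - c) \<bullet> b) *\<^sub>R h b y)" if y: "y \<in> ball c \<rho>" for y
  proof -
    let ?z = "\<lambda>s. c + s *\<^sub>R (y - c)"
    have zin: "?z s \<in> ball c \<rho>" if "s \<in> {0..1}" for s
    proof -
      have "norm (s *\<^sub>R (y - c)) \<le> norm (y - c)" using that by (simp add: mult_left_le_one_le)
      then show ?thesis using y by (simp add: dist_norm norm_minus_commute)
    qed
    have "((\<lambda>s. f (?z s)) has_vector_derivative ?D (?z s) (y - c)) (at s within {0..1})" if "s \<in> {0..1}" for s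
    proof -
      have "((\<lambda>s. ?z s) has_derivative (\<lambda>s. s *\<^sub>R (y - c))) (at s within {0..1})"
        by (auto intro!: derivative_eq_intros)
      then have "((\<lambda>s. f (?z s)) has_derivative (\<lambda>u. ?D (?z s) (u *\<^sub>R (y - c)))) (at s within {0..1})"
        using smooth_on_has_derivative[OF f zin[OF that]] by (rule has_derivative_compose[where f="?z" and g=f])
      then show ?thesis
        using linear_scale[OF has_derivative_linear[OF smooth_on_has_derivative[OF f zin[OF that]]]]
        by (simp add: has_vector_derivative_def)
    qed
    then have "((\<lambda>s. ?D (?z s) (y - c)) has_integral f (?z 1) - f (?z 0)) {0..1}"
      by (intro fundamental_theorem_of_calculus) auto
    then have e: "f y - f c = integral {0..1} (\<lambda>s. ?D (?z s) (y - c))"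
      by (simp add: integral_unique)
    have int: "(\<lambda>s. ?D (?z s) b) integrable_on {0..1}" for b
      by (intro integrable_continuous_interval continuous_on_compose2[OF smooth_on_continuous[OF smooth_on_frechet[OF f]]])
        (auto intro!: continuous_intros zin)
    have "integral {0..1} (\<lambda>s. ?D (?z s) (y - c)) = integral {0..1} (\<lambda>s. \<Sum>b\<in>B. ((y - c) \<bullet> b) *\<^sub>R ?D (?z s) b)"
      by (intro integral_cong on_basis_expand[OF B] has_derivative_linear[OF smooth_on_has_derivative[OF f zin]])
    also have "\<dots> = (\<Sum>b\<in>B. integral {0..1} (\<lambda>s. ((y - c) \<bullet> b) *\<^sub>R ?D (?z s) b))"
      using B by (intro integral_sum integrable_cmul int) (simp add: on_basis_def)
    also have "\<dots> = (\<Sum>b\<in>B. ((y - c) \<bullet> b) *\<^sub>R h b y)" by (simp add: h_def)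
    finally show ?thesis using e by (simp add: algebra_simps)
  qed
  show ?thesis using that 1 2 3 by blast
qed

end

section \<open>Tangent vectors and left invariant vector fields\<close>

text \<open>Beyond the expansion property, orthonormality makes the partial derivatives along
  \<open>B\<close> a basis of each complexified tangent space.\<close>

locale manifold =
  fixes A :: "('m::{t2_space,second_countable_topology}, 'e::real_inner) atlas" and B :: "'e set"
  assumes sm: "smooth_manifold A" and B: "on_basis B"
    and orth: "\<And>a b. a \<in> B \<Longrightarrow> b \<in> B \<Longrightarrow> a \<bullet> b = (if a = b then 1 else 0)"
begin

lemma finB: "finite B" using B by (simp add: on_basis_def)

lemma chart_cover: "\<exists>U \<phi>. (U, \<phi>) \<in> A \<and> p \<in> U"
proof -
  have "(\<Union>(U, \<phi>)\<in>A. U) = UNIV" using sm unfolding smooth_manifold_def by (elim conjE)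
  then have "p \<in> (\<Union>(U, \<phi>)\<in>A. U)" by simp
  then show ?thesis by auto
qed

lemma
  assumes "(U, \<phi>) \<in> A"
  shows chart_open: "open U" and chart_image_open: "open (\<phi> ` U)"
    and chart_homeo: "homeomorphism U (\<phi> ` U) \<phi> (inv_into U \<phi>)"
proof -
  have "\<forall>(U, \<phi>)\<in>A. open U \<and> open (\<phi> ` U) \<and> homeomorphism U (\<phi> ` U) \<phi> (inv_into U \<phi>)"
    using sm unfolding smooth_manifold_def by (elim conjE)
  from bspec[OF this assms] show "open U" "open (\<phi> ` U)" "homeomorphism U (\<phi> ` U) \<phi> (inv_into U \<phi>)"
    by simp_all
qed

lemma chart_transition:
  assumes "(U, \<phi>) \<in> A" "(V, \<psi>) \<in> A"
  shows "smooth_on (\<phi> ` (U \<inter> V)) (\<lambda>y. \<psi> (inv_into U \<phi> y))"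
proof -
  have "\<forall>(U, \<phi>)\<in>A. \<forall>(V, \<psi>)\<in>A. smooth_on (\<phi> ` (U \<inter> V)) (\<psi> \<circ> inv_into U \<phi>)"
    using sm unfolding smooth_manifold_def by (elim conjE)
  from bspec[OF this assms(1)] assms(2) show ?thesis by (auto simp: o_def)
qed

lemma chart_inv: "(U, \<phi>) \<in> A \<Longrightarrow> m \<in> U \<Longrightarrow> inv_into U \<phi> (\<phi> m) = m"
  using chart_homeo homeomorphism_apply1 by blast

lemma chart_inv_in: "y \<in> \<phi> ` U \<Longrightarrow> inv_into U \<phi> y \<in> U"
  by (rule inv_into_into)

lemma chart_inv2: "y \<in> \<phi> ` U \<Longrightarrow> \<phi> (inv_into U \<phi> y) = y"
  by (rule f_inv_into_f)

lemma chart_image_Int_open: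
  assumes "(U, \<phi>) \<in> A" "open W"
  shows "open (\<phi> ` (U \<inter> W))"
proof -
  have "\<phi> ` (U \<inter> W) = \<phi> ` U \<inter> inv_into U \<phi> -` W"
    using chart_inv[OF assms(1)] chart_inv_in chart_inv2 by force
  then show ?thesis
    using continuous_open_preimage[OF _ chart_image_open[OF assms(1)] assms(2)] chart_homeo[OF assms(1)]
    by (simp add: homeomorphism_def)
qed

lemma chart_preimage_open:
  assumes "(U, \<phi>) \<in> A" "open S"
  shows "open (U \<inter> \<phi> -` S)"
  using continuous_open_preimage[OF _ chart_open[OF assms(1)] assms(2)] chart_homeo[OF assms(1)]
  by (simp add: homeomorphism_def)

lemma smooth_funD: "f \<in> smooth_fun A \<Longrightarrow> (U, \<phi>) \<in> A \<Longrightarrow> smooth_on (\<phi> ` U) (\<lambda>y. f (inv_into U \<phi> y))"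
  unfolding smooth_fun_def by (auto simp: o_def)

lemma smooth_funI:
  "(\<And>U \<phi>. (U, \<phi>) \<in> A \<Longrightarrow> smooth_on (\<phi> ` U) (\<lambda>y. f (inv_into U \<phi> y))) \<Longrightarrow> f \<in> smooth_fun A"
  unfolding smooth_fun_def by (auto simp: o_def)

text \<open>Transition maps are smooth, so one chart near each point suffices.\<close>

lemma smooth_funI_local:
  assumes "\<And>m. \<exists>U \<phi> W. (U, \<phi>) \<in> A \<and> open W \<and> m \<in> W \<and> W \<subseteq> U \<and> smooth_on (\<phi> ` W) (\<lambda>y. f (inv_into U \<phi> y))"
  shows "f \<in> smooth_fun A"
proof (rule smooth_funI, rule smooth_on_local)
  fix V \<psi> y assume V: "(V, \<psi>) \<in> A" and y: "y \<in> \<psi> ` V"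
  define m where "m = inv_into V \<psi> y"
  have m: "m \<in> V" "\<psi> m = y" using y by (simp_all add: m_def chart_inv_in chart_inv2)
  obtain U \<phi> W where U: "(U, \<phi>) \<in> A" "open W" "m \<in> W" "W \<subseteq> U" "smooth_on (\<phi> ` W) (\<lambda>y. f (inv_into U \<phi> y))"
    using assms[of m] by metis
  let ?T = "\<psi> ` (V \<inter> W)"
  have T: "open ?T" by (rule chart_image_Int_open[OF V U(2)])
  have tr: "smooth_on ?T (\<lambda>y. \<phi> (inv_into V \<psi> y))"
    using chart_transition[OF V U(1)] by (rule smooth_on_subset) (use U(4) in blast)
  have "smooth_on ?T (\<lambda>y. f (inv_into U \<phi> (\<phi> (inv_into V \<psi> y))))"
  proof (rule smooth_on_compose[OF B T tr U(5)])
    show "(\<lambda>y. \<phi> (inv_into V \<psi> y)) ` ?T \<subseteq> \<phi> ` W" using chart_inv[OF V] by auto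
  qed
  then have "smooth_on ?T (\<lambda>y. f (inv_into V \<psi> y))"
  proof (rule smooth_on_cong[OF T])
    fix z assume "z \<in> ?T"
    then show "f (inv_into U \<phi> (\<phi> (inv_into V \<psi> z))) = f (inv_into V \<psi> z)"
      using chart_inv[OF V] chart_inv[OF U(1)] U(4) by auto
  qed
  then show "\<exists>T. open T \<and> y \<in> T \<and> smooth_on T (\<lambda>y. f (inv_into V \<psi> y))"
    using T m U(3) by blast
qed

lemma smooth_fun_const: "(\<lambda>x. c) \<in> smooth_fun A"
  by (rule smooth_funI) (rule smooth_on_const[OF chart_image_open])

lemma smooth_fun_add: "f \<in> smooth_fun A \<Longrightarrow> g \<in> smooth_fun A \<Longrightarrow> (\<lambda>x. f x + g x) \<in> smooth_fun A"
  by (rule smooth_funI) (intro smooth_on_add chart_image_open smooth_funD)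

lemma smooth_fun_mult:
  fixes f g :: "'m \<Rightarrow> 'k::real_normed_field"
  shows "f \<in> smooth_fun A \<Longrightarrow> g \<in> smooth_fun A \<Longrightarrow> (\<lambda>x. f x * g x) \<in> smooth_fun A"
  by (rule smooth_funI) (intro smooth_on_mult chart_image_open smooth_funD)

lemma smooth_fun_linear:
  assumes "bounded_linear L" "f \<in> smooth_fun A"
  shows "(\<lambda>x. L (f x)) \<in> smooth_fun A"
proof (rule smooth_funI)
  fix U \<phi> assume U: "(U, \<phi>) \<in> A"
  show "smooth_on (\<phi> ` U) (\<lambda>y. L (f (inv_into U \<phi> y)))"
    using smooth_on_bounded_linear_comp[OF assms(1) chart_image_open[OF U] smooth_funD[OF assms(2) U]] .
qed

lemma smooth_fun_cmult:
  fixes f :: "'m \<Rightarrow> 'k::real_normed_field"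
  shows "f \<in> smooth_fun A \<Longrightarrow> (\<lambda>x. a * f x) \<in> smooth_fun A"
  by (rule smooth_fun_mult[OF smooth_fun_const])

lemma smooth_fun_diff:
  fixes f :: "'m \<Rightarrow> 'k::real_normed_field"
  shows "f \<in> smooth_fun A \<Longrightarrow> g \<in> smooth_fun A \<Longrightarrow> (\<lambda>x. f x - g x) \<in> smooth_fun A"
  using smooth_fun_add[of f "\<lambda>x. - 1 * g x"] smooth_fun_cmult[of g "- 1"] by simp

lemma smooth_fun_sum:
  fixes f :: "'i \<Rightarrow> 'm \<Rightarrow> 'k::real_normed_field"
  shows "(\<And>i. i \<in> I \<Longrightarrow> f i \<in> smooth_fun A) \<Longrightarrow> (\<lambda>x. \<Sum>i\<in>I. f i x) \<in> smooth_fun A"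
  by (induction I rule: infinite_finite_induct) (simp_all add: smooth_fun_const smooth_fun_add)

text \<open>A function of the coordinates times a bump, extended by zero. The bump has half the
  radius of the ball where \<open>g\<close> is smooth, which leaves a collar for the smooth
  extension.\<close>

definition cut :: "'m set \<Rightarrow> ('m \<Rightarrow> 'e) \<Rightarrow> 'm \<Rightarrow> real \<Rightarrow> ('e \<Rightarrow> complex) \<Rightarrow> 'm \<Rightarrow> complex" where
  "cut U \<phi> p \<rho> g = (\<lambda>m. if m \<in> U then of_real (bump (\<phi> p) (\<rho> / 2) (\<phi> m)) * g (\<phi> m) else 0)"

lemma smooth_fun_cut:
  assumes U: "(U, \<phi>) \<in> A" and p: "p \<in> U" and \<rho>: "\<rho> > 0" "ball (\<phi> p) \<rho> \<subseteq> \<phi> ` U"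
    and g: "smooth_on (ball (\<phi> p) \<rho>) g"
  shows "cut U \<phi> p \<rho> g \<in> smooth_fun A"
proof (rule smooth_funI_local)
  fix m
  show "\<exists>U' \<phi>' W. (U', \<phi>') \<in> A \<and> open W \<and> m \<in> W \<and> W \<subseteq> U' \<and> smooth_on (\<phi>' ` W) (\<lambda>y. cut U \<phi> p \<rho> g (inv_into U' \<phi>' y))"
  proof (cases "m \<in> U \<and> \<phi> m \<in> ball (\<phi> p) \<rho>")
    case True
    let ?W = "U \<inter> \<phi> -` ball (\<phi> p) \<rho>"
    have im: "\<phi> ` ?W = ball (\<phi> p) \<rho>" using \<rho>(2) by auto
    have "smooth_on (ball (\<phi> p) \<rho>) (\<lambda>y. complex_of_real (bump (\<phi> p) (\<rho> / 2) y) * g y)"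
      by (intro smooth_on_mult open_ball g smooth_on_bounded_linear_comp[OF bounded_linear_of_real]
          smooth_on_subset[OF smooth_bump]) simp
    then have "smooth_on (ball (\<phi> p) \<rho>) (\<lambda>y. cut U \<phi> p \<rho> g (inv_into U \<phi> y))"
    proof (rule smooth_on_cong[OF open_ball])
      fix y assume "y \<in> ball (\<phi> p) \<rho>"
      then have "y \<in> \<phi> ` U" using \<rho> by blast
      then show "complex_of_real (bump (\<phi> p) (\<rho> / 2) y) * g y = cut U \<phi> p \<rho> g (inv_into U \<phi> y)"
        by (simp add: cut_def chart_inv_in chart_inv2)
    qed
    then have "smooth_on (\<phi> ` ?W) (\<lambda>y. cut U \<phi> p \<rho> g (inv_into U \<phi> y))" by (simp only: im)
    moreover have "m \<in> ?W" using True by simp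
    moreover have "?W \<subseteq> U" by blast
    ultimately show ?thesis using U chart_preimage_open[OF U open_ball] by metis
  next
    case False
    \<comment> \<open>The function vanishes off this compact set, which is closed because the
      manifold is Hausdorff; the rest of a chart around \<open>m\<close> is then a neighbourhood on
      which the function is zero.\<close>
    let ?K = "inv_into U \<phi> ` cball (\<phi> p) (\<rho> / 2)"
    have cb: "cball (\<phi> p) (\<rho> / 2) \<subseteq> \<phi> ` U" using \<rho> by (auto simp: subset_iff)
    have "continuous_on (\<phi> ` U) (inv_into U \<phi>)"
      using chart_homeo[OF U] unfolding homeomorphism_def by (elim conjE)
    then have "continuous_on (cball (\<phi> p) (\<rho> / 2)) (inv_into U \<phi>)"
      using cb by (rule continuous_on_subset)
    then have "compact ?K" using compact_cball_on_basis[OF B] by (rule compact_continuous_image)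
    then have cl: "closed ?K" by (rule compact_imp_closed)
    obtain V \<psi> where V: "(V, \<psi>) \<in> A" "m \<in> V" using chart_cover by blast
    have mK: "m \<notin> ?K"
    proof
      assume "m \<in> ?K"
      then obtain y where y: "y \<in> cball (\<phi> p) (\<rho> / 2)" "m = inv_into U \<phi> y" by blast
      then have "y \<in> \<phi> ` U" using cb by blast
      then have "m \<in> U" "\<phi> m = y" using y by (simp_all add: chart_inv_in chart_inv2)
      then show False using False y \<rho> by auto
    qed
    have zero: "cut U \<phi> p \<rho> g m' = 0" if "m' \<notin> ?K" for m'
    proof (cases "m' \<in> U")
      case True
      then have "\<phi> m' \<notin> cball (\<phi> p) (\<rho> / 2)" using that chart_inv[OF U True] by (metis imageI)
      then have "bump (\<phi> p) (\<rho> / 2) (\<phi> m') = 0" using \<rho> by (intro bump_zero) auto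
      then show ?thesis by (simp add: cut_def)
    qed (simp add: cut_def)
    have op: "open (V - ?K)" using chart_open[OF V(1)] cl by (rule open_Diff)
    have "open (\<psi> ` (V \<inter> (V - ?K)))" by (rule chart_image_Int_open[OF V(1) op])
    then have op2: "open (\<psi> ` (V - ?K))" by (simp add: Int_absorb1 Int_commute)
    have "smooth_on (\<psi> ` (V - ?K)) (\<lambda>y. cut U \<phi> p \<rho> g (inv_into V \<psi> y))"
    proof (rule smooth_on_cong[OF op2 smooth_on_const[OF op2, of 0]])
      fix y assume "y \<in> \<psi> ` (V - ?K)"
      then have "inv_into V \<psi> y \<notin> ?K" using chart_inv[OF V(1)] by auto
      then show "0 = cut U \<phi> p \<rho> g (inv_into V \<psi> y)" using zero by simp
    qed
    moreover have "m \<in> V - ?K" "V - ?K \<subseteq> V" using V mK by auto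
    ultimately show ?thesis using V op by metis
  qed
qed

section \<open>Tangent vectors as combinations of partial derivatives\<close>

lemma
  fixes v :: "('m, 'k::real_normed_field) tvec"
  assumes v: "v \<in> tangent_space A p"
  shows tvec_add: "f \<in> smooth_fun A \<Longrightarrow> g \<in> smooth_fun A \<Longrightarrow> v (\<lambda>x. f x + g x) = v f + v g"
    and tvec_mult: "f \<in> smooth_fun A \<Longrightarrow> g \<in> smooth_fun A \<Longrightarrow> v (\<lambda>x. f x * g x) = v f * g p + f p * v g"
    and tvec_cmult: "f \<in> smooth_fun A \<Longrightarrow> v (\<lambda>x. a * f x) = a * v f"
    and tvec_nonsmooth: "f \<notin> smooth_fun A \<Longrightarrow> v f = 0"
  using v by (simp_all add: tangent_space_def plus_fun_def times_fun_def fscale_def)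

lemma tangent_spaceI:
  fixes v :: "('m, 'k::real_normed_field) tvec"
  assumes "\<And>f g. f \<in> smooth_fun A \<Longrightarrow> g \<in> smooth_fun A \<Longrightarrow> v (\<lambda>x. f x + g x) = v f + v g"
    and "\<And>a f. f \<in> smooth_fun A \<Longrightarrow> v (\<lambda>x. a * f x) = a * v f"
    and "\<And>f g. f \<in> smooth_fun A \<Longrightarrow> g \<in> smooth_fun A \<Longrightarrow> v (\<lambda>x. f x * g x) = v f * g p + f p * v g"
    and "\<And>f. f \<notin> smooth_fun A \<Longrightarrow> v f = 0"
  shows "v \<in> tangent_space A p"
  using assms by (simp add: tangent_space_def plus_fun_def times_fun_def fscale_def)

lemma tvec_const:
  fixes v :: "('m, 'k::real_normed_field) tvec"
  assumes v: "v \<in> tangent_space A p"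
  shows "v (\<lambda>x. c) = 0"
proof -
  have "v (\<lambda>x. 1 * 1) = v (\<lambda>x. 1) * 1 + 1 * v (\<lambda>x. 1)"
    by (rule tvec_mult[OF v smooth_fun_const smooth_fun_const])
  then have "v (\<lambda>x. 1) = 0" by simp
  then show ?thesis using tvec_cmult[OF v smooth_fun_const[of 1], of c] by simp
qed

lemma tvec_diff:
  fixes v :: "('m, 'k::real_normed_field) tvec"
  assumes v: "v \<in> tangent_space A p" and "f \<in> smooth_fun A" "g \<in> smooth_fun A"
  shows "v (\<lambda>x. f x - g x) = v f - v g"
  using tvec_add[OF v assms(2) smooth_fun_cmult[OF assms(3)], of "- 1"] tvec_cmult[OF v assms(3), of "- 1"] by simp

lemma tvec_sum:
  fixes v :: "('m, 'k::real_normed_field) tvec"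
  assumes v: "v \<in> tangent_space A p" and f: "\<And>i. i \<in> I \<Longrightarrow> f i \<in> smooth_fun A"
  shows "v (\<lambda>x. \<Sum>i\<in>I. f i x) = (\<Sum>i\<in>I. v (f i))"
  using f by (induction I rule: infinite_finite_induct)
    (simp_all add: tvec_const[OF v] tvec_add[OF v] smooth_fun_sum)

text \<open>The value 0 on non-smooth functions follows the convention for tangent vectors.\<close>

definition pd :: "'m set \<Rightarrow> ('m \<Rightarrow> 'e) \<Rightarrow> 'm \<Rightarrow> 'e \<Rightarrow> ('m, complex) tvec" where
  "pd U \<phi> p b = (\<lambda>f. if f \<in> smooth_fun A then frechet_derivative (\<lambda>y. f (inv_into U \<phi> y)) (at (\<phi> p)) b else 0)"

lemma smooth_fun_has_derivative:
  fixes f :: "'m \<Rightarrow> 'k::real_normed_field"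
  assumes "(U, \<phi>) \<in> A" "p \<in> U" "f \<in> smooth_fun A"
  shows "((\<lambda>y. f (inv_into U \<phi> y)) has_derivative frechet_derivative (\<lambda>y. f (inv_into U \<phi> y)) (at (\<phi> p))) (at (\<phi> p))"
  using smooth_on_has_derivative[OF smooth_funD[OF assms(3,1)]] assms(2) by blast

lemma pd_tangent:
  assumes U: "(U, \<phi>) \<in> A" "p \<in> U"
  shows "pd U \<phi> p b \<in> tangent_space A p"
proof (rule tangent_spaceI)
  note d = smooth_fun_has_derivative[OF U]
  fix f g :: "'m \<Rightarrow> complex" and a
  assume f: "f \<in> smooth_fun A"
  show "pd U \<phi> p b (\<lambda>x. a * f x) = a * pd U \<phi> p b f"
    using frechet_derivative_eq[OF has_derivative_mult_right[OF d[OF f], of a]] f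
    by (simp add: pd_def smooth_fun_cmult)
  assume g: "g \<in> smooth_fun A"
  show "pd U \<phi> p b (\<lambda>x. f x + g x) = pd U \<phi> p b f + pd U \<phi> p b g"
    using frechet_derivative_eq[OF has_derivative_add[OF d[OF f] d[OF g]]] f g
    by (simp add: pd_def smooth_fun_add)
  show "pd U \<phi> p b (\<lambda>x. f x * g x) = pd U \<phi> p b f * g p + f p * pd U \<phi> p b g"
    using frechet_derivative_eq[OF has_derivative_mult[OF d[OF f] d[OF g]]] f g chart_inv[OF U]
    by (simp add: pd_def smooth_fun_mult)
qed (simp add: pd_def)

text \<open>Derivations act on global functions, while Hadamard's formula holds in a chart;
  multiplied by cut-off functions it becomes an identity on the whole manifold. Applying
  \<open>v\<close> leaves only first-order terms, because the functions \<open>X b\<close> vanish at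
  \<open>p\<close>.\<close>

lemma tangent_coordinates:
  assumes U: "(U, \<phi>) \<in> A" and p: "p \<in> U"
  obtains X where "\<And>b. X b \<in> smooth_fun A"
    "\<And>v f. v \<in> tangent_space A p \<Longrightarrow> f \<in> smooth_fun A \<Longrightarrow> v f = (\<Sum>b\<in>B. v (X b) * pd U \<phi> p b f)"
    "\<And>b b'. pd U \<phi> p b' (X b) = of_real (b' \<bullet> b)"
proof -
  let ?c = "\<phi> p"
  obtain \<rho> where \<rho>: "\<rho> > 0" "ball ?c \<rho> \<subseteq> \<phi> ` U"
    using chart_image_open[OF U] p open_contains_ball[of "\<phi> ` U"] by (meson imageI)
  \<comment> \<open>Dividing by the value of the bump at its centre makes the functions
    \<open>X b\<close> dual to the partial derivatives.\<close>
  define \<beta> where "\<beta> = complex_of_real (bump ?c (\<rho> / 2) ?c)"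
  have \<beta>0: "\<beta> \<noteq> 0" using bump_centre[of "\<rho>/2" ?c] \<rho>(1) by (simp add: \<beta>_def)
  define X where "X b = cut U \<phi> p \<rho> (\<lambda>y. of_real ((y - ?c) \<bullet> b) / \<beta>)" for b
  have lin: "bounded_linear (\<lambda>x. complex_of_real x / \<beta>)"
    by (intro bounded_linear_compose[OF bounded_linear_divide bounded_linear_of_real])
  have X: "X b \<in> smooth_fun A" for b
    unfolding X_def
    by (intro smooth_fun_cut[OF U p \<rho>] smooth_on_bounded_linear_comp[OF lin] smooth_on_inner smooth_on_diff
        smooth_on_ident smooth_on_const open_ball)
  have Xp: "X b p = 0" for b by (simp add: X_def cut_def)
  have 3: "pd U \<phi> p b' (X b) = of_real (b' \<bullet> b)" for b b'
  proof -
    have bd: "(bump ?c (\<rho> / 2) has_derivative frechet_derivative (bump ?c (\<rho> / 2)) (at ?c)) (at ?c)"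
      using smooth_on_has_derivative[OF smooth_bump] by blast
    have "((\<lambda>y. complex_of_real (bump ?c (\<rho> / 2) y) * (of_real ((y - ?c) \<bullet> b) / \<beta>)) has_derivative
       (\<lambda>h. complex_of_real (bump ?c (\<rho> / 2) ?c) * (of_real (h \<bullet> b) / \<beta>) +
          of_real (frechet_derivative (bump ?c (\<rho> / 2)) (at ?c) h) * (of_real ((?c - ?c) \<bullet> b) / \<beta>))) (at ?c)"
    proof (rule has_derivative_mult)
      show "((\<lambda>y. complex_of_real (bump ?c (\<rho> / 2) y)) has_derivative
         (\<lambda>h. of_real (frechet_derivative (bump ?c (\<rho> / 2)) (at ?c) h))) (at ?c)"
        by (rule bounded_linear.has_derivative[OF bounded_linear_of_real bd])
      have "((\<lambda>y. (y - ?c) \<bullet> b) has_derivative (\<lambda>h. h \<bullet> b)) (at ?c)"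
        by (auto intro!: derivative_eq_intros)
      then show "((\<lambda>y. complex_of_real ((y - ?c) \<bullet> b) / \<beta>) has_derivative (\<lambda>h. of_real (h \<bullet> b) / \<beta>)) (at ?c)"
        by (rule bounded_linear.has_derivative[OF lin])
    qed
    then have d: "((\<lambda>y. complex_of_real (bump ?c (\<rho> / 2) y) * (of_real ((y - ?c) \<bullet> b) / \<beta>)) has_derivative
       (\<lambda>h. of_real (h \<bullet> b))) (at ?c)" using \<beta>0 by (simp flip: \<beta>_def)
    have "((\<lambda>y. X b (inv_into U \<phi> y)) has_derivative (\<lambda>h. of_real (h \<bullet> b))) (at ?c)"
      by (rule has_derivative_transform_within_open[OF d chart_image_open[OF U]])
        (use p in \<open>auto simp: X_def cut_def chart_inv[OF U]\<close>)
    then show ?thesis using X by (simp add: pd_def frechet_derivative_eq)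
  qed
  have 2: "v f = (\<Sum>b\<in>B. v (X b) * pd U \<phi> p b f)"
    if v: "v \<in> tangent_space A p" and f: "f \<in> smooth_fun A" for v and f :: "'m \<Rightarrow> complex"
  proof -
    let ?f = "\<lambda>y. f (inv_into U \<phi> y)"
    have sf: "smooth_on (ball ?c \<rho>) ?f" using smooth_on_subset[OF smooth_funD[OF f U] \<rho>(2)] .
    obtain h where h: "\<And>b. smooth_on (ball ?c \<rho>) (h b)"
      "\<And>y. y \<in> ball ?c \<rho> \<Longrightarrow> ?f y = ?f ?c + (\<Sum>b\<in>B. ((y - ?c) \<bullet> b) *\<^sub>R h b y)"
      "\<And>b. h b ?c = frechet_derivative ?f (at ?c) b"
    proof (rule hadamard[OF B sf], goal_cases)
      case (1 h)
      show ?case by (rule 1(1)[OF 1(2-4)])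
    qed
    have fp: "?f ?c = f p" using chart_inv[OF U p] by simp
    define E where "E = cut U \<phi> p \<rho> (\<lambda>y. 1)"
    define H where "H b = cut U \<phi> p \<rho> (h b)" for b
    have sE: "E \<in> smooth_fun A" unfolding E_def by (intro smooth_fun_cut[OF U p \<rho>] smooth_on_const open_ball)
    have sH: "H b \<in> smooth_fun A" for b unfolding H_def by (intro smooth_fun_cut[OF U p \<rho>] h)
    have Ep: "E p = \<beta>" using p by (simp add: E_def cut_def \<beta>_def)
    have Hp: "H b p = \<beta> * pd U \<phi> p b f" for b using p f by (simp add: H_def cut_def \<beta>_def h(3) pd_def)
    \<comment> \<open>Hadamard's formula times the square of the bump: one factor goes into
      \<open>X b\<close>, the other into \<open>H b\<close>, and outside the ball both sides
      vanish.\<close>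
    have id: "E m * E m * (f m - f p) = (\<Sum>b\<in>B. \<beta> * (X b m * H b m))" for m
    proof (cases "m \<in> U \<and> \<phi> m \<in> ball ?c \<rho>")
      case True
      let ?u = "complex_of_real (bump ?c (\<rho> / 2) (\<phi> m))"
      have "f m - f p = (\<Sum>b\<in>B. ((\<phi> m - ?c) \<bullet> b) *\<^sub>R h b (\<phi> m))"
        using h(2)[of "\<phi> m"] True fp chart_inv[OF U] by simp
      then have "E m * E m * (f m - f p) = (\<Sum>b\<in>B. ?u * ?u * (((\<phi> m - ?c) \<bullet> b) *\<^sub>R h b (\<phi> m)))"
        using True by (simp add: E_def cut_def sum_distrib_left)
      also have "\<dots> = (\<Sum>b\<in>B. \<beta> * (X b m * H b m))"
        using True \<beta>0 by (intro sum.cong) (simp_all add: X_def H_def cut_def scaleR_conv_of_real)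
      finally show ?thesis .
    next
      case False
      have "E m = 0 \<and> (\<forall>b. X b m = 0)"
      proof (cases "m \<in> U")
        case True
        then have "\<phi> m \<notin> cball ?c (\<rho> / 2)" using False \<rho>(1) by auto
        then have "bump ?c (\<rho> / 2) (\<phi> m) = 0" using \<rho>(1) by (intro bump_zero) auto
        then show ?thesis by (simp add: E_def X_def cut_def)
      qed (simp add: E_def X_def cut_def)
      then show ?thesis by simp
    qed
    have sf': "(\<lambda>m. f m - f p) \<in> smooth_fun A" by (rule smooth_fun_diff[OF f smooth_fun_const])
    have "v (\<lambda>m. E m * E m * (f m - f p)) = v (\<lambda>m. E m * E m) * (f p - f p) + E p * E p * v (\<lambda>m. f m - f p)"
      by (rule tvec_mult[OF v smooth_fun_mult[OF sE sE] sf'])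
    also have "v (\<lambda>m. f m - f p) = v f"
      using tvec_diff[OF v f smooth_fun_const] tvec_const[OF v] by simp
    finally have l: "v (\<lambda>m. E m * E m * (f m - f p)) = \<beta> * \<beta> * v f" by (simp add: Ep)
    have "v (\<lambda>m. \<Sum>b\<in>B. \<beta> * (X b m * H b m)) = (\<Sum>b\<in>B. v (\<lambda>m. \<beta> * (X b m * H b m)))"
      by (rule tvec_sum[OF v]) (intro smooth_fun_cmult smooth_fun_mult X sH)
    also have "\<dots> = (\<Sum>b\<in>B. \<beta> * (v (X b) * (\<beta> * pd U \<phi> p b f)))"
      by (intro sum.cong refl)
        (simp add: tvec_cmult[OF v] tvec_mult[OF v] smooth_fun_mult X sH Xp Hp)
    also have "\<dots> = \<beta> * \<beta> * (\<Sum>b\<in>B. v (X b) * pd U \<phi> p b f)"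
      by (simp add: sum_distrib_left mult_ac)
    finally show ?thesis using l \<beta>0 unfolding id by simp
  qed
  show ?thesis by (rule that[OF X 2 3])
qed

end

lemma sum_fun_apply: "(\<Sum>i\<in>I. f i) x = (\<Sum>i\<in>I. f i x)" for f :: "'i \<Rightarrow> 'a \<Rightarrow> 'b::comm_monoid_add"
  by (induction I rule: infinite_finite_induct) simp_all

context manifold
begin

lemma chart_inj: "(U, \<phi>) \<in> A \<Longrightarrow> inj_on \<phi> U"
  by (rule inj_on_inverseI[where g="inv_into U \<phi>"]) (rule chart_inv)

lemma vfield_smooth_app:
  assumes "smooth_vector_field A X"
  shows "(\<lambda>q. X q f) \<in> smooth_fun A"
proof (cases "f \<in> smooth_fun A")
  case False
  then have "X q f = 0" for q using assms tvec_nonsmooth unfolding smooth_vector_field_def by blast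
  then show ?thesis by (simp add: smooth_fun_const)
qed (use assms in \<open>auto simp: smooth_vector_field_def\<close>)

lemma vfield_tangent: "smooth_vector_field A X \<Longrightarrow> X p \<in> tangent_space A p"
  by (simp add: smooth_vector_field_def)

lemma tangent_add:
  fixes u v :: "('m, 'k::real_normed_field) tvec"
  assumes "u \<in> tangent_space A p" "v \<in> tangent_space A p"
  shows "u + v \<in> tangent_space A p"
  by (rule tangent_spaceI)
    (simp_all add: tvec_add[OF assms(1)] tvec_add[OF assms(2)] tvec_mult[OF assms(1)] tvec_mult[OF assms(2)]
      tvec_cmult[OF assms(1)] tvec_cmult[OF assms(2)] tvec_nonsmooth[OF assms(1)] tvec_nonsmooth[OF assms(2)] algebra_simps)

lemma tangent_scale:
  fixes v :: "('m, 'k::real_normed_field) tvec"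
  assumes "v \<in> tangent_space A p"
  shows "fscale a v \<in> tangent_space A p"
  by (rule tangent_spaceI)
    (simp_all add: fscale_def tvec_add[OF assms(1)] tvec_mult[OF assms(1)]
      tvec_cmult[OF assms(1)] tvec_nonsmooth[OF assms(1)] algebra_simps)

lemma tangent_subspace: "tvec.subspace (tangent_space A p :: ('m, 'k::real_normed_field) tvec set)"
proof (rule tvec.subspaceI)
  show "0 \<in> (tangent_space A p :: ('m, 'k) tvec set)" by (rule tangent_spaceI) simp_all
qed (simp_all add: tangent_add tangent_scale)

text \<open>In the Leibniz rule the products of first derivatives cancel between the two orders. On
  a non-smooth \<open>f\<close> each field gives the zero function, which the other one
  annihilates.\<close>

lemma bracket_smooth:
  fixes X Y :: "('m, 'k::real_normed_field) vfield"
  assumes X: "smooth_vector_field A X" and Y: "smooth_vector_field A Y"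
  shows "smooth_vector_field A (bracket X Y)"
  unfolding smooth_vector_field_def
proof (intro conjI allI ballI)
  note sX = vfield_smooth_app[OF X] and sY = vfield_smooth_app[OF Y]
  fix p
  note tX = vfield_tangent[OF X] and tY = vfield_tangent[OF Y]
  show "bracket X Y p \<in> tangent_space A p"
  proof (rule tangent_spaceI)
    fix f g :: "'m \<Rightarrow> 'k" and a
    assume f: "f \<in> smooth_fun A"
    show "bracket X Y p (\<lambda>x. a * f x) = a * bracket X Y p f"
      using f by (simp add: bracket_def tvec_cmult[OF tX] tvec_cmult[OF tY] sX sY algebra_simps)
    assume g: "g \<in> smooth_fun A"
    show "bracket X Y p (\<lambda>x. f x + g x) = bracket X Y p f + bracket X Y p g"
      using f g by (simp add: bracket_def tvec_add[OF tX] tvec_add[OF tY] sX sY algebra_simps)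
    have pr: "(\<lambda>q. X q f * g q) \<in> smooth_fun A" "(\<lambda>q. f q * X q g) \<in> smooth_fun A"
      "(\<lambda>q. Y q f * g q) \<in> smooth_fun A" "(\<lambda>q. f q * Y q g) \<in> smooth_fun A"
      using f g sX sY by (auto intro!: smooth_fun_mult)
    have "X p (\<lambda>q. Y q (\<lambda>x. f x * g x)) = X p (\<lambda>q. Y q f * g q) + X p (\<lambda>q. f q * Y q g)"
      using f g pr by (simp add: tvec_mult[OF tY] tvec_add[OF tX])
    moreover have "Y p (\<lambda>q. X q (\<lambda>x. f x * g x)) = Y p (\<lambda>q. X q f * g q) + Y p (\<lambda>q. f q * X q g)"
      using f g pr by (simp add: tvec_mult[OF tX] tvec_add[OF tY])
    ultimately show "bracket X Y p (\<lambda>x. f x * g x) = bracket X Y p f * g p + f p * bracket X Y p g"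
      using f g by (simp add: bracket_def tvec_mult[OF tX] tvec_mult[OF tY] sX sY algebra_simps)
  next
    fix f :: "'m \<Rightarrow> 'k" assume "f \<notin> smooth_fun A"
    then show "bracket X Y p f = 0"
      by (simp add: bracket_def tvec_nonsmooth[OF tX] tvec_nonsmooth[OF tY] tvec_const[OF tX] tvec_const[OF tY])
  qed
next
  fix f :: "'m \<Rightarrow> 'k" assume "f \<in> smooth_fun A"
  show "(\<lambda>p. bracket X Y p f) \<in> smooth_fun A"
    unfolding bracket_def by (intro smooth_fun_diff vfield_smooth_app X Y)
qed

text \<open>Tangent vectors are additive on smooth functions only; this is how smoothness of the
  fields enters the purely algebraic identities for brackets.\<close>

lemma bracket_jacobi:
  fixes X Y Z :: "('m, 'k::real_normed_field) vfield"
  assumes X: "smooth_vector_field A X" and Y: "smooth_vector_field A Y" and Z: "smooth_vector_field A Z"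
  shows "bracket X (bracket Y Z) = bracket (bracket X Y) Z + bracket Y (bracket X Z)"
proof (intro ext)
  fix p f
  note d = tvec_diff[OF vfield_tangent[OF X] vfield_smooth_app vfield_smooth_app]
    tvec_diff[OF vfield_tangent[OF Y] vfield_smooth_app vfield_smooth_app]
    tvec_diff[OF vfield_tangent[OF Z] vfield_smooth_app vfield_smooth_app]
  show "bracket X (bracket Y Z) p f = (bracket (bracket X Y) Z + bracket Y (bracket X Z)) p f"
    by (simp add: bracket_def d X Y Z)
qed

lemma bracket_add_left:
  fixes X Y Z :: "('m, 'k::real_normed_field) vfield"
  assumes X: "smooth_vector_field A X" and Y: "smooth_vector_field A Y" and Z: "smooth_vector_field A Z"
  shows "bracket (X + Y) Z = bracket X Z + bracket Y Z"
  by (intro ext) (simp add: bracket_def tvec_add[OF vfield_tangent[OF Z]] vfield_smooth_app X Y)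

lemma bracket_scale_left:
  fixes X Z :: "('m, 'k::real_normed_field) vfield"
  assumes X: "smooth_vector_field A X" and Z: "smooth_vector_field A Z"
  shows "bracket (vfscale a X) Z = vfscale a (bracket X Z)"
  by (intro ext) (simp add: bracket_def vfscale_def fscale_def tvec_cmult[OF vfield_tangent[OF Z]] vfield_smooth_app X algebra_simps)

lemma bracket_anti: "bracket X Y = - bracket (Y :: ('m, 'k::real_normed_field) vfield) X"
  by (intro ext) (simp add: bracket_def)

lemma bracket_add_right:
  fixes X Y Z :: "('m, 'k::real_normed_field) vfield"
  assumes X: "smooth_vector_field A X" and Y: "smooth_vector_field A Y" and Z: "smooth_vector_field A Z"
  shows "bracket Z (X + Y) = bracket Z X + bracket Z Y"
  using bracket_add_left[OF assms] by (metis bracket_anti minus_add_distrib)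

lemma bracket_scale_right:
  fixes X Z :: "('m, 'k::real_normed_field) vfield"
  assumes X: "smooth_vector_field A X" and Z: "smooth_vector_field A Z"
  shows "bracket Z (vfscale a X) = vfscale a (bracket Z X)"
  using bracket_scale_left[OF assms] by (metis bracket_anti vfield.scale_minus_right)

text \<open>By orthonormality the functions \<open>X b\<close> pair with the partial derivatives
  like a dual basis, so the complexified tangent space has dimension \<open>card B\<close>.\<close>

lemma pd_basis:
  assumes U: "(U, \<phi>) \<in> A" "p \<in> U"
  shows "tvec.span (pd U \<phi> p ` B) = tangent_space A p" "tvec.independent (pd U \<phi> p ` B)" "card (pd U \<phi> p ` B) = card B"
proof -
  obtain X where X: "\<And>b. X b \<in> smooth_fun A"
    "\<And>v f. v \<in> tangent_space A p \<Longrightarrow> f \<in> smooth_fun A \<Longrightarrow> v f = (\<Sum>b\<in>B. v (X b) * pd U \<phi> p b f)"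
    "\<And>b b'. pd U \<phi> p b' (X b) = complex_of_real (b' \<bullet> b)"
    using tangent_coordinates[OF U] by metis
  have inj: "inj_on (pd U \<phi> p) B"
  proof (rule inj_onI)
    fix a b assume ab: "a \<in> B" "b \<in> B" "pd U \<phi> p a = pd U \<phi> p b"
    then have "complex_of_real (a \<bullet> b) = complex_of_real (b \<bullet> b)" using X(3) by metis
    then show "a = b" using orth ab by (metis of_real_eq_iff zero_neq_one)
  qed
  then show "card (pd U \<phi> p ` B) = card B" by (rule card_image)
  show "tvec.span (pd U \<phi> p ` B) = tangent_space A p"
  proof
    show "tvec.span (pd U \<phi> p ` B) \<subseteq> tangent_space A p"
      using pd_tangent[OF U] by (intro tvec.span_minimal tangent_subspace) auto
    show "tangent_space A p \<subseteq> tvec.span (pd U \<phi> p ` B)"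
    proof
      fix v :: "('m, complex) tvec" assume v: "v \<in> tangent_space A p"
      have "v f = (\<Sum>b\<in>B. fscale (v (X b)) (pd U \<phi> p b)) f" for f
      proof (cases "f \<in> smooth_fun A")
        case True
        then show ?thesis using X(2)[OF v True] by (simp add: sum_fun_apply fscale_def)
      next
        case False
        then show ?thesis using tvec_nonsmooth[OF v False] by (simp add: sum_fun_apply fscale_def pd_def)
      qed
      then have "v = (\<Sum>b\<in>B. fscale (v (X b)) (pd U \<phi> p b))" by blast
      moreover have "(\<Sum>b\<in>B. fscale (v (X b)) (pd U \<phi> p b)) \<in> tvec.span (pd U \<phi> p ` B)"
        by (intro tvec.span_sum tvec.span_scale tvec.span_base) blast
      ultimately show "v \<in> tvec.span (pd U \<phi> p ` B)" by metis
    qed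
  qed
  show "tvec.independent (pd U \<phi> p ` B)"
  proof -
    have fin: "finite (pd U \<phi> p ` B)" using finB by simp
    have "f x = 0" if e: "(\<Sum>w\<in>pd U \<phi> p ` B. fscale (f w) w) = 0" and x: "x \<in> pd U \<phi> p ` B" for f x
    proof -
    obtain b where b: "b \<in> B" "x = pd U \<phi> p b" using x by blast
    have "(\<Sum>w\<in>pd U \<phi> p ` B. fscale (f w) w) (X b) = (\<Sum>a\<in>B. f (pd U \<phi> p a) * complex_of_real (a \<bullet> b))"
      by (simp add: sum_fun_apply fscale_def sum.reindex[OF inj] X(3))
    also have "\<dots> = (\<Sum>a\<in>B. if a = b then f (pd U \<phi> p a) else 0)"
      using b by (intro sum.cong) (simp_all add: orth)
    also have "\<dots> = f x" using b finB by simp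
    finally have "(\<Sum>w\<in>pd U \<phi> p ` B. fscale (f w) w) (X b) = f x" .
    then show "f x = 0" unfolding e by simp
    qed
    then show ?thesis unfolding tvec.dependent_finite[OF fin] by blast
  qed
qed

end

section \<open>Left translation and left invariant complex fields\<close>

locale lie = manifold A B for A :: "('m::{t2_space,second_countable_topology}, 'e::real_inner) atlas" and B +
  fixes mul :: "'m \<Rightarrow> 'm \<Rightarrow> 'm" and e :: 'm and iv :: "'m \<Rightarrow> 'm"
  assumes lg: "lie_group A mul e iv"
begin

sublocale grp: group mul e iv
  using lg by (simp add: lie_group_def)

text \<open>Needed for the chain rule through pairs of coordinates, as multiplication is smooth on
  the product manifold.\<close>

lemma prod_on_basis: "on_basis ((\<lambda>b. (b, 0)) ` B \<union> (\<lambda>b. (0, b)) ` B :: ('e \<times> 'e) set)"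
proof -
  have nz: "b \<noteq> 0" if "b \<in> B" for b using orth[OF that that] by auto
  have dj: "(\<lambda>b. (b, 0)) ` B \<inter> (\<lambda>b. (0, b)) ` B = ({} :: ('e \<times> 'e) set)" using nz by auto
  have ex: "z = (\<Sum>b\<in>B. (z \<bullet> b) *\<^sub>R b)" for z using B by (simp add: on_basis_def)
  have "x = (\<Sum>b\<in>(\<lambda>b. (b, 0)) ` B \<union> (\<lambda>b. (0, b)) ` B. (x \<bullet> b) *\<^sub>R b)" for x :: "'e \<times> 'e"
  proof -
    have "(\<Sum>b\<in>(\<lambda>b. (b, 0)) ` B \<union> (\<lambda>b. (0, b)) ` B. (x \<bullet> b) *\<^sub>R b)
      = (\<Sum>b\<in>B. (x \<bullet> (b, 0)) *\<^sub>R (b, 0)) + (\<Sum>b\<in>B. (x \<bullet> (0, b)) *\<^sub>R (0, b))"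
      using finB dj by (simp add: sum.union_disjoint sum.reindex inj_on_def)
    also have "\<dots> = (\<Sum>b\<in>B. (fst x \<bullet> b) *\<^sub>R b, \<Sum>b\<in>B. (snd x \<bullet> b) *\<^sub>R b)"
      by (simp add: inner_prod_def sum_prod)
    also have "\<dots> = x" by (simp flip: ex)
    finally show ?thesis by simp
  qed
  then show ?thesis using finB by (simp add: on_basis_def)
qed

lemma mul_continuous: "continuous_on UNIV (\<lambda>(x, y). mul x y)"
  using lg by (simp add: lie_group_def smooth_map_def)

text \<open>Unpacks smoothness of the multiplication from the product atlas: on the image of a
  product chart, \<open>inv_into\<close> of \<open>map_prod\<close> is the pair of the two
  inverses.\<close>

lemma mul_chart:
  assumes U: "(U, \<phi>) \<in> A" and V: "(V, \<psi>) \<in> A" and W: "(W, \<xi>) \<in> A"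
  defines "Q \<equiv> {zy \<in> \<phi> ` U \<times> \<psi> ` V. mul (inv_into U \<phi> (fst zy)) (inv_into V \<psi> (snd zy)) \<in> W}"
  shows "open Q" "smooth_on Q (\<lambda>zy. \<xi> (mul (inv_into U \<phi> (fst zy)) (inv_into V \<psi> (snd zy))))"
proof -
  let ?q = "\<lambda>zy. mul (inv_into U \<phi> (fst zy)) (inv_into V \<psi> (snd zy))"
  have c1: "continuous_on (\<phi> ` U) (inv_into U \<phi>)" using chart_homeo[OF U] unfolding homeomorphism_def by (elim conjE)
  have c2: "continuous_on (\<psi> ` V) (inv_into V \<psi>)" using chart_homeo[OF V] unfolding homeomorphism_def by (elim conjE)
  have f1: "continuous_on (\<phi> ` U \<times> \<psi> ` V) (\<lambda>zy. inv_into U \<phi> (fst zy))"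
    by (rule continuous_on_compose2[OF c1 continuous_on_fst[OF continuous_on_id]]) auto
  have f2: "continuous_on (\<phi> ` U \<times> \<psi> ` V) (\<lambda>zy. inv_into V \<psi> (snd zy))"
    by (rule continuous_on_compose2[OF c2 continuous_on_snd[OF continuous_on_id]]) auto
  have "continuous_on (\<phi> ` U \<times> \<psi> ` V) (\<lambda>zy. (\<lambda>(x, y). mul x y) (inv_into U \<phi> (fst zy), inv_into V \<psi> (snd zy)))"
    by (rule continuous_on_compose2[OF mul_continuous continuous_on_Pair[OF f1 f2]]) auto
  then have cq: "continuous_on (\<phi> ` U \<times> \<psi> ` V) ?q" by simp
  have "open ((\<phi> ` U \<times> \<psi> ` V) \<inter> ?q -` W)"
    by (rule continuous_open_preimage[OF cq open_Times[OF chart_image_open[OF U] chart_image_open[OF V]] chart_open[OF W]])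
  moreover have "(\<phi> ` U \<times> \<psi> ` V) \<inter> ?q -` W = Q" by (auto simp: Q_def)
  ultimately show oQ: "open Q" by simp
  have inj: "inj_on (map_prod \<phi> \<psi>) (U \<times> V)"
    by (rule map_prod_inj_on[OF chart_inj[OF U] chart_inj[OF V]])
  have iv: "inv_into (U \<times> V) (map_prod \<phi> \<psi>) zy = (inv_into U \<phi> (fst zy), inv_into V \<psi> (snd zy))"
    if "zy \<in> \<phi> ` U \<times> \<psi> ` V" for zy
  proof (rule inv_into_f_eq[OF inj])
    show "(inv_into U \<phi> (fst zy), inv_into V \<psi> (snd zy)) \<in> U \<times> V" using that by (auto simp: inv_into_into)
    show "map_prod \<phi> \<psi> (inv_into U \<phi> (fst zy), inv_into V \<psi> (snd zy)) = zy" using that by (auto simp: f_inv_into_f)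
  qed
  have Qe: "map_prod \<phi> \<psi> ` (U \<times> V \<inter> (\<lambda>(x, y). mul x y) -` W) = Q"
  proof (intro equalityI subsetI)
    fix zy assume "zy \<in> map_prod \<phi> \<psi> ` (U \<times> V \<inter> (\<lambda>(x, y). mul x y) -` W)"
    then show "zy \<in> Q" using chart_inv[OF U] chart_inv[OF V] by (auto simp: Q_def)
  next
    fix zy assume zy: "zy \<in> Q"
    then have m: "(inv_into U \<phi> (fst zy), inv_into V \<psi> (snd zy)) \<in> U \<times> V \<inter> (\<lambda>(x, y). mul x y) -` W"
      by (auto simp: Q_def inv_into_into)
    have "map_prod \<phi> \<psi> (inv_into U \<phi> (fst zy), inv_into V \<psi> (snd zy)) = zy"
      using zy by (auto simp: Q_def f_inv_into_f)
    then show "zy \<in> map_prod \<phi> \<psi> ` (U \<times> V \<inter> (\<lambda>(x, y). mul x y) -` W)" using m by (metis imageI)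
  qed
  have "smooth_map (prod_atlas A A) A (\<lambda>(x, y). mul x y)" using lg by (simp add: lie_group_def)
  then have sm: "\<forall>(U, \<phi>)\<in>prod_atlas A A. \<forall>(V, \<psi>)\<in>A. smooth_on (\<phi> ` (U \<inter> (\<lambda>(x, y). mul x y) -` V)) (\<psi> \<circ> (\<lambda>(x, y). mul x y) \<circ> inv_into U \<phi>)"
    by (simp add: smooth_map_def)
  have "(U \<times> V, map_prod \<phi> \<psi>) \<in> prod_atlas A A" unfolding prod_atlas_def using U V by blast
  from bspec[OF sm this] W have "smooth_on Q (\<xi> \<circ> (\<lambda>(x, y). mul x y) \<circ> inv_into (U \<times> V) (map_prod \<phi> \<psi>))"
    unfolding Qe[symmetric] by auto
  then show "smooth_on Q (\<lambda>zy. \<xi> (?q zy))"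
    by (rule smooth_on_cong[OF oQ]) (use iv in \<open>auto simp: Q_def\<close>)
qed

lemma smooth_mul_fun:
  assumes U: "(U, \<phi>) \<in> A" and V: "(V, \<psi>) \<in> A" and f: "f \<in> smooth_fun A"
  shows "smooth_on (\<phi> ` U \<times> \<psi> ` V) (\<lambda>zy. f (mul (inv_into U \<phi> (fst zy)) (inv_into V \<psi> (snd zy))))"
proof (rule smooth_on_local)
  let ?q = "\<lambda>zy. mul (inv_into U \<phi> (fst zy)) (inv_into V \<psi> (snd zy))"
  fix x assume x: "x \<in> \<phi> ` U \<times> \<psi> ` V"
  obtain W \<xi> where W: "(W, \<xi>) \<in> A" "?q x \<in> W" using chart_cover by blast
  let ?Q = "{zy \<in> \<phi> ` U \<times> \<psi> ` V. ?q zy \<in> W}"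
  note Q = mul_chart[OF U V W(1)]
  have "smooth_on ?Q (\<lambda>zy. f (inv_into W \<xi> (\<xi> (?q zy))))"
    by (rule smooth_on_compose[OF B Q smooth_funD[OF f W(1)]]) auto
  then have "smooth_on ?Q (\<lambda>zy. f (?q zy))"
    by (rule smooth_on_cong[OF Q(1)]) (simp add: chart_inv[OF W(1)])
  moreover have "x \<in> ?Q" using x W(2) by simp
  ultimately show "\<exists>T. open T \<and> x \<in> T \<and> smooth_on T (\<lambda>zy. f (?q zy))"
    using Q(1) by (intro exI[of _ ?Q] conjI)
qed

lemma smooth_fun_left:
  assumes f: "f \<in> smooth_fun A"
  shows "(\<lambda>x. f (mul g x)) \<in> smooth_fun A"
proof (rule smooth_funI)
  fix V \<psi> assume V: "(V, \<psi>) \<in> A"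
  obtain U \<phi> where U: "(U, \<phi>) \<in> A" "g \<in> U" using chart_cover by blast
  have o: "open (\<psi> ` V)" by (rule chart_image_open[OF V])
  have "smooth_on (\<psi> ` V) (\<lambda>y. f (mul (inv_into U \<phi> (fst (\<phi> g, y))) (inv_into V \<psi> (snd (\<phi> g, y)))))"
    by (rule smooth_on_compose[OF prod_on_basis o smooth_on_Pair[OF o smooth_on_const[OF o] smooth_on_ident[OF o]]
          smooth_mul_fun[OF U(1) V f]]) (use U in auto)
  then show "smooth_on (\<psi> ` V) (\<lambda>y. f (mul g (inv_into V \<psi> y)))" by (simp add: chart_inv[OF U])
qed

text \<open>Translation by \<open>iv g\<close> undoes translation by \<open>g\<close>. The
  equivalence makes the value 0 on non-smooth functions compatible with translation.\<close>

lemma smooth_fun_left_iff: "(\<lambda>x. f (mul g x)) \<in> smooth_fun A \<longleftrightarrow> f \<in> smooth_fun A"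
proof
  assume "(\<lambda>x. f (mul g x)) \<in> smooth_fun A"
  then have "(\<lambda>x. f (mul g (mul (iv g) x))) \<in> smooth_fun A" by (rule smooth_fun_left)
  then show "f \<in> smooth_fun A" by (simp add: grp.right_inverse flip: grp.assoc)
qed (rule smooth_fun_left)

lemma smooth_map_left: "smooth_map A A (mul g)"
  unfolding smooth_map_def
proof (intro conjI ballI, safe)
  have "continuous_on UNIV (\<lambda>x. (\<lambda>(x, y). mul x y) (g, x))"
    by (rule continuous_on_compose2[OF mul_continuous]) (auto intro!: continuous_intros)
  then show c: "continuous_on UNIV (mul g)" by simp
  fix V \<psi> W \<xi> assume V: "(V, \<psi>) \<in> A" and W: "(W, \<xi>) \<in> A"
  obtain U \<phi> where U: "(U, \<phi>) \<in> A" "g \<in> U" using chart_cover by blast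
  have "open (mul g -` W)" using c chart_open[OF W] by (simp add: continuous_on_open_vimage)
  then have o: "open (\<psi> ` (V \<inter> mul g -` W))" by (rule chart_image_Int_open[OF V])
  have "smooth_on (\<psi> ` (V \<inter> mul g -` W))
     (\<lambda>y. \<xi> (mul (inv_into U \<phi> (fst (\<phi> g, y))) (inv_into V \<psi> (snd (\<phi> g, y)))))"
    by (rule smooth_on_compose[OF prod_on_basis o smooth_on_Pair[OF o smooth_on_const[OF o] smooth_on_ident[OF o]]
          mul_chart(2)[OF U(1) V W]]) (use U in \<open>auto simp: chart_inv[OF U] chart_inv[OF V]\<close>)
  then show "smooth_on (\<psi> ` (V \<inter> mul g -` W)) (\<xi> \<circ> mul g \<circ> inv_into V \<psi>)"
    by (simp add: chart_inv[OF U] o_def)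
qed

text \<open>The left invariant field through \<open>v\<close>: its value at \<open>p\<close> is the
  differential of translation by \<open>p\<close> applied to \<open>v\<close>.\<close>

definition transl :: "('m, complex) tvec \<Rightarrow> ('m, complex) vfield" where
  "transl v = (\<lambda>p f. v (\<lambda>x. f (mul p x)))"

text \<open>At \<open>e\<close> the vector \<open>v\<close> is a combination of partial derivatives,
  so the function of \<open>p\<close> is a combination of partial derivatives of the jointly smooth
  \<open>f (p x)\<close> in the second variable, taken at \<open>x = e\<close>.\<close>

lemma smooth_transl:
  assumes v: "v \<in> tangent_space A e" and f: "f \<in> smooth_fun A"
  shows "(\<lambda>p. transl v p f) \<in> smooth_fun A"
proof (rule smooth_funI)
  fix U \<phi> assume U: "(U, \<phi>) \<in> A"
  obtain V \<psi> where V: "(V, \<psi>) \<in> A" "e \<in> V" using chart_cover by blast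
  obtain X where "\<And>b. X b \<in> smooth_fun A"
    and X: "\<And>v f. v \<in> tangent_space A e \<Longrightarrow> f \<in> smooth_fun A \<Longrightarrow> v f = (\<Sum>b\<in>B. v (X b) * pd V \<psi> e b f)"
    and "\<And>b b'. pd V \<psi> e b' (X b) = complex_of_real (b' \<bullet> b)"
    using tangent_coordinates[OF V] by metis
  let ?F = "\<lambda>zy. f (mul (inv_into U \<phi> (fst zy)) (inv_into V \<psi> (snd zy)))"
  have F: "smooth_on (\<phi> ` U \<times> \<psi> ` V) ?F" by (rule smooth_mul_fun[OF U V(1) f])
  have o: "open (\<phi> ` U)" by (rule chart_image_open[OF U])
  have pdF: "pd V \<psi> e b (\<lambda>x. f (mul (inv_into U \<phi> z) x)) = frechet_derivative ?F (at (z, \<psi> e)) (0, b)"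
    if z: "z \<in> \<phi> ` U" for z b
  proof -
    have "(?F has_derivative frechet_derivative ?F (at (z, \<psi> e))) (at (z, \<psi> e))"
      by (rule smooth_on_has_derivative[OF F]) (use z V in auto)
    moreover have "((\<lambda>y. (z, y)) has_derivative (\<lambda>h. (0, h))) (at (\<psi> e))"
      by (auto intro!: derivative_eq_intros)
    ultimately have "((\<lambda>y. ?F (z, y)) has_derivative (\<lambda>h. frechet_derivative ?F (at (z, \<psi> e)) (0, h))) (at (\<psi> e))"
      by (rule has_derivative_compose[where f="\<lambda>y. (z, y)", rotated])
    then have d: "((\<lambda>y. f (mul (inv_into U \<phi> z) (inv_into V \<psi> y))) has_derivative
        (\<lambda>h. frechet_derivative ?F (at (z, \<psi> e)) (0, h))) (at (\<psi> e))" by simp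
    show ?thesis using smooth_fun_left[OF f] by (simp add: pd_def frechet_derivative_eq[OF d])
  qed
  have "smooth_on (\<phi> ` U) (\<lambda>z. \<Sum>b\<in>B. v (X b) * frechet_derivative ?F (at (z, \<psi> e)) (0, b))"
  proof (intro smooth_on_sum smooth_on_mult smooth_on_const o)
    fix b
    show "smooth_on (\<phi> ` U) (\<lambda>z. frechet_derivative ?F (at (z, \<psi> e)) (0, b))"
      by (rule smooth_on_compose[OF prod_on_basis o smooth_on_Pair[OF o smooth_on_ident[OF o] smooth_on_const[OF o]]
            smooth_on_frechet[OF F]]) (use V in auto)
  qed
  then show "smooth_on (\<phi> ` U) (\<lambda>z. transl v (inv_into U \<phi> z) f)"
    by (rule smooth_on_cong[OF o]) (simp add: transl_def X[OF v smooth_fun_left[OF f]] pdF)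
qed

lemma transl_tangent:
  assumes v: "v \<in> tangent_space A e"
  shows "transl v p \<in> tangent_space A p"
  by (rule tangent_spaceI)
    (simp_all add: transl_def tvec_add[OF v] tvec_mult[OF v] tvec_cmult[OF v] tvec_nonsmooth[OF v]
      smooth_fun_left smooth_fun_left_iff)

text \<open>The complexified Lie algebra.\<close>

definition LC :: "('m, complex) vfield set" where
  "LC = {X. smooth_vector_field A X \<and> (\<forall>g p. differential A (mul g) (X p) = X (mul g p))}"

lemma LC_smooth: "X \<in> LC \<Longrightarrow> smooth_vector_field A X" by (simp add: LC_def)

lemma LC_left: "X \<in> LC \<Longrightarrow> X (mul g p) f = X p (\<lambda>x. f (mul g x))"
proof -
  assume X: "X \<in> LC"
  then have "X (mul g p) f = differential A (mul g) (X p) f" by (simp add: LC_def)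
  also have "\<dots> = X p (\<lambda>x. f (mul g x))"
    using tvec_nonsmooth[OF vfield_tangent[OF LC_smooth[OF X]]] smooth_fun_left_iff[of f g]
    by (auto simp: differential_def o_def)
  finally show ?thesis .
qed

lemma LC_I:
  assumes "smooth_vector_field A X" "\<And>g p f. f \<in> smooth_fun A \<Longrightarrow> X (mul g p) f = X p (\<lambda>x. f (mul g x))"
  shows "X \<in> LC"
  unfolding LC_def
proof (intro CollectI conjI allI assms(1) ext)
  fix g p f
  show "differential A (mul g) (X p) f = X (mul g p) f"
    using assms tvec_nonsmooth[OF vfield_tangent[OF assms(1)]] by (auto simp: differential_def o_def)
qed

lemma transl_LC:
  assumes v: "v \<in> tangent_space A e"
  shows "transl v \<in> LC"
  by (rule LC_I) (auto simp: smooth_vector_field_def transl_tangent[OF v] smooth_transl[OF v], simp add: transl_def grp.assoc)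

lemma LC_transl: "X \<in> LC \<Longrightarrow> X = transl (X e)"
proof (intro ext)
  fix p f assume "X \<in> LC"
  then show "X p f = transl (X e) p f" using LC_left[of X p e f] by (simp add: transl_def)
qed

lemma transl_e: "transl v e = v"
  by (simp add: transl_def)

lemma LC_image: "LC = transl ` tangent_space A e"
proof (intro equalityI subsetI)
  fix X assume "X \<in> LC"
  then show "X \<in> transl ` tangent_space A e"
    using LC_transl[of X] vfield_tangent[OF LC_smooth, of X e] by (rule_tac image_eqI)
next
  fix X assume "X \<in> transl ` tangent_space A e"
  then show "X \<in> LC" using transl_LC by (elim imageE) simp
qed

lemma transl_linear: "Vector_Spaces.linear fscale vfscale transl"
  by unfold_locales (simp_all add: transl_def fscale_def vfscale_def fun_eq_iff)

text \<open>Translation is a linear bijection from the tangent space at \<open>e\<close> onto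
  \<open>LC\<close>, inverted by evaluation at \<open>e\<close>.\<close>

lemma LC_basis: "\<exists>C. vfield.independent C \<and> finite C \<and> vfield.span C = LC \<and> card C = card B"
proof -
  interpret T: Vector_Spaces.linear fscale vfscale transl by (rule transl_linear)
  obtain V \<psi> where V: "(V, \<psi>) \<in> A" "e \<in> V" using chart_cover by blast
  let ?D = "pd V \<psi> e ` B"
  note D = pd_basis[OF V]
  have inj: "inj transl" by (metis injI transl_e)
  have "vfield.independent (transl ` ?D)"
    by (rule T.independent_injective_image[OF D(2)]) (rule inj_on_subset[OF inj subset_UNIV])
  moreover have "vfield.span (transl ` ?D) = LC" using T.span_image[of ?D] D(1) LC_image by simp
  moreover have "card (transl ` ?D) = card B" using D(3) card_image[OF inj_on_subset[OF inj subset_UNIV], of ?D] by simp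
  ultimately show ?thesis using finB by blast
qed

lemma LC_bracket:
  assumes X: "X \<in> LC" and Y: "Y \<in> LC"
  shows "bracket X Y \<in> LC"
  by (rule LC_I[OF bracket_smooth[OF LC_smooth[OF X] LC_smooth[OF Y]]])
    (simp add: bracket_def LC_left[OF X] LC_left[OF Y])

end

section \<open>Conjugation of fields and comparison with the real Lie algebra\<close>

definition conj_vfield :: "('m, complex) vfield \<Rightarrow> ('m, complex) vfield" where
  "conj_vfield X = (\<lambda>p. conj_tvec (X p))"

lemma conj_vfield_add: "conj_vfield (X + Y) = conj_vfield X + conj_vfield Y"
  by (intro ext) (simp add: conj_vfield_def conj_tvec_def)

lemma conj_vfield_scale: "conj_vfield (vfscale c X) = vfscale (cnj c) (conj_vfield X)"
  by (intro ext) (simp add: conj_vfield_def conj_tvec_def vfscale_def fscale_def)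

lemma conj_vfield_conj: "conj_vfield (conj_vfield X) = X"
  by (intro ext) (simp add: conj_vfield_def conj_tvec_def o_def)

lemma conj_vfield_bracket: "conj_vfield (bracket X Y) = bracket (conj_vfield X) (conj_vfield Y)"
  by (intro ext) (simp add: conj_vfield_def conj_tvec_def bracket_def o_def)

context lie
begin

lemma LC_subspace: "vfield.subspace LC"
  using LC_basis vfield.subspace_span by metis

lemma smooth_fun_cnj_iff: "(\<lambda>x. cnj (f x)) \<in> smooth_fun A \<longleftrightarrow> f \<in> smooth_fun A"
proof
  assume "(\<lambda>x. cnj (f x)) \<in> smooth_fun A"
  from smooth_fun_linear[OF bounded_linear_cnj this] show "f \<in> smooth_fun A" by simp
qed (rule smooth_fun_linear[OF bounded_linear_cnj])

lemma conj_vfield_smooth: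
  assumes X: "smooth_vector_field A X"
  shows "smooth_vector_field A (conj_vfield X)"
  unfolding smooth_vector_field_def
proof (intro conjI allI ballI)
  fix p
  note t = vfield_tangent[OF X, of p]
  show "conj_vfield X p \<in> tangent_space A p"
    by (rule tangent_spaceI)
      (simp_all add: conj_vfield_def conj_tvec_def o_def tvec_add[OF t] tvec_cmult[OF t] tvec_mult[OF t]
        smooth_fun_cnj_iff tvec_nonsmooth[OF t])
next
  fix f :: "'m \<Rightarrow> complex"
  show "(\<lambda>p. conj_vfield X p f) \<in> smooth_fun A"
    unfolding conj_vfield_def conj_tvec_def
    by (rule smooth_fun_linear[OF bounded_linear_cnj vfield_smooth_app[OF X]])
qed

lemma conj_vfield_LC:
  assumes "X \<in> LC"
  shows "conj_vfield X \<in> LC"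
  by (rule LC_I[OF conj_vfield_smooth[OF LC_smooth[OF assms]]])
    (simp add: conj_vfield_def conj_tvec_def o_def LC_left[OF assms])

definition LC0 :: "('m, complex) vfield set" where
  "LC0 = {X \<in> LC. conj_vfield X = X}"

text \<open>The real fields span \<open>LC\<close> over the complex numbers, each \<open>X\<close>
  being \<open>a + i b\<close> with real \<open>a\<close> and \<open>b\<close>; a maximal
  independent set of real fields is therefore a basis.\<close>

lemma ex_real_basis:
  "\<exists>RB. vfield.independent RB \<and> finite RB \<and> vfield.span RB = LC \<and> card RB = card B \<and> RB \<subseteq> LC0"
proof -
  obtain C where C: "vfield.independent C" "finite C" "vfield.span C = LC" "card C = card B"
    using LC_basis by blast
  obtain RB where RB: "RB \<subseteq> LC0" "vfield.independent RB" "LC0 \<subseteq> vfield.span RB"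
    using vfield.maximal_independent_subset[of LC0] by blast
  have "LC \<subseteq> vfield.span RB"
  proof
    fix X assume X: "X \<in> LC"
    define a where "a = vfscale (1/2) (X + conj_vfield X)"
    define b where "b = vfscale (- \<i> / 2) (X - conj_vfield X)"
    have ab: "a \<in> LC" "b \<in> LC" unfolding a_def b_def
      by (intro vfield.subspace_scale[OF LC_subspace] vfield.subspace_add[OF LC_subspace]
          vfield.subspace_diff[OF LC_subspace] X conj_vfield_LC[OF X])+
    have cd: "conj_vfield (X - Y) = conj_vfield X - conj_vfield Y" for X Y :: "('m, complex) vfield"
      by (intro ext) (simp add: conj_vfield_def conj_tvec_def)
    have "conj_vfield a = a"
      by (simp add: a_def conj_vfield_scale conj_vfield_add conj_vfield_conj add.commute)
    moreover have "conj_vfield b = b"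
    proof (intro ext)
      fix p f
      show "conj_vfield b p f = b p f"
        unfolding b_def conj_vfield_scale cd conj_vfield_conj by (simp add: vfscale_def fscale_def field_simps)
    qed
    ultimately have "a \<in> vfield.span RB" "b \<in> vfield.span RB" using ab RB(3) by (auto simp: LC0_def)
    then have "a + vfscale \<i> b \<in> vfield.span RB" by (intro vfield.span_add vfield.span_scale)
    moreover have "a + vfscale \<i> b = X"
      by (intro ext) (simp add: a_def b_def vfscale_def fscale_def field_simps)
    ultimately show "X \<in> vfield.span RB" by simp
  qed
  moreover have "vfield.span RB \<subseteq> LC" using RB(1) by (intro vfield.span_minimal LC_subspace) (auto simp: LC0_def)
  ultimately have sp: "vfield.span RB = LC" by (rule equalityI[rotated])
  have "RB \<subseteq> vfield.span C" using sp C(3) vfield.span_superset by metis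
  then have "finite RB" using vfield.independent_span_bound[OF C(2) RB(2)] by blast
  moreover have "card RB = card C"
    using vfield.dim_span_eq_card_independent[OF RB(2)] vfield.dim_span_eq_card_independent[OF C(1)] sp C(3) by simp
  ultimately show ?thesis using RB sp C(4) by (intro exI[of _ RB] conjI) simp_all
qed

text \<open>On fields fixed by conjugation the value at a real function is already real, and
  \<open>rho\<close> identifies these fields with the real Lie algebra of the group.\<close>

definition rho :: "('m, complex) vfield \<Rightarrow> ('m, real) vfield" where
  "rho X = (\<lambda>p f. Re (X p (\<lambda>x. of_real (f x))))"

lemma smooth_fun_of_real_iff:
  "(\<lambda>x. complex_of_real (f x)) \<in> smooth_fun A \<longleftrightarrow> f \<in> smooth_fun A"
proof
  assume "(\<lambda>x. complex_of_real (f x)) \<in> smooth_fun A"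
  from smooth_fun_linear[OF bounded_linear_Re this] show "f \<in> smooth_fun A" by simp
qed (rule smooth_fun_linear[OF bounded_linear_of_real])

lemma lie_algebra_I:
  assumes "smooth_vector_field A X" "\<And>g p f. f \<in> smooth_fun A \<Longrightarrow> X (mul g p) f = X p (\<lambda>x. f (mul g x))"
  shows "X \<in> lie_algebra_of A mul"
  unfolding lie_algebra_of_def
proof (intro CollectI conjI allI assms(1) ext)
  fix g p f
  show "differential A (mul g) (X p) f = X (mul g p) f"
    using assms tvec_nonsmooth[OF vfield_tangent[OF assms(1)]] by (auto simp: differential_def o_def)
qed

lemma rho_lie_algebra:
  assumes X: "X \<in> LC"
  shows "rho X \<in> lie_algebra_of A mul"
proof (rule lie_algebra_I)
  show "smooth_vector_field A (rho X)"
    unfolding smooth_vector_field_def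
  proof (intro conjI allI ballI)
    fix p
    note t = vfield_tangent[OF LC_smooth[OF X], of p]
    show "rho X p \<in> tangent_space A p"
      by (rule tangent_spaceI)
        (simp_all add: rho_def tvec_add[OF t] tvec_cmult[OF t] tvec_mult[OF t]
          smooth_fun_of_real_iff tvec_nonsmooth[OF t])
  next
    fix f :: "'m \<Rightarrow> real"
    show "(\<lambda>p. rho X p f) \<in> smooth_fun A"
      unfolding rho_def by (rule smooth_fun_linear[OF bounded_linear_Re vfield_smooth_app[OF LC_smooth[OF X]]])
  qed
  show "rho X (mul g p) f = rho X p (\<lambda>x. f (mul g x))" for g p f
    by (simp add: rho_def LC_left[OF X])
qed

lemma rho_surj:
  assumes Y: "Y \<in> lie_algebra_of A mul"
  shows "\<exists>X\<in>LC0. rho X = Y"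
proof -
  have Ys: "smooth_vector_field A Y" using Y by (simp add: lie_algebra_of_def)
  have Yl: "Y (mul g p) f = Y p (\<lambda>x. f (mul g x))" if "f \<in> smooth_fun A" for g p f
  proof -
    have "Y (mul g p) f = differential A (mul g) (Y p) f" using Y by (simp add: lie_algebra_of_def)
    then show ?thesis using that by (simp add: differential_def o_def)
  qed
  have re: "(\<lambda>x. Re (f x)) \<in> smooth_fun A" and im: "(\<lambda>x. Im (f x)) \<in> smooth_fun A"
    if "f \<in> smooth_fun A" for f
    using smooth_fun_linear[OF bounded_linear_Re that] smooth_fun_linear[OF bounded_linear_Im that] .
  \<comment> \<open>The complex linear extension of \<open>Y\<close>, with the value 0 on non-smooth
    functions.\<close>
  define X where "X = (\<lambda>p f. if f \<in> smooth_fun A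
     then of_real (Y p (\<lambda>x. Re (f x))) + \<i> * of_real (Y p (\<lambda>x. Im (f x))) else 0)"
  have Xs: "smooth_vector_field A X"
    unfolding smooth_vector_field_def
  proof (intro conjI allI ballI)
    fix p
    note t = vfield_tangent[OF Ys, of p]
    show "X p \<in> tangent_space A p"
    proof (rule tangent_spaceI)
      fix f g :: "'m \<Rightarrow> complex" and a
      assume f: "f \<in> smooth_fun A"
      show "X p (\<lambda>x. a * f x) = a * X p f"
        using f by (simp add: X_def smooth_fun_cmult re im tvec_diff[OF t] tvec_add[OF t] tvec_cmult[OF t] complex_eq_iff)
      assume g: "g \<in> smooth_fun A"
      show "X p (\<lambda>x. f x + g x) = X p f + X p g"
        using f g by (simp add: X_def smooth_fun_add re im tvec_add[OF t] complex_eq_iff)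
      show "X p (\<lambda>x. f x * g x) = X p f * g p + f p * X p g"
        using f g by (simp add: X_def smooth_fun_mult re im tvec_add[OF t] tvec_diff[OF t] tvec_mult[OF t] complex_eq_iff algebra_simps)
    qed (simp add: X_def)
  next
    fix f :: "'m \<Rightarrow> complex" assume f: "f \<in> smooth_fun A"
    have "(\<lambda>p. complex_of_real (Y p (\<lambda>x. Re (f x))) + \<i> * of_real (Y p (\<lambda>x. Im (f x)))) \<in> smooth_fun A"
      by (intro smooth_fun_add smooth_fun_cmult smooth_fun_linear[OF bounded_linear_of_real vfield_smooth_app[OF Ys]])
    then show "(\<lambda>p. X p f) \<in> smooth_fun A" using f by (simp add: X_def)
  qed
  have XLC: "X \<in> LC"
    by (rule LC_I[OF Xs]) (simp add: X_def smooth_fun_left Yl re im)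
  moreover have "conj_vfield X = X"
  proof (intro ext)
    fix p f
    have n: "Y p (\<lambda>x. - Im (f x)) = - Y p (\<lambda>x. Im (f x))" if "f \<in> smooth_fun A"
      using tvec_cmult[OF vfield_tangent[OF Ys] im[OF that], of p "- 1"] by simp
    show "conj_vfield X p f = X p f"
      by (auto simp: conj_vfield_def conj_tvec_def o_def X_def smooth_fun_cnj_iff n)
  qed
  moreover have "rho X = Y"
  proof (intro ext)
    fix p f
    show "rho X p f = Y p f"
      using tvec_nonsmooth[OF vfield_tangent[OF Ys], of f p]
      by (auto simp: rho_def X_def smooth_fun_of_real_iff)
  qed
  ultimately show ?thesis by (auto simp: LC0_def)
qed

lemma LC0_real:
  assumes X: "X \<in> LC0"
  shows "X p (\<lambda>x. of_real (f x)) = of_real (rho X p f)"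
proof -
  have "cnj (X p (\<lambda>x. of_real (f x))) = conj_vfield X p (\<lambda>x. of_real (f x))"
    by (simp add: conj_vfield_def conj_tvec_def o_def)
  then have "cnj (X p (\<lambda>x. of_real (f x))) = X p (\<lambda>x. of_real (f x))" using X by (simp add: LC0_def)
  then show ?thesis by (simp add: rho_def complex_eq_iff)
qed

lemma rho_bracket:
  assumes "X \<in> LC0" "Y \<in> LC0"
  shows "rho (bracket X Y) = bracket (rho X) (rho Y)"
  by (intro ext) (simp add: bracket_def rho_def[of "\<lambda>p f. X p (\<lambda>q. Y q f) - Y p (\<lambda>q. X q f)"] LC0_real[OF assms(1)] LC0_real[OF assms(2)])

lemma rho_inj:
  assumes X: "X \<in> LC0" and 0: "rho X = 0"
  shows "X = 0"
proof (intro ext)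
  fix p f
  note t = vfield_tangent[OF LC_smooth, of X p]
  have XL: "X \<in> LC" using X by (simp add: LC0_def)
  show "X p f = 0 p f"
  proof (cases "f \<in> smooth_fun A")
    case True
    have s: "(\<lambda>x. complex_of_real (Re (f x))) \<in> smooth_fun A" "(\<lambda>x. complex_of_real (Im (f x))) \<in> smooth_fun A"
      using smooth_fun_linear[OF bounded_linear_Re True] smooth_fun_linear[OF bounded_linear_Im True]
      by (simp_all add: smooth_fun_of_real_iff)
    have "X p f = X p (\<lambda>x. of_real (Re (f x)) + \<i> * of_real (Im (f x)))"
      by (simp flip: complex_eq)
    also have "\<dots> = X p (\<lambda>x. of_real (Re (f x))) + \<i> * X p (\<lambda>x. of_real (Im (f x)))"
      by (simp add: tvec_add[OF t[OF XL]] tvec_cmult[OF t[OF XL]] smooth_fun_cmult s)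
    also have "\<dots> = 0" using 0 by (simp add: LC0_real[OF X])
    finally show ?thesis by simp
  qed (simp add: tvec_nonsmooth[OF t[OF XL]])
qed

lemma rho_linear: "rho (X + Y) = rho X + rho Y" "rho (vfscale (of_real r) X) = vfscale r (rho X)"
  by (intro ext; simp add: rho_def vfscale_def fscale_def)+

end

section \<open>The left invariant fields as an abstract Lie algebra with real form\<close>

locale real_basis = lie A B mul e iv
  for A :: "('m::{t2_space,second_countable_topology}, 'e::real_inner) atlas" and B mul e iv +
  fixes RB :: "('m, complex) vfield set"
  assumes RB: "vfield.independent RB" "finite RB" "vfield.span RB = LC" "RB \<subseteq> LC0"
begin

text \<open>The bracket of vector fields is bilinear on smooth fields, whereas the abstract bracket
  must be bilinear everywhere with values in the span. Precomposing with a linear projection onto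
  \<open>LC\<close> achieves this without changing brackets inside \<open>LC\<close>.\<close>

definition proj :: "('m, complex) vfield \<Rightarrow> ('m, complex) vfield" where
  "proj = vector_space_pair.construct vfscale vfscale RB id"

lemma pair: "vector_space_pair (vfscale :: complex \<Rightarrow> ('m, complex) vfield \<Rightarrow> _) (vfscale :: complex \<Rightarrow> ('m, complex) vfield \<Rightarrow> _)"
  by unfold_locales

lemma proj_linear: "Vector_Spaces.linear vfscale vfscale proj"
  unfolding proj_def by (rule vector_space_pair.linear_construct[OF pair RB(1)])

lemma proj_LC: "proj X \<in> LC"
  using vector_space_pair.construct_in_span[OF pair RB(1), of id X] RB(3) by (simp add: proj_def)

lemma proj_id: "X \<in> LC \<Longrightarrow> proj X = X"
proof -
  interpret P: Vector_Spaces.linear vfscale vfscale proj by (rule proj_linear)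
  assume "X \<in> LC"
  then have "X \<in> vfield.span RB" using RB(3) by simp
  then show ?thesis
  proof (induction rule: vfield.span_induct_alt)
    case base show ?case by (rule P.zero)
  next
    case (step c x y)
    have "proj x = x" unfolding proj_def using vector_space_pair.construct_basis[OF pair RB(1) step(1)] by simp
    then show ?case by (simp only: P.add P.scale step(2))
  qed
qed

definition br :: "('m, complex) vfield \<Rightarrow> ('m, complex) vfield \<Rightarrow> ('m, complex) vfield" where
  "br X Y = bracket (proj X) (proj Y)"

lemma br_LC: "br X Y \<in> LC"
  unfolding br_def by (rule LC_bracket[OF proj_LC proj_LC])

lemma br_eq: "X \<in> LC \<Longrightarrow> Y \<in> LC \<Longrightarrow> br X Y = bracket X Y"
  by (simp add: br_def proj_id)

sublocale F: real_form vfscale br RB conj_vfield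
proof
  interpret P: Vector_Spaces.linear vfscale vfscale proj by (rule proj_linear)
  note s = LC_smooth[OF proj_LC]
  fix X Y Z :: "('m, complex) vfield" and c
  show "br (X + Y) Z = br X Z + br Y Z" by (simp add: br_def P.add bracket_add_left s)
  show "br X (Y + Z) = br X Y + br X Z" by (simp add: br_def P.add bracket_add_right s)
  show "br (vfscale c X) Y = vfscale c (br X Y)" by (simp add: br_def P.scale bracket_scale_left s)
  show "br X (vfscale c Y) = vfscale c (br X Y)" by (simp add: br_def P.scale bracket_scale_right s)
  show "br X X = 0" by (intro ext) (simp add: br_def bracket_def)
  show "br X (br Y Z) = br (br X Y) Z + br Y (br X Z)"
    unfolding br_def proj_id[OF LC_bracket[OF proj_LC proj_LC]] by (rule bracket_jacobi[OF s s s])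
  show "vfield.independent RB" "finite RB" by (rule RB)+
  show "br X Y \<in> vfield.span RB" using br_LC RB(3) by simp
  show "conj_vfield (X + Y) = conj_vfield X + conj_vfield Y" by (rule conj_vfield_add)
  show "conj_vfield (vfscale c X) = vfscale (cnj c) (conj_vfield X)" by (rule conj_vfield_scale)
  show "conj_vfield (conj_vfield X) = X" by (rule conj_vfield_conj)
  show "X \<in> RB \<Longrightarrow> conj_vfield X = X" using RB(4) by (auto simp: LC0_def)
  show "conj_vfield (br X Y) = br (conj_vfield X) (conj_vfield Y)" if "X \<in> vfield.span RB" "Y \<in> vfield.span RB"
    using that conj_vfield_LC by (simp add: RB(3) br_eq conj_vfield_bracket)
qed

lemma G0_eq: "F.G0 = LC0"
  by (simp add: F.G0_def LC0_def RB(3))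

lemma LC0_LC: "LC0 \<subseteq> LC" by (auto simp: LC0_def)

text \<open>\<open>rho\<close> is an isomorphism from \<open>LC0\<close> to the real Lie algebra, so
  it carries a solvable ideal, together with its derived series, to a solvable ideal.\<close>

lemma semisimple_transfer:
  assumes ss: "lie_semisimple vfscale bracket (lie_algebra_of A mul)"
  shows "lie_semisimple F.rscale br F.G0"
  unfolding lie_semisimple_def
proof (intro allI impI, elim conjE)
  fix I assume I: "lie_ideal F.rscale br F.G0 I" and sol: "lie_solvable F.rscale br I"
  have IL: "I \<subseteq> LC0" and Is: "F.R.subspace I" and Ii: "\<And>x y. x \<in> LC0 \<Longrightarrow> y \<in> I \<Longrightarrow> br x y \<in> I"
    using I unfolding lie_ideal_def G0_eq by auto
  interpret T: Vector_Spaces.linear F.rscale "vfscale :: real \<Rightarrow> ('m, real) vfield \<Rightarrow> _" rho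
    by unfold_locales (simp_all add: rho_linear)
  let ?D = "derived_series F.rscale br I"
  have DI: "?D k \<subseteq> I" for k
  proof (induction k)
    case (Suc k)
    have "{br x y |x y. x \<in> ?D k \<and> y \<in> ?D k} \<subseteq> I" using Suc Ii IL by blast
    then show ?case using F.R.span_minimal[OF _ Is] by simp
  qed simp
  have D: "derived_series vfscale bracket (rho ` I) k = rho ` ?D k" for k
  proof (induction k)
    case (Suc k)
    have "{bracket x y |x y. x \<in> rho ` ?D k \<and> y \<in> rho ` ?D k} = rho ` {br x y |x y. x \<in> ?D k \<and> y \<in> ?D k}"
    proof -
      have e: "bracket (rho x) (rho y) = rho (br x y)" if "x \<in> ?D k" "y \<in> ?D k" for x y
      proof -
        have "x \<in> LC0" "y \<in> LC0" using that DI IL by blast+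
        then show ?thesis using LC0_LC by (simp add: rho_bracket br_eq subset_iff)
      qed
      show ?thesis
      proof (intro equalityI subsetI)
        fix z assume "z \<in> {bracket x y |x y. x \<in> rho ` ?D k \<and> y \<in> rho ` ?D k}"
        then obtain x y where "x \<in> ?D k" "y \<in> ?D k" "z = bracket (rho x) (rho y)" by blast
        then show "z \<in> rho ` {br x y |x y. x \<in> ?D k \<and> y \<in> ?D k}" using e by blast
      next
        fix z assume "z \<in> rho ` {br x y |x y. x \<in> ?D k \<and> y \<in> ?D k}"
        then obtain x y where xy: "x \<in> ?D k" "y \<in> ?D k" "z = rho (br x y)" by blast
        then have "z = bracket (rho x) (rho y)" by (simp only: e)
        then show "z \<in> {bracket x y |x y. x \<in> rho ` ?D k \<and> y \<in> rho ` ?D k}" using xy(1,2) by blast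
      qed
    qed
    then show ?case using T.span_image[of "{br x y |x y. x \<in> ?D k \<and> y \<in> ?D k}"] by (simp add: Suc)
  qed simp
  obtain k where "?D k = {0}" using sol unfolding lie_solvable_def by blast
  then have "derived_series vfscale bracket (rho ` I) k = {0}" by (simp add: D T.zero)
  then have "lie_solvable vfscale bracket (rho ` I)" unfolding lie_solvable_def by blast
  moreover have "lie_ideal vfscale bracket (lie_algebra_of A mul) (rho ` I)"
    unfolding lie_ideal_def
  proof (intro conjI ballI)
    show "rho ` I \<subseteq> lie_algebra_of A mul" using rho_lie_algebra IL LC0_LC by blast
    show "vfield.subspace (rho ` I)" by (rule T.subspace_image[OF Is])
    fix x y assume x: "x \<in> lie_algebra_of A mul" and y: "y \<in> rho ` I"
    obtain x' where x': "x' \<in> LC0" "rho x' = x" using rho_surj[OF x] by blast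
    obtain y' where y': "y' \<in> I" "y = rho y'" using y by blast
    have "y' \<in> LC0" using y' IL by blast
    then have "bracket x y = rho (br x' y')" using x' y' LC0_LC by (simp add: rho_bracket br_eq subset_iff)
    then show "bracket x y \<in> rho ` I" using Ii x' y' by blast
  qed
  ultimately have "rho ` I = {0}" using ss unfolding lie_semisimple_def by blast
  then have "I \<subseteq> {0}" using rho_inj IL by blast
  then show "I = {0}" using F.R.subspace_0[OF Is] by blast
qed

end

section \<open>CR structures from subalgebras\<close>

text \<open>Let \<open>N\<close> be the distance of the matrix from the identity and
  \<open>E\<close> the error made by inserting \<open>w0\<close>. The distance \<open>D\<close> of
  \<open>w\<close> from \<open>w0\<close> satisfies \<open>D \<le> E + D N\<close>, hence
  \<open>D \<le> 2 E\<close> as soon as \<open>N < 1/2\<close>.\<close>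

lemma tendsto_linear_system:
  fixes w :: "'s \<Rightarrow> 'a \<Rightarrow> 'k::real_normed_field" and M :: "'s \<Rightarrow> 's \<Rightarrow> 'a \<Rightarrow> 'k"
  assumes S: "finite S"
    and M: "\<And>s s'. s \<in> S \<Longrightarrow> s' \<in> S \<Longrightarrow> (M s s' \<longlongrightarrow> (if s = s' then 1 else 0)) F"
    and b: "\<And>s. s \<in> S \<Longrightarrow> (b s \<longlongrightarrow> w0 s) F"
    and eq: "\<And>s r. s \<in> S \<Longrightarrow> b s r = (\<Sum>s'\<in>S. w s' r * M s s' r)"
    and s: "s \<in> S"
  shows "(w s \<longlongrightarrow> w0 s) F"
proof -
  define D where "D r = (\<Sum>s\<in>S. norm (w s r - w0 s))" for r
  define N where "N r = (\<Sum>s\<in>S. \<Sum>s'\<in>S. norm (M s s' r - (if s = s' then 1 else 0)))" for r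
  define E where "E r = (\<Sum>s\<in>S. norm (b s r - (\<Sum>s'\<in>S. w0 s' * M s s' r)))" for r
  have "(N \<longlongrightarrow> (\<Sum>s\<in>S. \<Sum>s'\<in>S. norm ((if s = s' then 1 else 0) - (if s = s' then 1 else (0::'k))))) F"
    unfolding N_def by (intro tendsto_sum tendsto_norm tendsto_diff M tendsto_const)
  then have N: "(N \<longlongrightarrow> 0) F" by simp
  have "(E \<longlongrightarrow> (\<Sum>s\<in>S. norm (w0 s - (\<Sum>s'\<in>S. w0 s' * (if s = s' then 1 else 0))))) F"
    unfolding E_def by (intro tendsto_sum tendsto_norm tendsto_diff tendsto_mult M b tendsto_const)
  moreover have "(\<Sum>s\<in>S. norm (w0 s - (\<Sum>s'\<in>S. w0 s' * (if s = s' then 1 else 0)))) = 0"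
    using S by (intro sum.neutral) (simp add: if_distrib[of "\<lambda>x. _ * x"] cong: if_cong)
  ultimately have E: "(E \<longlongrightarrow> 0) F" by simp
  have DE: "D r \<le> E r + D r * N r" for r
  proof -
    have bd: "norm (w s r - w0 s) \<le> norm (b s r - (\<Sum>s'\<in>S. w0 s' * M s s' r))
        + D r * (\<Sum>s'\<in>S. norm (M s s' r - (if s = s' then 1 else 0)))" if s: "s \<in> S" for s
    proof -
      have "b s r - (\<Sum>s'\<in>S. w0 s' * M s s' r) = (\<Sum>s'\<in>S. (w s' r - w0 s') * M s s' r)"
        by (simp add: eq[OF s] sum_subtractf[symmetric] left_diff_distrib)
      also have "\<dots> = (\<Sum>s'\<in>S. (w s' r - w0 s') * (M s s' r - (if s = s' then 1 else 0)) + (if s = s' then w s' r - w0 s' else 0))"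
        by (intro sum.cong) (auto simp: algebra_simps)
      also have "\<dots> = (\<Sum>s'\<in>S. (w s' r - w0 s') * (M s s' r - (if s = s' then 1 else 0))) + (w s r - w0 s)"
        using S s by (simp add: sum.distrib)
      finally have e: "w s r - w0 s = (b s r - (\<Sum>s'\<in>S. w0 s' * M s s' r))
          - (\<Sum>s'\<in>S. (w s' r - w0 s') * (M s s' r - (if s = s' then 1 else 0)))" by (simp add: algebra_simps)
      have "norm (\<Sum>s'\<in>S. (w s' r - w0 s') * (M s s' r - (if s = s' then 1 else 0)))
          \<le> (\<Sum>s'\<in>S. norm (w s' r - w0 s') * norm (M s s' r - (if s = s' then 1 else 0)))"
        by (rule order_trans[OF norm_sum]) (simp add: norm_mult)
      also have "\<dots> \<le> (\<Sum>s'\<in>S. D r * norm (M s s' r - (if s = s' then 1 else 0)))"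
        unfolding D_def using S by (intro sum_mono mult_right_mono member_le_sum) auto
      finally show ?thesis
        unfolding e sum_distrib_left by (rule order_trans[OF norm_triangle_ineq4 add_left_mono])
    qed
    have "D r \<le> (\<Sum>s\<in>S. norm (b s r - (\<Sum>s'\<in>S. w0 s' * M s s' r))
        + D r * (\<Sum>s'\<in>S. norm (M s s' r - (if s = s' then 1 else 0))))"
      by (subst (1) D_def) (rule sum_mono[OF bd])
    then show ?thesis by (simp add: E_def N_def sum.distrib sum_distrib_left)
  qed
  have D0: "D r \<ge> 0" for r unfolding D_def by (simp add: sum_nonneg)
  have "\<forall>\<^sub>F r in F. N r < 1/2" using order_tendstoD(2)[OF N, of "1/2"] by simp
  then have "\<forall>\<^sub>F r in F. norm (w s r - w0 s) \<le> 2 * E r"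
  proof (rule eventually_mono)
    fix r assume "N r < 1/2"
    then have "D r * N r \<le> D r * (1/2)" using D0[of r] by (intro mult_left_mono) auto
    then have "D r \<le> 2 * E r" using DE[of r] by simp
    moreover have "norm (w s r - w0 s) \<le> D r" unfolding D_def using S s by (intro member_le_sum) auto
    ultimately show "norm (w s r - w0 s) \<le> 2 * E r" by simp
  qed
  moreover have "((\<lambda>r. 2 * E r) \<longlongrightarrow> 0) F" using tendsto_mult_right_zero[OF E] .
  ultimately have "((\<lambda>r. w s r - w0 s) \<longlongrightarrow> 0) F" by (rule Lim_null_comparison)
  then show ?thesis by (simp add: LIM_zero_iff)
qed

text \<open>The product is \<open>o(1)\<close> times \<open>O(|y - c|)\<close>, so a mere limit of
  the first factor is enough.\<close>

lemma has_derivative_null_mult: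
  fixes a m :: "'e::real_normed_vector \<Rightarrow> 'k::real_normed_field"
  assumes a: "(a \<longlongrightarrow> 0) (nhds c)" and m: "(m has_derivative D) (at c)" and m0: "m c = 0"
  shows "((\<lambda>y. a y * m y) has_derivative (\<lambda>_. 0)) (at c)"
  unfolding has_derivative_at_alt
proof (intro conjI allI impI)
  show "bounded_linear (\<lambda>_::'e. 0::'k)" by (rule bounded_linear_zero)
  fix \<epsilon> :: real assume \<epsilon>: "0 < \<epsilon>"
  have bD: "bounded_linear D" using m by (rule has_derivative_bounded_linear)
  obtain K where K: "0 < K" "\<And>x. norm (D x) \<le> norm x * K" using bounded_linear.pos_bounded[OF bD] by blast
  obtain d1 where d1: "0 < d1" "\<And>y. norm (y - c) < d1 \<Longrightarrow> norm (m y - m c - D (y - c)) \<le> 1 * norm (y - c)"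
    using m unfolding has_derivative_at_alt by (meson zero_less_one)
  have "\<forall>\<^sub>F y in nhds c. dist (a y) 0 < \<epsilon> / (K + 1)" by (rule tendstoD[OF a]) (use \<epsilon> K in auto)
  then obtain d2 where d2: "0 < d2" "\<And>y. dist y c < d2 \<Longrightarrow> dist (a y) 0 < \<epsilon> / (K + 1)"
    unfolding eventually_nhds_metric by blast
  have "norm (a y * m y) \<le> \<epsilon> * norm (y - c)" if y: "norm (y - c) < min d1 d2" for y
  proof -
    have "norm (m y - D (y - c)) \<le> norm (y - c)" using d1(2)[of y] y m0 by simp
    moreover have "norm (m y) \<le> norm (m y - D (y - c)) + norm (D (y - c))"
      using norm_triangle_ineq[of "m y - D (y - c)" "D (y - c)"] by simp
    ultimately have "norm (m y) \<le> (K + 1) * norm (y - c)" using K(2)[of "y - c"] by (simp add: algebra_simps)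
    moreover have "norm (a y) \<le> \<epsilon> / (K + 1)" using d2(2)[of y] y by (simp add: dist_norm)
    ultimately have "norm (a y) * norm (m y) \<le> (\<epsilon> / (K + 1)) * ((K + 1) * norm (y - c))"
      using \<epsilon> K(1) by (intro mult_mono) auto
    then show ?thesis using K(1) by (simp add: norm_mult)
  qed
  then show "\<exists>d>0. \<forall>y. norm (y - c) < d \<longrightarrow> norm (a y * m y - a c * m c - 0) \<le> \<epsilon> * norm (y - c)"
    using d1(1) d2(1) m0 by (intro exI[of _ "min d1 d2"]) simp
qed

context manifold
begin

lemma smooth_fun_tendsto:
  fixes f :: "'m \<Rightarrow> 'k::real_normed_field"
  assumes f: "f \<in> smooth_fun A"
  shows "(f \<longlongrightarrow> f p) (nhds p)"
proof -
  obtain U \<phi> where U: "(U, \<phi>) \<in> A" "p \<in> U" using chart_cover by blast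
  have c1: "continuous_on U \<phi>" using chart_homeo[OF U(1)] unfolding homeomorphism_def by (elim conjE)
  have "continuous_on U (\<lambda>m. f (inv_into U \<phi> (\<phi> m)))"
    by (rule continuous_on_compose2[OF smooth_on_continuous[OF smooth_funD[OF f U(1)]] c1]) simp
  then have "continuous_on U f" by (rule continuous_on_eq) (simp add: chart_inv[OF U(1)])
  then have "isCont f p" using chart_open[OF U(1)] U(2) by (simp add: continuous_on_eq_continuous_at)
  then show ?thesis using tendsto_at_iff_tendsto_nhds[of f p] by (simp add: isCont_def)
qed

text \<open>Extending \<open>F\<close> to a basis of the tangent space gives a linear functional
  dual to \<open>x\<close>. Its values on the partial derivatives are the coefficients of a
  combination of coordinate functions that realizes it.\<close>

lemma dual_function:
  assumes F: "F \<subseteq> tangent_space A p" "tvec.independent F" and x: "x \<in> F"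
  obtains g :: "'m \<Rightarrow> complex" where "g \<in> smooth_fun A" "\<And>y. y \<in> F \<Longrightarrow> y g = (if y = x then 1 else 0)"
proof -
  obtain E where E: "F \<subseteq> E" "E \<subseteq> tangent_space A p" "tvec.independent E" "tangent_space A p \<subseteq> tvec.span E"
    using tvec.maximal_independent_subset_extend[OF F] by blast
  obtain U \<phi> where U: "(U, \<phi>) \<in> A" "p \<in> U" using chart_cover by blast
  obtain X where X: "\<And>b. X b \<in> smooth_fun A"
    and X2: "\<And>v f. v \<in> tangent_space A p \<Longrightarrow> f \<in> smooth_fun A \<Longrightarrow> v f = (\<Sum>b\<in>B. v (X b) * pd U \<phi> p b f)"
    and "\<And>b b'. pd U \<phi> p b' (X b) = complex_of_real (b' \<bullet> b)"
    using tangent_coordinates[OF U] by metis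
  define l where "l v = tvec.representation E v x" for v
  define g where "g = (\<lambda>m. \<Sum>b\<in>B. l (pd U \<phi> p b) * X b m)"
  have "y g = (if y = x then 1 else 0)" if y: "y \<in> F" for y
  proof -
    have yT: "y \<in> tangent_space A p" using y F by blast
    have pE: "pd U \<phi> p b \<in> tvec.span E" for b using pd_tangent[OF U] E(4) by blast
    have "y f = (\<Sum>b\<in>B. fscale (y (X b)) (pd U \<phi> p b)) f" for f
    proof (cases "f \<in> smooth_fun A")
      case True
      then show ?thesis using X2[OF yT True] by (simp add: sum_fun_apply fscale_def)
    next
      case False
      then show ?thesis using tvec_nonsmooth[OF yT False] by (simp add: sum_fun_apply fscale_def pd_def)
    qed
    then have ys: "y = (\<Sum>b\<in>B. fscale (y (X b)) (pd U \<phi> p b))" by blast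
    have "y g = (\<Sum>b\<in>B. y (\<lambda>m. l (pd U \<phi> p b) * X b m))"
      unfolding g_def by (rule tvec_sum[OF yT]) (rule smooth_fun_cmult[OF X])
    also have "\<dots> = (\<Sum>b\<in>B. y (X b) * l (pd U \<phi> p b))"
      by (intro sum.cong refl) (subst tvec_cmult[OF yT X], rule mult.commute)
    also have "\<dots> = tvec.representation E (\<Sum>b\<in>B. fscale (y (X b)) (pd U \<phi> p b)) x"
      by (simp add: tvec.representation_sum[OF E(3)] tvec.representation_scale[OF E(3)] pE tvec.span_scale l_def)
    also have "\<dots> = tvec.representation E y x" using ys by metis
    also have "\<dots> = (if y = x then 1 else 0)"
    proof -
      have "y \<in> E" using y E(1) by blast
      then show ?thesis using tvec.representation_basis[OF E(3)] by auto
    qed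
    finally show ?thesis .
  qed
  moreover have "g \<in> smooth_fun A" unfolding g_def by (intro smooth_fun_sum smooth_fun_cmult X)
  ultimately show ?thesis using that by blast
qed

text \<open>Since \<open>m s p = 0\<close>, the derivative at \<open>p\<close> of \<open>\<Sum>s. w s * m s\<close> sees only the values of the
  coefficients at \<open>p\<close>; they need not be differentiable.\<close>

lemma tvec_sum_vanishing:
  fixes w :: "'s \<Rightarrow> 'm \<Rightarrow> complex"
  assumes v: "v \<in> tangent_space A p" and S: "finite S"
    and k: "(\<lambda>r. \<Sum>s\<in>S. w s r * m s r) \<in> smooth_fun A"
    and m: "\<And>s. s \<in> S \<Longrightarrow> m s \<in> smooth_fun A" "\<And>s. s \<in> S \<Longrightarrow> m s p = 0"
    and w: "\<And>s. s \<in> S \<Longrightarrow> (w s \<longlongrightarrow> w s p) (nhds p)"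
  shows "v (\<lambda>r. \<Sum>s\<in>S. w s r * m s r) = (\<Sum>s\<in>S. w s p * v (m s))"
proof -
  \<comment> \<open>Subtracting the values at \<open>p\<close> leaves coefficients that tend to 0,
    as \<open>has_derivative_null_mult\<close> requires.\<close>
  let ?k = "\<lambda>r. \<Sum>s\<in>S. (w s r - w s p) * m s r"
  have ke: "?k = (\<lambda>r. (\<Sum>s\<in>S. w s r * m s r) - (\<Sum>s\<in>S. w s p * m s r))"
    by (simp add: left_diff_distrib sum_subtractf)
  have sm: "(\<lambda>r. \<Sum>s\<in>S. w s p * m s r) \<in> smooth_fun A" by (intro smooth_fun_sum smooth_fun_cmult m)
  have ks: "?k \<in> smooth_fun A" unfolding ke by (rule smooth_fun_diff[OF k sm])
  obtain U \<phi> where U: "(U, \<phi>) \<in> A" "p \<in> U" using chart_cover by blast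
  obtain X where "\<And>b. X b \<in> smooth_fun A"
    and X2: "\<And>v f. v \<in> tangent_space A p \<Longrightarrow> f \<in> smooth_fun A \<Longrightarrow> v f = (\<Sum>b\<in>B. v (X b) * pd U \<phi> p b f)"
    and "\<And>b b'. pd U \<phi> p b' (X b) = complex_of_real (b' \<bullet> b)"
    using tangent_coordinates[OF U] by metis
  have t: "(inv_into U \<phi> \<longlongrightarrow> p) (nhds (\<phi> p))"
  proof -
    have "continuous_on (\<phi> ` U) (inv_into U \<phi>)" using chart_homeo[OF U(1)] unfolding homeomorphism_def by (elim conjE)
    then have "isCont (inv_into U \<phi>) (\<phi> p)"
      using chart_image_open[OF U(1)] U(2) by (simp add: continuous_on_eq_continuous_at)
    then show ?thesis
      using tendsto_at_iff_tendsto_nhds[of "inv_into U \<phi>" "\<phi> p"] chart_inv[OF U] by (simp add: isCont_def)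
  qed
  have "((\<lambda>y. \<Sum>s\<in>S. (w s (inv_into U \<phi> y) - w s p) * m s (inv_into U \<phi> y)) has_derivative (\<lambda>h. \<Sum>s\<in>S. 0)) (at (\<phi> p))"
  proof (rule has_derivative_sum)
    fix s assume s: "s \<in> S"
    show "((\<lambda>y. (w s (inv_into U \<phi> y) - w s p) * m s (inv_into U \<phi> y)) has_derivative (\<lambda>_. 0)) (at (\<phi> p))"
    proof (rule has_derivative_null_mult[OF _ smooth_fun_has_derivative[OF U m(1)[OF s]]])
      have "((\<lambda>y. w s (inv_into U \<phi> y)) \<longlongrightarrow> w s p) (nhds (\<phi> p))"
        using filterlim_compose[OF w[OF s] t] .
      then show "((\<lambda>y. w s (inv_into U \<phi> y) - w s p) \<longlongrightarrow> 0) (nhds (\<phi> p))" by (simp add: LIM_zero)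
      show "m s (inv_into U \<phi> (\<phi> p)) = 0" using m(2)[OF s] chart_inv[OF U] by simp
    qed
  qed
  then have "pd U \<phi> p b ?k = 0" for b
    using ks frechet_derivative_eq by (fastforce simp: pd_def)
  then have "v ?k = 0" using X2[OF v ks] by simp
  then have "v (\<lambda>r. \<Sum>s\<in>S. w s r * m s r) - v (\<lambda>r. \<Sum>s\<in>S. w s p * m s r) = 0"
    unfolding ke tvec_diff[OF v k sm] .
  then have "v (\<lambda>r. \<Sum>s\<in>S. w s r * m s r) = v (\<lambda>r. \<Sum>s\<in>S. w s p * m s r)" by simp
  also have "\<dots> = (\<Sum>s\<in>S. v (\<lambda>r. w s p * m s r))" by (rule tvec_sum[OF v]) (intro smooth_fun_cmult m)
  also have "\<dots> = (\<Sum>s\<in>S. w s p * v (m s))" by (intro sum.cong refl tvec_cmult[OF v] m)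
  finally show ?thesis .
qed

end

context lie
begin

lemma eval_linear: "Vector_Spaces.linear vfscale fscale (\<lambda>X :: ('m, complex) vfield. X p)"
  by unfold_locales (simp_all add: vfscale_def)

text \<open>Translation by \<open>r p^-1\<close> carries the value at \<open>p\<close> to the value
  at \<open>r\<close>.\<close>

lemma LC_eval_zero:
  assumes X: "X \<in> LC" and 0: "X p = 0"
  shows "X = 0"
proof (intro ext)
  fix r f
  have "X r f = X (mul (mul r (iv p)) p) f" by (simp add: grp.assoc)
  also have "\<dots> = 0" unfolding LC_left[OF X] 0 by simp
  finally show "X r f = 0 r f" by simp
qed

text \<open>A basis \<open>S\<close> of \<open>q\<close> is a global frame of \<open>H\<close>,
  which settles rank, smoothness and the condition on conjugates. The work lies in closure under
  brackets, known for \<open>q\<close> and required for all smooth sections.\<close>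

lemma CR_structure_of_subalgebra:
  assumes q: "vfield.subspace q" "q \<subseteq> LC" and br: "\<And>X Y. X \<in> q \<Longrightarrow> Y \<in> q \<Longrightarrow> bracket X Y \<in> q"
    and cj: "q \<inter> conj_vfield ` q = {0}"
  defines "H \<equiv> \<lambda>p. (\<lambda>X. X p) ` q"
  shows "CR_structure A (vfield.dim q) H" "left_invariant A mul H"
proof -
  obtain C where C: "finite C" "vfield.span C = LC" using LC_basis by blast
  obtain S where S: "S \<subseteq> q" "vfield.independent S" "q \<subseteq> vfield.span S" "card S = vfield.dim q"
    using vfield.basis_exists by blast
  have fS: "finite S" using vfield.independent_span_bound[OF C(1) S(2)] S(1) q(2) C(2) by blast
  have spS: "vfield.span S = q" using S q(1) by (simp add: vfield.span_subspace)
  have SLC: "S \<subseteq> LC" using S(1) q(2) by blast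
  have eval_inj: "inj_on (\<lambda>X. X p) LC" for p
  proof (rule inj_onI)
    fix X Y assume XY: "X \<in> LC" "Y \<in> LC" "X p = Y p"
    then have "X - Y = 0" by (intro LC_eval_zero[of _ p] vfield.subspace_diff[OF LC_subspace]) simp_all
    then show "X = Y" by simp
  qed
  have Hspan: "H p = tvec.span ((\<lambda>X. X p) ` S)" for p
  proof -
    interpret E: Vector_Spaces.linear vfscale fscale "\<lambda>X :: ('m, complex) vfield. X p" by (rule eval_linear)
    show ?thesis unfolding H_def using E.span_image[of S] spS by simp
  qed
  have ind: "tvec.independent ((\<lambda>X. X p) ` S)" for p
  proof -
    interpret E: Vector_Spaces.linear vfscale fscale "\<lambda>X :: ('m, complex) vfield. X p" by (rule eval_linear)
    show ?thesis
      by (rule E.independent_injective_image[OF S(2)]) (use inj_on_subset[OF eval_inj] spS q(2) in auto)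
  qed
  have cardS: "card ((\<lambda>X. X p) ` S) = card S" for p by (rule card_image[OF inj_on_subset[OF eval_inj SLC]])
  have HT: "H p \<subseteq> tangent_space A p" for p
    unfolding H_def using vfield_tangent[OF LC_smooth] q(2) by blast
  have sub: "smooth_complex_subbundle A (vfield.dim q) H"
    unfolding smooth_complex_subbundle_def
  proof (intro conjI allI)
    fix p
    show "H p \<subseteq> tangent_space A p" by (rule HT)
    show "tvec.subspace (H p)" unfolding Hspan by (rule tvec.subspace_span)
    show "tvec.dim (H p) = vfield.dim q"
      unfolding Hspan tvec.dim_span_eq_card_independent[OF ind] cardS S(4) ..
    obtain X where X: "bij_betw X {0..<card S} S" using ex_bij_betw_nat_finite[OF fS] by blast
    have "X ` {..<vfield.dim q} = S" using X S(4) by (simp add: bij_betw_def atLeast0LessThan)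
    moreover have "(\<lambda>i. X i r) ` {..<vfield.dim q} = (\<lambda>Y. Y r) ` X ` {..<vfield.dim q}" for r by (simp add: image_image)
    ultimately have 1: "H r = tvec.span ((\<lambda>i. X i r) ` {..<vfield.dim q})" for r by (simp add: Hspan)
    have 2: "smooth_vector_field A (X i)" if "i < vfield.dim q" for i
    proof -
      have "X i \<in> S" using X S(4) that by (auto simp: bij_betw_def)
      then show ?thesis using SLC LC_smooth by blast
    qed
    show "\<exists>U X. open U \<and> p \<in> U \<and> (\<forall>i<vfield.dim q. smooth_vector_field A (X i)) \<and>
        (\<forall>r\<in>U. H r = tvec.span ((\<lambda>i. X i r) ` {..<vfield.dim q}))"
      using 1 2 by (intro exI[of _ UNIV] exI[of _ X]) simp
  qed
  have conj0: "H p \<inter> conj_tvec ` H p = {0}" for p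
  proof -
    have "u = 0" if u: "u \<in> H p" "u \<in> conj_tvec ` H p" for u
    proof -
      obtain X where X: "X \<in> q" "u = X p" using u(1) by (auto simp: H_def)
      obtain Y where Y: "Y \<in> q" "u = conj_tvec (Y p)" using u(2) by (auto simp: H_def)
      have "X p = conj_vfield Y p" using X Y by (simp add: conj_vfield_def)
      then have "X = conj_vfield Y"
        using inj_onD[OF eval_inj[of p]] X(1) Y(1) q(2) conj_vfield_LC by blast
      then have "X \<in> q \<inter> conj_vfield ` q" using X Y by blast
      then have "X = 0" using cj by blast
      then show ?thesis using X(2) by simp
    qed
    moreover have "0 \<in> H p" unfolding Hspan by (rule tvec.span_zero)
    moreover have "conj_tvec 0 = (0 :: ('m, complex) tvec)" by (intro ext) (simp add: conj_tvec_def)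
    ultimately show ?thesis by force
  qed
  \<comment> \<open>The coefficients are chosen point by point; nothing is known yet about their
    dependence on \<open>r\<close>.\<close>
  have coeff: "\<exists>w. \<forall>r. W r = (\<Sum>s\<in>S. fscale (w s r) (s r))" if W: "\<And>r. W r \<in> H r" for W :: "('m, complex) vfield"
  proof -
    have "\<exists>X\<in>q. W r = X r" for r using W[of r] by (auto simp: H_def)
    then obtain X where X: "\<And>r. X r \<in> q" "\<And>r. W r = X r r" by metis
    have "W r = (\<Sum>s\<in>S. fscale (vfield.representation S (X r) s) (s r))" for r
    proof -
      have "X r = (\<Sum>s\<in>S. vfscale (vfield.representation S (X r) s) s)"
        using vfield.sum_representation_eq[OF S(2) _ fS, of "X r"] X(1) spS by simp
      then have "X r r = (\<Sum>s\<in>S. vfscale (vfield.representation S (X r) s) s) r" by metis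
      then show ?thesis unfolding X(2) by (simp add: sum_fun_apply vfscale_def)
    qed
    then show ?thesis by (intro exI[of _ "\<lambda>s r. vfield.representation S (X r) s"]) simp
  qed
  have closed: "smooth_section A H (bracket Z W)"
    if Z: "smooth_section A H Z" and W: "smooth_section A H W" for Z W
    unfolding smooth_section_def
  proof (intro conjI allI)
    have Zs: "smooth_vector_field A Z" "\<And>r. Z r \<in> H r" and Ws: "smooth_vector_field A W" "\<And>r. W r \<in> H r"
      using Z W by (auto simp: smooth_section_def)
    show bs: "smooth_vector_field A (bracket Z W)" by (rule bracket_smooth[OF Zs(1) Ws(1)])
    fix p
    let ?E = "(\<lambda>X. X p) ` S"
    have SE: "?E \<subseteq> tangent_space A p" using HT Hspan tvec.span_superset by blast
    obtain z where z: "\<And>r. Z r = (\<Sum>s\<in>S. fscale (z s r) (s r))" using coeff[OF Zs(2)] by blast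
    obtain w where w: "\<And>r. W r = (\<Sum>s\<in>S. fscale (w s r) (s r))" using coeff[OF Ws(2)] by blast
    \<comment> \<open>Functions dual to the frame at \<open>p\<close>. Applying a smooth section to
      them near \<open>p\<close> gives a linear system for its coefficients whose matrix tends to
      the identity, so the coefficients are continuous at \<open>p\<close>.\<close>
    have "\<exists>g. \<forall>s\<in>S. g s \<in> smooth_fun A \<and> (\<forall>s'\<in>S. s' p (g s) = (if s = s' then 1 else 0))"
    proof (rule bchoice, rule ballI)
      fix s assume s: "s \<in> S"
      obtain h where h: "h \<in> smooth_fun A" "\<And>y. y \<in> ?E \<Longrightarrow> y h = (if y = s p then 1 else 0)"
        using dual_function[OF SE ind imageI[OF s]] by blast
      have "s' p h = (if s = s' then 1 else 0)" if "s' \<in> S" for s'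
        using h(2)[of "s' p"] that s inj_onD[OF eval_inj[of p], of s' s] SLC by auto
      then show "\<exists>h. h \<in> smooth_fun A \<and> (\<forall>s'\<in>S. s' p h = (if s = s' then 1 else 0))" using h(1) by blast
    qed
    then obtain g where g: "\<forall>s\<in>S. g s \<in> smooth_fun A \<and> (\<forall>s'\<in>S. s' p (g s) = (if s = s' then 1 else 0))"
      by (elim exE)
    have g2: "s' p (g s) = (if s = s' then 1 else 0)" if "s \<in> S" "s' \<in> S" for s s'
      using g that by simp
    have cont: "(c s \<longlongrightarrow> c s p) (nhds p)"
      if V: "smooth_vector_field A V" and c: "\<And>r. V r = (\<Sum>s\<in>S. fscale (c s r) (s r))" and s: "s \<in> S"
      for V :: "('m, complex) vfield" and c s
    proof -
      have lim: "((\<lambda>r. V r (g s)) \<longlongrightarrow> c s p) (nhds p)" if s: "s \<in> S" for s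
      proof -
        have "V p (g s) = (\<Sum>s'\<in>S. c s' p * s' p (g s))"
          unfolding c by (simp add: sum_fun_apply fscale_def)
        also have "\<dots> = (\<Sum>s'\<in>S. if s = s' then c s' p else 0)"
          by (intro sum.cong) (simp_all add: g2[OF s])
        also have "\<dots> = c s p" using fS s by simp
        finally show ?thesis using smooth_fun_tendsto[OF vfield_smooth_app[OF V], of "g s" p] by simp
      qed
      have M: "((\<lambda>r. s' r (g s)) \<longlongrightarrow> (if s = s' then 1 else 0)) (nhds p)" if "s \<in> S" "s' \<in> S" for s s'
      proof -
        have "(\<lambda>r. s' r (g s)) \<in> smooth_fun A"
          by (rule vfield_smooth_app[OF LC_smooth[OF subsetD[OF SLC that(2)]]])
        from smooth_fun_tendsto[OF this, of p] show ?thesis using g2[OF that] by simp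
      qed
      have e: "V r (g s) = (\<Sum>s'\<in>S. c s' r * s' r (g s))" if "s \<in> S" for s r
        unfolding c by (simp add: sum_fun_apply fscale_def)
      show ?thesis
        using tendsto_linear_system[OF fS, where M="\<lambda>s s' r. s' r (g s)" and b="\<lambda>s r. V r (g s)" and w=c
            and ?w0.0="\<lambda>s. c s p", OF M lim e s] .
    qed
    let ?u = "bracket Z W p"
    have uT: "?u \<in> tangent_space A p" by (rule vfield_tangent[OF bs])
    show "?u \<in> H p"
    proof (rule ccontr)
      assume nu: "?u \<notin> H p"
      have iu: "tvec.independent (insert ?u ?E)"
        using tvec.independent_insertI[OF _ ind] nu Hspan by blast
      have sT: "insert ?u ?E \<subseteq> tangent_space A p" using uT SE by blast
      \<comment> \<open>If the bracket left \<open>H p\<close>, it could be separated from it: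
        \<open>h\<close> is annihilated by \<open>H p\<close>, while the bracket takes the value 1
        on it.\<close>
      obtain h where h: "h \<in> smooth_fun A" "\<And>y. y \<in> insert ?u ?E \<Longrightarrow> y h = (if y = ?u then 1 else 0)"
        using dual_function[OF sT iu insertI1] by blast
      have EH: "?E \<subseteq> H p" unfolding Hspan by (rule tvec.span_superset)
      have Eh: "s p h = 0" if s: "s \<in> S" for s
      proof -
        have sE: "s p \<in> ?E" using s by (rule imageI)
        then have "s p \<noteq> ?u" using EH nu by (metis subsetD)
        then show ?thesis using h(2)[OF insertI2[OF sE]] by simp
      qed
      have Hh: "y h = 0" if "y \<in> H p" for y
        using that unfolding Hspan
        by (induction rule: tvec.span_induct_alt) (auto simp: fscale_def Eh)
      have sm: "(\<lambda>r. s r h) \<in> smooth_fun A" if "s \<in> S" for s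
        by (rule vfield_smooth_app[OF LC_smooth[OF subsetD[OF SLC that]]])
      \<comment> \<open>The functions \<open>r \<mapsto> s r h\<close> vanish at \<open>p\<close>,
        so differentiating \<open>V r h\<close> there sees only the values \<open>c s p\<close> of
        the coefficients.\<close>
      have appl: "v (\<lambda>r. V r h) = (\<Sum>s\<in>S. c s p * v (\<lambda>r. s r h))"
        if V: "smooth_vector_field A V" and c: "\<And>r. V r = (\<Sum>s\<in>S. fscale (c s r) (s r))" and v: "v \<in> tangent_space A p"
        for V :: "('m, complex) vfield" and c v
      proof -
        have e: "(\<lambda>r. V r h) = (\<lambda>r. \<Sum>s\<in>S. c s r * s r h)"
          unfolding c by (simp add: sum_fun_apply fscale_def)
        have k: "(\<lambda>r. \<Sum>s\<in>S. c s r * s r h) \<in> smooth_fun A"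
          using vfield_smooth_app[OF V, of h] unfolding e .
        show ?thesis unfolding e
          by (rule tvec_sum_vanishing[OF v fS k]) (use sm Eh cont[OF V c] in auto)
      qed
      have "?u h = Z p (\<lambda>r. W r h) - W p (\<lambda>r. Z r h)" by (simp add: bracket_def)
      also have "Z p (\<lambda>r. W r h) = (\<Sum>s\<in>S. w s p * Z p (\<lambda>r. s r h))"
        by (rule appl[OF Ws(1) w vfield_tangent[OF Zs(1)]])
      also have "\<dots> = (\<Sum>s\<in>S. \<Sum>t\<in>S. w s p * z t p * t p (\<lambda>r. s r h))"
        unfolding z[of p] by (simp add: sum_fun_apply fscale_def sum_distrib_left mult.assoc)
      also have "W p (\<lambda>r. Z r h) = (\<Sum>t\<in>S. z t p * W p (\<lambda>r. t r h))"
        by (rule appl[OF Zs(1) z vfield_tangent[OF Ws(1)]])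
      also have "\<dots> = (\<Sum>t\<in>S. \<Sum>s\<in>S. w s p * z t p * s p (\<lambda>r. t r h))"
        unfolding w[of p] by (simp add: sum_fun_apply fscale_def sum_distrib_left mult.assoc mult.left_commute)
      also have "\<dots> = (\<Sum>s\<in>S. \<Sum>t\<in>S. w s p * z t p * s p (\<lambda>r. t r h))" by (rule sum.swap)
      \<comment> \<open>Derivatives of coefficients being absent, the bracket of the sections acts
        on \<open>h\<close> at \<open>p\<close> as a combination of brackets of frame fields; those
        lie in \<open>q\<close> and kill \<open>h\<close> at \<open>p\<close>.\<close>
      also have "(\<Sum>s\<in>S. \<Sum>t\<in>S. w s p * z t p * t p (\<lambda>r. s r h)) - (\<Sum>s\<in>S. \<Sum>t\<in>S. w s p * z t p * s p (\<lambda>r. t r h))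
          = (\<Sum>s\<in>S. \<Sum>t\<in>S. w s p * z t p * bracket t s p h)"
        by (simp add: bracket_def sum_subtractf[symmetric] right_diff_distrib)
      also have "\<dots> = 0"
      proof (intro sum.neutral ballI)
        fix s t assume "s \<in> S" "t \<in> S"
        then have "bracket t s \<in> q" using br S(1) by blast
        then have "bracket t s p \<in> H p" by (auto simp: H_def)
        then show "w s p * z t p * bracket t s p h = 0" using Hh by simp
      qed
      finally have "?u h = 0" .
      then show False using h(2)[of ?u] by simp
    qed
  qed
  show "CR_structure A (vfield.dim q) H"
    unfolding CR_structure_def using sub conj0 closed by blast
  show "left_invariant A mul H"
    unfolding left_invariant_def CR_map_def
  proof (intro allI conjI smooth_map_left)
    fix g p
    show "differential A (mul g) ` H p \<subseteq> H (mul g p)"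
    proof
      fix u assume "u \<in> differential A (mul g) ` H p"
      then obtain X where X: "X \<in> q" "u = differential A (mul g) (X p)" by (auto simp: H_def)
      then have "u = X (mul g p)" using q(2) by (auto simp: LC_def)
      then show "u \<in> H (mul g p)" using X(1) by (auto simp: H_def)
    qed
  qed
qed

end

theorem theorem5p1:
  fixes A :: "('g::{t2_space,second_countable_topology}, 'e::real_inner) atlas"
    and mul :: "'g \<Rightarrow> 'g \<Rightarrow> 'g" and e :: 'g and iv :: "'g \<Rightarrow> 'g"
  assumes "semisimple_lie_group A mul e iv"
  shows "(even (manifold_dim A) \<longrightarrow> (\<exists>H. complex_structure A H \<and> left_invariant A mul H)) \<and>
         (odd (manifold_dim A) \<longrightarrow> (\<exists>H. hypersurface_CR_structure A H \<and> left_invariant A mul H))"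
proof -
  have lg: "lie_group A mul e iv" and ss: "lie_semisimple vfscale bracket (lie_algebra_of A mul)"
    using assms by (auto simp: semisimple_lie_group_def)
  have sm: "smooth_manifold A" using lg by (simp add: lie_group_def)
  then have "\<exists>C::'e set. finite C \<and> span C = UNIV" unfolding smooth_manifold_def by (elim conjE)
  then obtain C :: "'e set" where C: "finite C" "span C = UNIV" by blast
  obtain B :: "'e set" where onB: "on_basis B" "card B = dim (UNIV :: 'e set)"
    "\<And>a b. a \<in> B \<Longrightarrow> b \<in> B \<Longrightarrow> a \<bullet> b = (if a = b then 1 else 0)"
    using ex_on_basis[OF C] by metis
  interpret lie A B mul e iv by unfold_locales (rule sm onB lg | assumption)+
  obtain RB where rb: "vfield.independent RB" "finite RB" "vfield.span RB = LC" "card RB = card B" "RB \<subseteq> LC0"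
    using ex_real_basis by blast
  interpret real_basis A B mul e iv RB by unfold_locales (rule rb)+
  interpret semisimple_real_form vfscale br RB conj_vfield
    by unfold_locales (rule semisimple_transfer[OF ss])
  obtain q where q: "vfield.subspace q" "q \<subseteq> vfield.span RB" "\<And>x y. x \<in> q \<Longrightarrow> y \<in> q \<Longrightarrow> br x y \<in> q"
    "q \<inter> conj_vfield ` q = {0}" "vfield.dim q = card RB div 2"
    using ex_half_dimensional_subalgebra by metis
  have qLC: "q \<subseteq> LC" using q(2) rb(3) by simp
  \<comment> \<open>On \<open>LC\<close> the abstract bracket is the bracket of vector fields, so
    closure of \<open>q\<close> carries over.\<close>
  have "bracket X Y \<in> q" if "X \<in> q" "Y \<in> q" for X Y
    using q(3)[OF that] br_eq[OF subsetD[OF qLC that(1)] subsetD[OF qLC that(2)]] by simp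
  note CR = CR_structure_of_subalgebra[OF q(1) qLC this q(4)]
  have d: "manifold_dim A = card RB" by (simp add: manifold_dim_def rb(4) onB(2))
  show ?thesis
  proof (intro conjI impI)
    assume "even (manifold_dim A)"
    then have "CR_codim A (vfield.dim q) = 0" by (auto simp: CR_codim_def d q(5) elim: evenE)
    then show "\<exists>H. complex_structure A H \<and> left_invariant A mul H"
      using CR unfolding complex_structure_def by blast
  next
    assume "odd (manifold_dim A)"
    then have "CR_codim A (vfield.dim q) = 1" by (auto simp: CR_codim_def d q(5) elim: oddE)
    then show "\<exists>H. hypersurface_CR_structure A H \<and> left_invariant A mul H"
      using CR unfolding hypersurface_CR_structure_def by blast
  qed
qed

end
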